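(* Let $\mathcal{C}$ be a group-like monoidal groupoid with invariants the abelian groups $\pi_0(\mathcal{C})=B$ and $\pi_1(\mathcal{C},I)=\mathrm{Aut}_{\mathcal{C}}(I)=A$, such that the $B$-module structure on $A$ is trivial, and whose associated trilinear map $$\varphi_{\mathcal{C}}(x,y,z)=\frac{f(x,y,z)\,f(z,x,y)\,f(y,z,x)}{f(x,z,y)\,f(z,y,x)\,f(y,x,z)}$$ (where $f$ is a 3-cocycle describing $\mathcal{C}$) is trivial. Suppose that the associated commutator biextension $E$ of $B\times B$ by $A$ is trivial as an alternating biextension. Then the monoidal structure on $\mathcal{C}$ is trivial.
   Context: $A$ is written multiplicatively, $B$ additively; these are abstract abelian groups. A group-like monoidal groupoid is a monoidal category $\mathcal{C}$ (tensor product written $XY$, unit $I$, associativity isomorphisms $a_{X,Y,Z}:X(YZ)\to(XY)Z$) in which all arrows are invertible and each object is invertible up to isomorphism. $\pi_0(\mathcal{C})$ is the group of isomorphism classes of objects. Each $\mathrm{Aut}(X)$ is identified with $A$ by $a\mapsto a\otimes X$; then $a\mapsto X\otimes a$ defines the action on $A$ of the class of $X$ in $B$. Cocycle: choose objects $X_x$ of class $x$ and arrows $c_{x,y}:X_xX_y\to X_{x+y}$; $f(x,y,z)\in\mathrm{Aut}(X_{x+y+z})=A$ is defined by $c_{x+y,z}\circ(c_{x,y}X_z)\circ a_{x,y,z}=f(x,y,z)\circ c_{x,y+z}\circ(X_xc_{y,z})$. The monoidal structure on $\mathcal{C}$ is trivial when the class of $f$ in $H^3(B,A)$ is zero, i.e.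 $\mathcal{C}$ is monoidally equivalent to the monoidal groupoid with object set $B$, with $\mathrm{Aut}(x)=A$ for all $x$ and no arrows between distinct objects, tensor product given by the group laws of $B$ and $A$, and identity associativity. Commutator: the $A$-torsor $E$ on $B\times B$ with fibres $E_{x,y}=\mathrm{Isom}_{\mathcal{C}}(X_yX_x,X_xX_y)$, with partial laws: for $u\in E_{x,y}$, $v\in E_{x',y}$, $u\stackrel{1}{+}v\in E_{x+x',y}$ is $$X_yX_{x+x'}\to X_y(X_xX_{x'})\to(X_yX_x)X_{x'}\xrightarrow{u}(X_xX_y)X_{x'}\to X_x(X_yX_{x'})\xrightarrow{v}X_x(X_{x'}X_y)\to(X_xX_{x'})X_y\to X_{x+x'}X_y;$$ for $u\in E_{x,y}$, $w\in E_{x,y'}$, $u\stackrel{2}{+}w\in E_{x,y+y'}$ is $$X_{y+y'}X_x\to(X_yX_{y'})X_x\to X_y(X_{y'}X_x)\xrightarrow{w}X_y(X_xX_{y'})\to(X_yX_x)X_{y'}\xrightarrow{u}(X_xX_y)X_{y'}\to X_x(X_yX_{y'})\to X_xX_{y+y'}$$ (unlabelled arrows: associativity isomorphisms, and arrows induced by $c^{\pm1}$ at the ends). When $\varphi_{\mathcal{C}}$ is trivial, $E$ is a biextension (both laws are associative, commutative and compatible with each other), and it is alternating, its alternating structure being the section $t(x)=1_{X_xX_x}\in E_{x,x}$ above the diagonal. $E$ is trivial as an alternating biextension when there is a section $s(x,y)\in E_{x,y}$, for all $x,y\in B$, with $s(x+x',y)=s(x,y)\stackrel{1}{+}s(x',y)$,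 $s(x,y+y')=s(x,y)\stackrel{2}{+}s(x,y')$ and $s(x,x)=t(x)$. *)

theory Defs
  imports "HOL-Algebra.Group"
begin

section \<open>Categories\<close>

record ('o, 'm) category =
  Obj :: "'o set"
  Arr :: "'m set"
  Dom :: "'m \<Rightarrow> 'o"
  Cod :: "'m \<Rightarrow> 'o"
  Ident :: "'o \<Rightarrow> 'm"
  Comp :: "'m \<Rightarrow> 'm \<Rightarrow> 'm" (infixr \<open>\<cdot>\<index>\<close> 65)

definition Hom :: "('o, 'm, 'z) category_scheme \<Rightarrow> 'o \<Rightarrow> 'o \<Rightarrow> 'm set" where
  "Hom C X Y = {u \<in> Arr C. Dom C u = X \<and> Cod C u = Y}"

locale category =
  fixes C :: "('o, 'm, 'z) category_scheme" (structure)
  assumes Dom_in_Obj: "u \<in> Arr C \<Longrightarrow> Dom C u \<in> Obj C"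
    and Cod_in_Obj: "u \<in> Arr C \<Longrightarrow> Cod C u \<in> Obj C"
    and Ident_in_Hom: "X \<in> Obj C \<Longrightarrow> Ident C X \<in> Hom C X X"
    and Comp_in_Hom: "\<lbrakk>u \<in> Hom C X Y; v \<in> Hom C Y Z\<rbrakk> \<Longrightarrow> v \<cdot> u \<in> Hom C X Z"
    and Comp_Ident: "u \<in> Hom C X Y \<Longrightarrow> u \<cdot> Ident C X = u"
    and Ident_Comp: "u \<in> Hom C X Y \<Longrightarrow> Ident C Y \<cdot> u = u"
    and Comp_assoc: "\<lbrakk>u \<in> Hom C W X; v \<in> Hom C X Y; w \<in> Hom C Y Z\<rbrakk>
      \<Longrightarrow> (w \<cdot> v) \<cdot> u = w \<cdot> (v \<cdot> u)"

definition inverse_arrows :: "('o, 'm, 'z) category_scheme \<Rightarrow> 'm \<Rightarrow> 'm \<Rightarrow> bool" where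
  "inverse_arrows C u v \<longleftrightarrow>
     u \<in> Arr C \<and> v \<in> Hom C (Cod C u) (Dom C u) \<and>
     v \<cdot>\<^bsub>C\<^esub> u = Ident C (Dom C u) \<and> u \<cdot>\<^bsub>C\<^esub> v = Ident C (Cod C u)"

definition inv_arr :: "('o, 'm, 'z) category_scheme \<Rightarrow> 'm \<Rightarrow> 'm" where
  "inv_arr C u = (THE v. inverse_arrows C u v)"

definition Isom :: "('o, 'm, 'z) category_scheme \<Rightarrow> 'o \<Rightarrow> 'o \<Rightarrow> 'm set" where
  "Isom C X Y = {u \<in> Hom C X Y. \<exists>v. inverse_arrows C u v}"

definition aut_group :: "('o, 'm, 'z) category_scheme \<Rightarrow> 'o \<Rightarrow> 'm monoid" where
  "aut_group C X = \<lparr>carrier = Isom C X X, mult = Comp C, one = Ident C X\<rparr>"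

definition iso_class :: "('o, 'm, 'z) category_scheme \<Rightarrow> 'o \<Rightarrow> 'o set" where
  "iso_class C X = {Y \<in> Obj C. Isom C X Y \<noteq> {}}"


section \<open>Monoidal categories\<close>

record ('o, 'm) monoidal_category = "('o, 'm) category" +
  TObj :: "'o \<Rightarrow> 'o \<Rightarrow> 'o" (infixl \<open>\<boxdot>\<index>\<close> 70)
  TArr :: "'m \<Rightarrow> 'm \<Rightarrow> 'm" (infixl \<open>\<boxtimes>\<index>\<close> 70)
  TUnit :: "'o"
  Assoc :: "'o \<Rightarrow> 'o \<Rightarrow> 'o \<Rightarrow> 'm"
  LUnit :: "'o \<Rightarrow> 'm"
  RUnit :: "'o \<Rightarrow> 'm"

text \<open>The associativity isomorphisms go from \<open>X(YZ)\<close> to \<open>(XY)Z\<close>; pentagon and triangle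
  are stated accordingly.\<close>

locale monoidal_category = category C
  for C :: "('o, 'm, 'z) monoidal_category_scheme" (structure) +
  assumes TUnit_in_Obj: "TUnit C \<in> Obj C"
    and TObj_in_Obj: "\<lbrakk>X \<in> Obj C; Y \<in> Obj C\<rbrakk> \<Longrightarrow> X \<boxdot> Y \<in> Obj C"
    and TArr_in_Hom: "\<lbrakk>u \<in> Hom C X X'; v \<in> Hom C Y Y'\<rbrakk>
      \<Longrightarrow> u \<boxtimes> v \<in> Hom C (X \<boxdot> Y) (X' \<boxdot> Y')"
    and TArr_Ident: "\<lbrakk>X \<in> Obj C; Y \<in> Obj C\<rbrakk>
      \<Longrightarrow> Ident C X \<boxtimes> Ident C Y = Ident C (X \<boxdot> Y)"
    and TArr_Comp: "\<lbrakk>u \<in> Hom C X X'; u' \<in> Hom C X' X''; v \<in> Hom C Y Y'; v' \<in> Hom C Y' Y''\<rbrakk>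
      \<Longrightarrow> (u' \<cdot> u) \<boxtimes> (v' \<cdot> v) = (u' \<boxtimes> v') \<cdot> (u \<boxtimes> v)"
    and Assoc_in_Isom: "\<lbrakk>X \<in> Obj C; Y \<in> Obj C; Z \<in> Obj C\<rbrakk>
      \<Longrightarrow> Assoc C X Y Z \<in> Isom C (X \<boxdot> (Y \<boxdot> Z)) ((X \<boxdot> Y) \<boxdot> Z)"
    and Assoc_natural: "\<lbrakk>u \<in> Hom C X X'; v \<in> Hom C Y Y'; w \<in> Hom C Z Z'\<rbrakk>
      \<Longrightarrow> Assoc C X' Y' Z' \<cdot> (u \<boxtimes> (v \<boxtimes> w)) = ((u \<boxtimes> v) \<boxtimes> w) \<cdot> Assoc C X Y Z"
    and LUnit_in_Isom: "X \<in> Obj C \<Longrightarrow> LUnit C X \<in> Isom C (TUnit C \<boxdot> X) X"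
    and LUnit_natural: "u \<in> Hom C X Y
      \<Longrightarrow> LUnit C Y \<cdot> (Ident C (TUnit C) \<boxtimes> u) = u \<cdot> LUnit C X"
    and RUnit_in_Isom: "X \<in> Obj C \<Longrightarrow> RUnit C X \<in> Isom C (X \<boxdot> TUnit C) X"
    and RUnit_natural: "u \<in> Hom C X Y
      \<Longrightarrow> RUnit C Y \<cdot> (u \<boxtimes> Ident C (TUnit C)) = u \<cdot> RUnit C X"
    and pentagon: "\<lbrakk>W \<in> Obj C; X \<in> Obj C; Y \<in> Obj C; Z \<in> Obj C\<rbrakk>
      \<Longrightarrow> Assoc C (W \<boxdot> X) Y Z \<cdot> Assoc C W X (Y \<boxdot> Z) =
          (Assoc C W X Y \<boxtimes> Ident C Z) \<cdot> Assoc C W (X \<boxdot> Y) Z \<cdot> (Ident C W \<boxtimes> Assoc C X Y Z)"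
    and triangle: "\<lbrakk>X \<in> Obj C; Y \<in> Obj C\<rbrakk>
      \<Longrightarrow> (RUnit C X \<boxtimes> Ident C Y) \<cdot> Assoc C X (TUnit C) Y = Ident C X \<boxtimes> LUnit C Y"

locale grouplike_monoidal_groupoid = monoidal_category +
  assumes all_invertible: "u \<in> Arr C \<Longrightarrow> \<exists>v. inverse_arrows C u v"
    and objects_invertible: "X \<in> Obj C \<Longrightarrow>
      \<exists>Y\<in>Obj C. Isom C (X \<boxdot> Y) (TUnit C) \<noteq> {} \<and> Isom C (Y \<boxdot> X) (TUnit C) \<noteq> {}"


section \<open>Monoidal equivalence\<close>

definition is_functor ::
  "('o, 'm, 'z) category_scheme \<Rightarrow> ('p, 'n, 'w) category_scheme
    \<Rightarrow> ('o \<Rightarrow> 'p) \<Rightarrow> ('m \<Rightarrow> 'n) \<Rightarrow> bool" where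
  "is_functor C D Fo Fa \<longleftrightarrow>
     (\<forall>X\<in>Obj C. Fo X \<in> Obj D) \<and>
     (\<forall>u\<in>Arr C. Fa u \<in> Hom D (Fo (Dom C u)) (Fo (Cod C u))) \<and>
     (\<forall>X\<in>Obj C. Fa (Ident C X) = Ident D (Fo X)) \<and>
     (\<forall>u\<in>Arr C. \<forall>v\<in>Arr C. Dom C v = Cod C u \<longrightarrow> Fa (v \<cdot>\<^bsub>C\<^esub> u) = Fa v \<cdot>\<^bsub>D\<^esub> Fa u)"

definition is_natural_iso ::
  "('o, 'm, 'z) category_scheme \<Rightarrow> ('p, 'n, 'w) category_scheme
    \<Rightarrow> ('o \<Rightarrow> 'p) \<Rightarrow> ('m \<Rightarrow> 'n) \<Rightarrow> ('o \<Rightarrow> 'p) \<Rightarrow> ('m \<Rightarrow> 'n) \<Rightarrow> ('o \<Rightarrow> 'n) \<Rightarrow> bool" where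
  "is_natural_iso C D Fo Fa Go Ga \<eta> \<longleftrightarrow>
     (\<forall>X\<in>Obj C. \<eta> X \<in> Isom D (Fo X) (Go X)) \<and>
     (\<forall>u\<in>Arr C. \<eta> (Cod C u) \<cdot>\<^bsub>D\<^esub> Fa u = Ga u \<cdot>\<^bsub>D\<^esub> \<eta> (Dom C u))"

definition is_equivalence ::
  "('o, 'm, 'z) category_scheme \<Rightarrow> ('p, 'n, 'w) category_scheme
    \<Rightarrow> ('o \<Rightarrow> 'p) \<Rightarrow> ('m \<Rightarrow> 'n) \<Rightarrow> bool" where
  "is_equivalence C D Fo Fa \<longleftrightarrow> is_functor C D Fo Fa \<and>
     (\<exists>Go Ga \<eta> \<epsilon>. is_functor D C Go Ga \<and>
        is_natural_iso C C (\<lambda>X. X) (\<lambda>u. u) (Go \<circ> Fo) (Ga \<circ> Fa) \<eta> \<and>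
        is_natural_iso D D (Fo \<circ> Go) (Fa \<circ> Ga) (\<lambda>Y. Y) (\<lambda>v. v) \<epsilon>)"

definition is_monoidal_functor ::
  "('o, 'm, 'z) monoidal_category_scheme \<Rightarrow> ('p, 'n, 'w) monoidal_category_scheme
    \<Rightarrow> ('o \<Rightarrow> 'p) \<Rightarrow> ('m \<Rightarrow> 'n) \<Rightarrow> ('o \<Rightarrow> 'o \<Rightarrow> 'n) \<Rightarrow> 'n \<Rightarrow> bool" where
  "is_monoidal_functor C D Fo Fa \<mu> \<iota> \<longleftrightarrow> is_functor C D Fo Fa \<and>
     (\<forall>X\<in>Obj C. \<forall>Y\<in>Obj C. \<mu> X Y \<in> Isom D (Fo X \<boxdot>\<^bsub>D\<^esub> Fo Y) (Fo (X \<boxdot>\<^bsub>C\<^esub> Y))) \<and>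
     \<iota> \<in> Isom D (TUnit D) (Fo (TUnit C)) \<and>
     (\<forall>u\<in>Arr C. \<forall>v\<in>Arr C.
        \<mu> (Cod C u) (Cod C v) \<cdot>\<^bsub>D\<^esub> (Fa u \<boxtimes>\<^bsub>D\<^esub> Fa v) =
        Fa (u \<boxtimes>\<^bsub>C\<^esub> v) \<cdot>\<^bsub>D\<^esub> \<mu> (Dom C u) (Dom C v)) \<and>
     (\<forall>X\<in>Obj C. \<forall>Y\<in>Obj C. \<forall>Z\<in>Obj C.
        Fa (Assoc C X Y Z) \<cdot>\<^bsub>D\<^esub> \<mu> X (Y \<boxdot>\<^bsub>C\<^esub> Z) \<cdot>\<^bsub>D\<^esub> (Ident D (Fo X) \<boxtimes>\<^bsub>D\<^esub> \<mu> Y Z) =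
        \<mu> (X \<boxdot>\<^bsub>C\<^esub> Y) Z \<cdot>\<^bsub>D\<^esub> (\<mu> X Y \<boxtimes>\<^bsub>D\<^esub> Ident D (Fo Z)) \<cdot>\<^bsub>D\<^esub> Assoc D (Fo X) (Fo Y) (Fo Z)) \<and>
     (\<forall>X\<in>Obj C.
        Fa (LUnit C X) \<cdot>\<^bsub>D\<^esub> \<mu> (TUnit C) X \<cdot>\<^bsub>D\<^esub> (\<iota> \<boxtimes>\<^bsub>D\<^esub> Ident D (Fo X)) = LUnit D (Fo X) \<and>
        Fa (RUnit C X) \<cdot>\<^bsub>D\<^esub> \<mu> X (TUnit C) \<cdot>\<^bsub>D\<^esub> (Ident D (Fo X) \<boxtimes>\<^bsub>D\<^esub> \<iota>) = RUnit D (Fo X))"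

definition monoidally_equivalent ::
  "('o, 'm, 'z) monoidal_category_scheme \<Rightarrow> ('p, 'n, 'w) monoidal_category_scheme \<Rightarrow> bool" where
  "monoidally_equivalent C D \<longleftrightarrow>
     (\<exists>Fo Fa \<mu> \<iota>. is_monoidal_functor C D Fo Fa \<mu> \<iota> \<and> is_equivalence C D Fo Fa)"

text \<open>The arrow \<open>(x, a)\<close> is the automorphism \<open>a\<close> of the object \<open>x\<close>.\<close>

definition trivial_monoidal_groupoid ::
  "('b, 'w) monoid_scheme \<Rightarrow> ('a, 'z) monoid_scheme \<Rightarrow> ('b, 'b \<times> 'a) monoidal_category" where
  "trivial_monoidal_groupoid B A =
    \<lparr>Obj = carrier B,
     Arr = carrier B \<times> carrier A,
     Dom = fst,
     Cod = fst,
     Ident = (\<lambda>x. (x, \<one>\<^bsub>A\<^esub>)),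
     Comp = (\<lambda>v u. (fst u, snd v \<otimes>\<^bsub>A\<^esub> snd u)),
     TObj = mult B,
     TArr = (\<lambda>u v. (fst u \<otimes>\<^bsub>B\<^esub> fst v, snd u \<otimes>\<^bsub>A\<^esub> snd v)),
     TUnit = \<one>\<^bsub>B\<^esub>,
     Assoc = (\<lambda>x y z. (x \<otimes>\<^bsub>B\<^esub> y \<otimes>\<^bsub>B\<^esub> z, \<one>\<^bsub>A\<^esub>)),
     LUnit = (\<lambda>x. (x, \<one>\<^bsub>A\<^esub>)),
     RUnit = (\<lambda>x. (x, \<one>\<^bsub>A\<^esub>))\<rparr>"


section \<open>Invariants of a group-like monoidal groupoid\<close>

definition pi0 :: "('o, 'm, 'z) monoidal_category_scheme \<Rightarrow> 'o set monoid" where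
  "pi0 C =
    \<lparr>carrier = iso_class C ` Obj C,
     mult = (\<lambda>S T. {Z \<in> Obj C. \<exists>X\<in>S. \<exists>Y\<in>T. Isom C (X \<boxdot>\<^bsub>C\<^esub> Y) Z \<noteq> {}}),
     one = iso_class C (TUnit C)\<rparr>"

definition pi1 :: "('o, 'm, 'z) monoidal_category_scheme \<Rightarrow> 'm monoid" where
  "pi1 C = aut_group C (TUnit C)"

text \<open>For \<open>a\<close> in \<open>Aut(I)\<close>, the automorphisms \<open>a \<otimes> X\<close> and \<open>X \<otimes> a\<close> of \<open>X\<close>: as \<open>C\<close> need not be
  strictly unital, they are transported from \<open>IX\<close> and \<open>XI\<close> to \<open>X\<close> along the unit isomorphisms.\<close>

definition left_aut :: "('o, 'm, 'z) monoidal_category_scheme \<Rightarrow> 'o \<Rightarrow> 'm \<Rightarrow> 'm" where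
  "left_aut C X a = LUnit C X \<cdot>\<^bsub>C\<^esub> (a \<boxtimes>\<^bsub>C\<^esub> Ident C X) \<cdot>\<^bsub>C\<^esub> inv_arr C (LUnit C X)"

definition right_aut :: "('o, 'm, 'z) monoidal_category_scheme \<Rightarrow> 'o \<Rightarrow> 'm \<Rightarrow> 'm" where
  "right_aut C X a = RUnit C X \<cdot>\<^bsub>C\<^esub> (Ident C X \<boxtimes>\<^bsub>C\<^esub> a) \<cdot>\<^bsub>C\<^esub> inv_arr C (RUnit C X)"

text \<open>From here on, \<open>A\<close> and \<open>B\<close> are abstract groups (\<open>B\<close> is additive on paper, but uses the
  notation of \<^locale>\<open>group\<close> here) with identifications \<open>\<alpha> : A \<cong> Aut(I)\<close> and \<open>\<beta> : \<pi>\<^sub>0(C) \<cong> B\<close>.\<close>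

definition module_action ::
  "('o, 'm, 'z) monoidal_category_scheme \<Rightarrow> ('a, 'v) monoid_scheme
    \<Rightarrow> ('a \<Rightarrow> 'm) \<Rightarrow> ('o set \<Rightarrow> 'b) \<Rightarrow> 'b \<Rightarrow> 'a \<Rightarrow> 'a" where
  "module_action C A \<alpha> \<beta> x a =
     (THE a'. a' \<in> carrier A \<and>
        (\<forall>X\<in>Obj C. \<beta> (iso_class C X) = x \<longrightarrow> left_aut C X (\<alpha> a') = right_aut C X (\<alpha> a)))"

text \<open>A choice of objects \<open>X x\<close> of class \<open>x\<close> and of arrows \<open>c x y : X x X y \<rightarrow> X (x + y)\<close>;
  no normalization is required.\<close>

definition cocycle_data ::
  "('o, 'm, 'z) monoidal_category_scheme \<Rightarrow> ('b, 'w) monoid_scheme \<Rightarrow> ('o set \<Rightarrow> 'b)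
    \<Rightarrow> ('b \<Rightarrow> 'o) \<Rightarrow> ('b \<Rightarrow> 'b \<Rightarrow> 'm) \<Rightarrow> bool" where
  "cocycle_data C B \<beta> X c \<longleftrightarrow>
     (\<forall>x\<in>carrier B. X x \<in> Obj C \<and> \<beta> (iso_class C (X x)) = x) \<and>
     (\<forall>x\<in>carrier B. \<forall>y\<in>carrier B. c x y \<in> Hom C (X x \<boxdot>\<^bsub>C\<^esub> X y) (X (x \<otimes>\<^bsub>B\<^esub> y)))"

definition cocycle ::
  "('o, 'm, 'z) monoidal_category_scheme \<Rightarrow> ('a, 'v) monoid_scheme \<Rightarrow> ('b, 'w) monoid_scheme
    \<Rightarrow> ('a \<Rightarrow> 'm) \<Rightarrow> ('b \<Rightarrow> 'o) \<Rightarrow> ('b \<Rightarrow> 'b \<Rightarrow> 'm) \<Rightarrow> 'b \<Rightarrow> 'b \<Rightarrow> 'b \<Rightarrow> 'a" where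
  "cocycle C A B \<alpha> X c x y z =
     (THE a. a \<in> carrier A \<and>
        c (x \<otimes>\<^bsub>B\<^esub> y) z \<cdot>\<^bsub>C\<^esub> (c x y \<boxtimes>\<^bsub>C\<^esub> Ident C (X z)) \<cdot>\<^bsub>C\<^esub> Assoc C (X x) (X y) (X z) =
        left_aut C (X (x \<otimes>\<^bsub>B\<^esub> y \<otimes>\<^bsub>B\<^esub> z)) (\<alpha> a) \<cdot>\<^bsub>C\<^esub>
          c x (y \<otimes>\<^bsub>B\<^esub> z) \<cdot>\<^bsub>C\<^esub> (Ident C (X x) \<boxtimes>\<^bsub>C\<^esub> c y z))"

definition phi ::
  "('a, 'v) monoid_scheme \<Rightarrow> ('b \<Rightarrow> 'b \<Rightarrow> 'b \<Rightarrow> 'a) \<Rightarrow> 'b \<Rightarrow> 'b \<Rightarrow> 'b \<Rightarrow> 'a" where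
  "phi A f x y z =
     (f x y z \<otimes>\<^bsub>A\<^esub> f z x y \<otimes>\<^bsub>A\<^esub> f y z x) \<otimes>\<^bsub>A\<^esub> inv\<^bsub>A\<^esub> (f x z y \<otimes>\<^bsub>A\<^esub> f z y x \<otimes>\<^bsub>A\<^esub> f y x z)"

text \<open>The class of \<open>f\<close> in \<open>H\<^sup>3(B, A)\<close> is zero, where \<open>A\<close> has trivial \<open>B\<close>-action:
  \<open>f\<close> is the coboundary of an inhomogeneous 2-cochain.\<close>

definition coboundary3 ::
  "('a, 'v) monoid_scheme \<Rightarrow> ('b, 'w) monoid_scheme \<Rightarrow> ('b \<Rightarrow> 'b \<Rightarrow> 'b \<Rightarrow> 'a) \<Rightarrow> bool" where
  "coboundary3 A B f \<longleftrightarrow>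
     (\<exists>h \<in> carrier B \<rightarrow> carrier B \<rightarrow> carrier A.
        \<forall>x\<in>carrier B. \<forall>y\<in>carrier B. \<forall>z\<in>carrier B.
          f x y z = h y z \<otimes>\<^bsub>A\<^esub> inv\<^bsub>A\<^esub> h (x \<otimes>\<^bsub>B\<^esub> y) z \<otimes>\<^bsub>A\<^esub> h x (y \<otimes>\<^bsub>B\<^esub> z) \<otimes>\<^bsub>A\<^esub> inv\<^bsub>A\<^esub> h x y)"


section \<open>The commutator biextension\<close>

text \<open>Compositions are read from right to left, so the first arrow of each chain comes last.\<close>

definition commutator_fibre ::
  "('o, 'm, 'z) monoidal_category_scheme \<Rightarrow> ('b \<Rightarrow> 'o) \<Rightarrow> 'b \<Rightarrow> 'b \<Rightarrow> 'm set" where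
  "commutator_fibre C X x y = Isom C (X y \<boxdot>\<^bsub>C\<^esub> X x) (X x \<boxdot>\<^bsub>C\<^esub> X y)"

definition commutator_plus1 ::
  "('o, 'm, 'z) monoidal_category_scheme \<Rightarrow> ('b \<Rightarrow> 'o) \<Rightarrow> ('b \<Rightarrow> 'b \<Rightarrow> 'm)
    \<Rightarrow> 'b \<Rightarrow> 'b \<Rightarrow> 'b \<Rightarrow> 'm \<Rightarrow> 'm \<Rightarrow> 'm" where
  "commutator_plus1 C X c x x' y u v =
     (c x x' \<boxtimes>\<^bsub>C\<^esub> Ident C (X y)) \<cdot>\<^bsub>C\<^esub>
     Assoc C (X x) (X x') (X y) \<cdot>\<^bsub>C\<^esub>
     (Ident C (X x) \<boxtimes>\<^bsub>C\<^esub> v) \<cdot>\<^bsub>C\<^esub>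
     inv_arr C (Assoc C (X x) (X y) (X x')) \<cdot>\<^bsub>C\<^esub>
     (u \<boxtimes>\<^bsub>C\<^esub> Ident C (X x')) \<cdot>\<^bsub>C\<^esub>
     Assoc C (X y) (X x) (X x') \<cdot>\<^bsub>C\<^esub>
     (Ident C (X y) \<boxtimes>\<^bsub>C\<^esub> inv_arr C (c x x'))"

definition commutator_plus2 ::
  "('o, 'm, 'z) monoidal_category_scheme \<Rightarrow> ('b \<Rightarrow> 'o) \<Rightarrow> ('b \<Rightarrow> 'b \<Rightarrow> 'm)
    \<Rightarrow> 'b \<Rightarrow> 'b \<Rightarrow> 'b \<Rightarrow> 'm \<Rightarrow> 'm \<Rightarrow> 'm" where
  "commutator_plus2 C X c x y y' u w =
     (Ident C (X x) \<boxtimes>\<^bsub>C\<^esub> c y y') \<cdot>\<^bsub>C\<^esub>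
     inv_arr C (Assoc C (X x) (X y) (X y')) \<cdot>\<^bsub>C\<^esub>
     (u \<boxtimes>\<^bsub>C\<^esub> Ident C (X y')) \<cdot>\<^bsub>C\<^esub>
     Assoc C (X y) (X x) (X y') \<cdot>\<^bsub>C\<^esub>
     (Ident C (X y) \<boxtimes>\<^bsub>C\<^esub> w) \<cdot>\<^bsub>C\<^esub>
     inv_arr C (Assoc C (X y) (X y') (X x)) \<cdot>\<^bsub>C\<^esub>
     (inv_arr C (c y y') \<boxtimes>\<^bsub>C\<^esub> Ident C (X x))"

definition commutator_diagonal ::
  "('o, 'm, 'z) monoidal_category_scheme \<Rightarrow> ('b \<Rightarrow> 'o) \<Rightarrow> 'b \<Rightarrow> 'm" where
  "commutator_diagonal C X x = Ident C (X x \<boxdot>\<^bsub>C\<^esub> X x)"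

definition trivial_alternating ::
  "('o, 'm, 'z) monoidal_category_scheme \<Rightarrow> ('b, 'w) monoid_scheme
    \<Rightarrow> ('b \<Rightarrow> 'o) \<Rightarrow> ('b \<Rightarrow> 'b \<Rightarrow> 'm) \<Rightarrow> bool" where
  "trivial_alternating C B X c \<longleftrightarrow>
     (\<exists>s. (\<forall>x\<in>carrier B. \<forall>y\<in>carrier B. s x y \<in> commutator_fibre C X x y) \<and>
          (\<forall>x\<in>carrier B. \<forall>x'\<in>carrier B. \<forall>y\<in>carrier B.
             s (x \<otimes>\<^bsub>B\<^esub> x') y = commutator_plus1 C X c x x' y (s x y) (s x' y)) \<and>
          (\<forall>x\<in>carrier B. \<forall>y\<in>carrier B. \<forall>y'\<in>carrier B.
             s x (y \<otimes>\<^bsub>B\<^esub> y') = commutator_plus2 C X c x y y' (s x y) (s x y')) \<and>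
          (\<forall>x\<in>carrier B. s x x = commutator_diagonal C X x))"

end

(* The section s of the commutator biextension is a braiding of the monoidal groupoid, and it is the
   identity on every X_x X_x. In terms of the cocycle f and of the elements sigma(x,y) of A measuring s,
   the pentagon and the two hexagons say that (f, sigma) is an abelian 3-cocycle on B with
   sigma(x,x) = 1. Such a cocycle is trivial, as Ext^2(B, A) = 0 over the integers: it becomes a
   coboundary on the free abelian group P generated by B (one adds the generators one by one), the
   trivialisation restricts to a symmetric 2-cocycle on the kernel K of P -> B, this is a coboundary
   because K is free, and after correcting by it the trivialisation descends to B. Once f = 1, the
   arrows Z -> X_x yield the monoidal equivalence. *)

theory Submission
  imports Defs "HOL-Algebra.Free_Abelian_Groups"
begin

section \<open>Subgroups and abelian 3-cocycles\<close>

text \<open>The map sending x to sigma(x,x) is quadratic and is, by Eilenberg and Mac Lane, the only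
  invariant of an abelian 3-cocycle up to coboundary; the alternating condition says that it
  vanishes. In B itself generators cannot be added one by one: a new generator may satisfy a
  relation, and the recursion defining the correcting cochain along its multiples would have to
  close up. This is why the argument moves to P, where each step adds an infinite cyclic summand.
  The price is that a trivialisation on P need not be constant on cosets of K. Its restriction to K
  is a symmetric 2-cocycle because the normalised pullback of f vanishes as soon as its first
  argument lies in K, and the pullback of sigma vanishes on K x K. That K is free is not quoted:
  both inductions run over the intersections of a subgroup with Z[T], T a set of generators, and a
  new generator contributes an infinite cyclic summand or nothing.\<close>

definition add_subgroup :: "'g::ab_group_add set \<Rightarrow> bool" where
  "add_subgroup S \<longleftrightarrow> 0 \<in> S \<and> (\<forall>x\<in>S. \<forall>y\<in>S. x - y \<in> S)"

lemma add_subgroup_zero: "add_subgroup S \<Longrightarrow> 0 \<in> S"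
  and add_subgroup_diff: "\<lbrakk>add_subgroup S; x \<in> S; y \<in> S\<rbrakk> \<Longrightarrow> x - y \<in> S"
  by (auto simp: add_subgroup_def)

lemma add_subgroup_minus: "\<lbrakk>add_subgroup S; x \<in> S\<rbrakk> \<Longrightarrow> - x \<in> S"
  using add_subgroup_diff[of S 0 x] add_subgroup_zero by auto

lemma add_subgroup_add: "\<lbrakk>add_subgroup S; x \<in> S; y \<in> S\<rbrakk> \<Longrightarrow> x + y \<in> S"
  using add_subgroup_diff[of S x "- y"] add_subgroup_minus by auto

lemma add_subgroup_frag_cmul:
  assumes "add_subgroup S" "x \<in> S"
  shows "frag_cmul k x \<in> S"
  by (rule frag_closure_minus_cmul) (use assms in \<open>auto simp: add_subgroup_def\<close>)

text \<open>The coefficient group of the cocycles is \<open>'m\<close> modulo \<open>N\<close>. A group given by its carrier is presented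
  as a quotient of a free abelian group, so that the arithmetic takes place in a type class.\<close>

locale modulus =
  fixes N :: "'m::ab_group_add set"
  assumes subgroup_N: "add_subgroup N"
begin

lemma N_zero [simp]: "0 \<in> N"
  using subgroup_N by (rule add_subgroup_zero)

lemma N_diff: "x \<in> N \<Longrightarrow> y \<in> N \<Longrightarrow> x - y \<in> N"
  and N_add: "x \<in> N \<Longrightarrow> y \<in> N \<Longrightarrow> x + y \<in> N"
  using subgroup_N by (auto intro: add_subgroup_diff add_subgroup_add)

lemma N_minus [simp]: "- x \<in> N \<longleftrightarrow> x \<in> N"
  using add_subgroup_minus[OF subgroup_N, of x] add_subgroup_minus[OF subgroup_N, of "- x"] by auto

text \<open>As conditional rewrite rules these let the simplifier erase from a sum every summand
  known to lie in \<open>N\<close>; most membership goals below are settled this way.\<close>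

lemma N_cancel:
  assumes "x \<in> N"
  shows "x + y \<in> N \<longleftrightarrow> y \<in> N" "y + x \<in> N \<longleftrightarrow> y \<in> N"
    "x - y \<in> N \<longleftrightarrow> y \<in> N" "y - x \<in> N \<longleftrightarrow> y \<in> N"
proof -
  show 1: "x + y \<in> N \<longleftrightarrow> y \<in> N"
    using N_add[OF assms, of y] N_diff[OF _ assms, of "x + y"] by auto
  then show "y + x \<in> N \<longleftrightarrow> y \<in> N" by (simp add: add.commute)
  show "y - x \<in> N \<longleftrightarrow> y \<in> N"
    using N_add[OF _ assms, of "y - x"] N_diff[OF _ assms, of y] by auto
  then show "x - y \<in> N \<longleftrightarrow> y \<in> N" using N_minus[of "y - x"] by simp
qed

lemma N_cancel_left:
  assumes "x \<in> N"
  shows "y + x + z \<in> N \<longleftrightarrow> y + z \<in> N" "y - x + z \<in> N \<longleftrightarrow> y + z \<in> N"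
    "y + x - z \<in> N \<longleftrightarrow> y - z \<in> N" "y - x - z \<in> N \<longleftrightarrow> y - z \<in> N"
  using N_cancel[OF assms, of "y + z"] N_cancel[OF assms, of "y - z"]
  by (simp_all add: algebra_simps)

lemma N_commute: "x - y \<in> N \<longleftrightarrow> y - x \<in> N"
  using N_minus[of "x - y"] by simp

end

text \<open>\<open>gauge3 f h\<close> and \<open>gauge2 s h\<close> are, in additive notation, what
  the cocycle and the braiding become when every arrow \<open>c x y\<close> is multiplied by
  \<open>h x y\<close>. Thus \<open>gauge3 f h\<close> vanishes exactly when \<open>h\<close>
  witnesses that \<open>f\<close> is a coboundary.\<close>

definition gauge3 :: "('p::plus \<Rightarrow> 'p \<Rightarrow> 'p \<Rightarrow> 'm::ab_group_add) \<Rightarrow> ('p \<Rightarrow> 'p \<Rightarrow> 'm) \<Rightarrow> 'p \<Rightarrow> 'p \<Rightarrow> 'p \<Rightarrow> 'm" where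
  "gauge3 f h x y z = f x y z - (h y z - h (x + y) z + h x (y + z) - h x y)"

definition gauge2 :: "('p \<Rightarrow> 'p \<Rightarrow> 'm::ab_group_add) \<Rightarrow> ('p \<Rightarrow> 'p \<Rightarrow> 'm) \<Rightarrow> 'p \<Rightarrow> 'p \<Rightarrow> 'm" where
  "gauge2 s h x y = s x y + h x y - h y x"

lemma gauge3_gauge3: "gauge3 (gauge3 f g) h = gauge3 f (\<lambda>x y. g x y + h x y)"
  and gauge2_gauge2: "gauge2 (gauge2 s g) h = gauge2 s (\<lambda>x y. g x y + h x y)"
  by (auto simp: gauge3_def gauge2_def fun_eq_iff algebra_simps)

text \<open>Eilenberg and Mac Lane's relations for abelian 3-cocycles modulo \<open>N\<close>,
  together with the vanishing of the quadratic map \<open>s x x\<close>. The arguments range over a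
  whole type, so no carrier conditions arise.\<close>

locale abelian_3cocycle = modulus N
  for N :: "'m::ab_group_add set" +
  fixes f :: "'p::ab_group_add \<Rightarrow> 'p \<Rightarrow> 'p \<Rightarrow> 'm" and s :: "'p \<Rightarrow> 'p \<Rightarrow> 'm"
  assumes pentagon_rel: "f x y z - f (w + x) y z + f w (x + y) z - f w x (y + z) + f w x y \<in> N"
    and hexagon1_rel: "s (x + x') y - s x y - s x' y - (f x x' y - f x y x' + f y x x') \<in> N"
    and hexagon2_rel: "s x (y + y') - s x y - s x y' + (f x y y' - f y x y' + f y y' x) \<in> N"
    and diagonal_rel: "s x x \<in> N"
begin

lemma abelian_3cocycle_gauge: "abelian_3cocycle N (gauge3 f h) (gauge2 s h)"
proof
  fix w x y z
  have "gauge3 f h x y z - gauge3 f h (w + x) y z + gauge3 f h w (x + y) z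
      - gauge3 f h w x (y + z) + gauge3 f h w x y
    = f x y z - f (w + x) y z + f w (x + y) z - f w x (y + z) + f w x y"
    by (simp add: gauge3_def algebra_simps)
  then show "gauge3 f h x y z - gauge3 f h (w + x) y z + gauge3 f h w (x + y) z
      - gauge3 f h w x (y + z) + gauge3 f h w x y \<in> N"
    using pentagon_rel[of x y z w] by simp
next
  fix x x' y
  have "gauge2 s h (x + x') y - gauge2 s h x y - gauge2 s h x' y
      - (gauge3 f h x x' y - gauge3 f h x y x' + gauge3 f h y x x')
    = s (x + x') y - s x y - s x' y - (f x x' y - f x y x' + f y x x')"
    by (simp add: gauge3_def gauge2_def algebra_simps)
  then show "gauge2 s h (x + x') y - gauge2 s h x y - gauge2 s h x' y
      - (gauge3 f h x x' y - gauge3 f h x y x' + gauge3 f h y x x') \<in> N"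
    using hexagon1_rel[of x x' y] by simp
next
  fix x y y'
  have "gauge2 s h x (y + y') - gauge2 s h x y - gauge2 s h x y'
      + (gauge3 f h x y y' - gauge3 f h y x y' + gauge3 f h y y' x)
    = s x (y + y') - s x y - s x y' + (f x y y' - f y x y' + f y y' x)"
    by (simp add: gauge3_def gauge2_def algebra_simps)
  then show "gauge2 s h x (y + y') - gauge2 s h x y - gauge2 s h x y'
      + (gauge3 f h x y y' - gauge3 f h y x y' + gauge3 f h y y' x) \<in> N"
    using hexagon2_rel[of x y y'] by simp
qed (use diagonal_rel in \<open>simp add: gauge2_def\<close>)

definition normalised :: bool where
  "normalised \<longleftrightarrow> (\<forall>x y. f 0 x y \<in> N \<and> f x 0 y \<in> N \<and> f x y 0 \<in> N)"

definition vanishes_on :: "'p set \<Rightarrow> bool" where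
  "vanishes_on H \<longleftrightarrow> (\<forall>x\<in>H. \<forall>y\<in>H. s x y \<in> N \<and> (\<forall>z\<in>H. f x y z \<in> N))"

end

text \<open>The pentagon with two leading zeros gives
  \<open>f 0 y z = f 0 0 (y + z) - f 0 0 y\<close> modulo \<open>N\<close>, which is the value at
  \<open>0 y z\<close> of the coboundary of \<open>f 0 0 y\<close>; the other end is symmetric and
  explains the term \<open>f x 0 0\<close>. Once both ends vanish, the pentagon forces the middle
  one to vanish.\<close>

lemma (in abelian_3cocycle) normalised_gauge:
  "abelian_3cocycle.normalised N (gauge3 f (\<lambda>x y. f 0 0 y - f x 0 0))"
proof -
  let ?g = "\<lambda>x y. f 0 0 y - f x 0 0"
  have 1: "gauge3 f ?g 0 y z \<in> N" for y z
  proof -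
    have "gauge3 f ?g 0 y z
      = f 0 y z - f (0 + 0) y z + f 0 (0 + y) z - f 0 0 (y + z) + f 0 0 y"
      by (simp add: gauge3_def algebra_simps)
    then show ?thesis using pentagon_rel[of 0 y z 0] by simp
  qed
  have 2: "gauge3 f ?g x y 0 \<in> N" for x y
  proof -
    have "gauge3 f ?g x y 0
      = f y 0 0 - f (x + y) 0 0 + f x (y + 0) 0 - f x y (0 + 0) + f x y 0"
      by (simp add: gauge3_def algebra_simps)
    then show ?thesis using pentagon_rel[of y 0 0 x] by simp
  qed
  interpret G: abelian_3cocycle N "gauge3 f ?g" "gauge2 s ?g"
    by (rule abelian_3cocycle_gauge)
  have "gauge3 f ?g x 0 z \<in> N" for x z
    using G.pentagon_rel[of 0 0 z x] by (simp add: 1 2 N_cancel)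
  with 1 2 show ?thesis by (simp add: G.normalised_def)
qed

section \<open>Splitting off an infinite cyclic summand\<close>

lemma int_recursion:
  fixes r :: "int \<Rightarrow> 'm::ab_group_add"
  obtains E where "E 0 = 0" "\<And>k. E (k + 1) = E k + r k"
proof -
  \<comment> \<open>Below zero the recursion is run backwards, so \<open>E k\<close> is minus the
    sum of \<open>r (- 1)\<close> down to \<open>r k\<close>.\<close>
  define E where "E k = (if 0 \<le> k then \<Sum>i<nat k. r (int i) else - (\<Sum>i<nat (- k). r (- 1 - int i)))" for k
  have "E 0 = 0" by (simp add: E_def)
  moreover have "E (k + 1) = E k + r k" for k
  proof (cases "0 \<le> k")
    case True
    then have "nat (k + 1) = Suc (nat k)" by simp
    with True show ?thesis by (simp add: E_def)
  next
    case False
    then have n: "nat (- k) = Suc (nat (- (k + 1)))" and k: "- 1 - int (nat (- (k + 1))) = k" by auto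
    show ?thesis
    proof (cases "k = - 1")
      case True
      then show ?thesis by (simp add: E_def)
    next
      case False
      with \<open>\<not> 0 \<le> k\<close> have "\<not> 0 \<le> k + 1" by simp
      with \<open>\<not> 0 \<le> k\<close> show ?thesis
        by (simp only: E_def n k if_False sum.lessThan_Suc) simp
    qed
  qed
  ultimately show ?thesis by (rule that)
qed

text \<open>\<open>G\<close> is the internal direct sum of \<open>H\<close> and the infinite cyclic
  group \<open>range l\<close>, and \<open>j\<close> is the coordinate on the latter. Giving
  \<open>l\<close> and \<open>j\<close> as functions lets cochains on \<open>G\<close> be defined by
  formulas in the two components.\<close>

locale cyclic_extension =
  fixes G H :: "'p::ab_group_add set" and l :: "int \<Rightarrow> 'p" and j :: "'p \<Rightarrow> int"
  assumes subgroup_G: "add_subgroup G" and subgroup_H: "add_subgroup H"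
    and H_le_G: "H \<subseteq> G"
    and l_in_G: "l a \<in> G"
    and l_add: "l (a + b) = l a + l b"
    and j_l: "j (l a) = a"
    and j_H: "x \<in> H \<Longrightarrow> j x = 0"
    and j_add: "x \<in> G \<Longrightarrow> y \<in> G \<Longrightarrow> j (x + y) = j x + j y"
    and diff_in_H: "x \<in> G \<Longrightarrow> x - l (j x) \<in> H"
begin

lemma l_zero [simp]: "l 0 = 0"
  using l_add[of 0 0] by simp

lemma H_range_l: "x \<in> H \<Longrightarrow> x \<in> range l \<Longrightarrow> x = 0"
  using j_H j_l l_zero by (metis imageE)

lemma decompose:
  assumes "x \<in> G"
  obtains u a where "u \<in> H" "x = u + l a"
  using diff_in_H[OF assms] by (metis diff_add_cancel)

lemma j_decompose: "u \<in> H \<Longrightarrow> j (u + l a) = a"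
  using j_add[of u "l a"] l_in_G H_le_G by (auto simp: j_H j_l)

text \<open>The step is an equivalence, so that one case serves for going up and for going down from
  0.\<close>

lemma range_l_induct [consumes 1, case_names zero step]:
  assumes "x \<in> range l"
    and "P 0"
    and step: "\<And>y. y \<in> range l \<Longrightarrow> P (l 1 + y) \<longleftrightarrow> P y"
  shows "P x"
proof -
  have "P (l a)" for a
  proof (induction a rule: int_induct[where k = 0])
    case base
    then show ?case using assms by simp
  next
    case (step1 i)
    then show ?case using step[of "l i"] by (simp add: l_add add.commute)
  next
    case (step2 i)
    then show ?case using step[of "l (i - 1)"] l_add[of 1 "i - 1"] by simp
  qed
  then show ?thesis using assms(1) by auto
qed

end

locale abelian_3cocycle_cyclic_extension = abelian_3cocycle N f s + cyclic_extension G H l j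
  for N :: "'m::ab_group_add set"
    and f :: "'p::ab_group_add \<Rightarrow> 'p \<Rightarrow> 'p \<Rightarrow> 'm" and s :: "'p \<Rightarrow> 'p \<Rightarrow> 'm"
    and G H :: "'p set" and l :: "int \<Rightarrow> 'p" and j :: "'p \<Rightarrow> int" +
  assumes f_normalised: normalised
begin

lemma f_zero [simp]: "f 0 x y \<in> N" "f x 0 y \<in> N" "f x y 0 \<in> N"
  using f_normalised by (auto simp: normalised_def)

lemma s_zero [simp]: "s 0 x \<in> N" "s x 0 \<in> N"
  using hexagon1_rel[of 0 0 x] hexagon2_rel[of x 0 0] by (simp_all add: N_cancel)

text \<open>The gauge makes \<open>f (l 1)\<close> vanish on the cyclic group; by the pentagon the set of \<open>x\<close> with
  \<open>f x = 0\<close> is a subgroup, and then \<open>s\<close> is bilinear, hence determined by \<open>s (l 1) (l 1)\<close>.\<close>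

lemma vanishing_gauge_cyclic:
  obtains g where "\<And>x y. (x, y) \<notin> range l \<times> range l \<Longrightarrow> g x y = 0"
    "\<And>x. g 0 x \<in> N \<and> g x 0 \<in> N" "g 0 0 = 0"
    "abelian_3cocycle.vanishes_on N (gauge3 f g) (gauge2 s g) (range l)"
proof -
  \<comment> \<open>Solving \<open>gauge3 f g (l 1) x y = 0\<close> with \<open>g (l 1)\<close>
    trivial gives \<open>g (l 1 + x) y = g x y - f (l 1) x y\<close>: for each \<open>y\<close> a
    recursion along the multiples of the generator, started at 0.\<close>
  have "\<exists>E. E 0 = 0 \<and> (\<forall>a. E (a + 1) = E a + - f (l 1) (l a) y)" for y
    by (rule int_recursion[of "\<lambda>a. - f (l 1) (l a) y"]) auto
  then obtain E where E_0: "\<And>y. E y 0 = 0"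
    and E_Suc: "\<And>y a. E y (a + 1) = E y a + - f (l 1) (l a) y" by metis
  define g where "g x y = (if x \<in> range l \<and> y \<in> range l then E y (j x) else 0)" for x y
  have g_l: "g (l a) (l b) = E (l b) a" for a b by (simp add: g_def j_l)
  have g_Suc: "g (l 1 + x) y = g x y - f (l 1) x y" if "x \<in> range l" "y \<in> range l" for x y
  proof -
    obtain a b where ab: "x = l a" "y = l b" using \<open>x \<in> range l\<close> \<open>y \<in> range l\<close> by blast
    have "l 1 + x = l (a + 1)" by (simp add: ab l_add add.commute)
    then show ?thesis unfolding ab using g_l E_Suc[of "l b" a] by simp
  qed
  have g_0l: "g 0 x = 0" for x
  proof -
    have "j 0 = 0" using j_l[of 0] by simp
    then show ?thesis by (simp add: g_def E_0)
  qed
  have g_0r: "g x 0 \<in> N" for x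
  proof (cases "x \<in> range l")
    case True
    have l0: "0 \<in> range l" using l_zero by (metis rangeI)
    from True show ?thesis
    proof (induction rule: range_l_induct)
      case zero
      show ?case by (simp add: g_0l)
    next
      case (step y)
      then show ?case by (simp add: g_Suc l0 N_cancel)
    qed
  qed (simp add: g_def)
  have g_1: "g (l 1) y = 0 - f (l 1) 0 y" if "y \<in> range l" for y
    using g_Suc[of 0 y] that g_0l by (metis add.right_neutral l_zero rangeI)
  have sum_l: "x + y \<in> range l" if "x \<in> range l" "y \<in> range l" for x y
    using that by (auto simp flip: l_add)
  interpret K: abelian_3cocycle N "gauge3 f g" "gauge2 s g"
    by (rule abelian_3cocycle_gauge)
  have f1: "gauge3 f g (l 1) x y \<in> N" if "x \<in> range l" "y \<in> range l" for x y
    using that by (simp add: gauge3_def g_Suc g_1 sum_l N_cancel)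
  have fx: "gauge3 f g x y z \<in> N" if "x \<in> range l" "y \<in> range l" "z \<in> range l" for x y z
    using that(1,2,3)
  proof (induction arbitrary: y z rule: range_l_induct)
    case zero
    then show ?case by (simp add: gauge3_def g_0l N_cancel)
  next
    case (step x)
    have "gauge3 f g (l 1 + x) y z \<in> N \<longleftrightarrow> gauge3 f g x y z \<in> N"
      if "y \<in> range l" "z \<in> range l" for y z
    proof -
      have "gauge3 f g x y z - gauge3 f g (l 1 + x) y z \<in> N"
        using K.pentagon_rel[of x y z "l 1"] f1 that step
        by (simp add: sum_l N_cancel)
      then show ?thesis by (metis N_cancel(3,4) N_commute)
    qed
    then show ?case by (metis)
  qed
  have "gauge2 s g x y \<in> N" if "x \<in> range l" "y \<in> range l" for x y
  proof -
    \<comment> \<open>The diagonal relation at the generator supplies the one value on which the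
      bilinear \<open>s\<close> depends.\<close>
    have s1: "gauge2 s g (l 1) y \<in> N" if "y \<in> range l" for y
      using that
    proof (induction rule: range_l_induct)
      case (step y)
      have "gauge2 s g (l 1) (l 1 + y) - gauge2 s g (l 1) y \<in> N"
        using K.hexagon2_rel[of "l 1" "l 1" y] fx step K.diagonal_rel[of "l 1"]
        by (simp add: N_cancel N_cancel_left)
      then show ?case by (metis N_cancel(3,4) N_commute)
    qed (simp add: gauge2_def g_0l g_0r N_cancel)
    from that show ?thesis
    proof (induction arbitrary: y rule: range_l_induct)
      case (step x)
      have "gauge2 s g (l 1 + x) y - gauge2 s g x y \<in> N" if "y \<in> range l" for y
        using K.hexagon1_rel[of "l 1" x y] fx step s1 that
        by (simp add: N_cancel N_cancel_left)
      then show ?case by (metis N_cancel(3,4) N_commute)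
    qed (simp add: gauge2_def g_0l g_0r N_cancel)
  qed
  with fx have "K.vanishes_on (range l)" by (simp add: K.vanishes_on_def)
  moreover have "g x y = 0" if "(x, y) \<notin> range l \<times> range l" for x y
    using that by (auto simp: g_def)
  ultimately show ?thesis
    using that[of g] g_0l g_0r by simp
qed

lemma (in modulus) five_term:
  assumes "a - b + c - d + e \<in> N"
  shows "b \<in> N \<Longrightarrow> c \<in> N \<Longrightarrow> d \<in> N \<Longrightarrow> e \<in> N \<Longrightarrow> a \<in> N"
    and "a \<in> N \<Longrightarrow> c \<in> N \<Longrightarrow> d \<in> N \<Longrightarrow> e \<in> N \<Longrightarrow> b \<in> N"
    and "a \<in> N \<Longrightarrow> b \<in> N \<Longrightarrow> d \<in> N \<Longrightarrow> e \<in> N \<Longrightarrow> c \<in> N"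
    and "a \<in> N \<Longrightarrow> b \<in> N \<Longrightarrow> c \<in> N \<Longrightarrow> e \<in> N \<Longrightarrow> d \<in> N"
  using assms by (simp_all add: N_cancel)

text \<open>The value of \<open>h\<close> is forced by \<open>h u k = 0\<close> for \<open>u\<close> in \<open>H\<close> and \<open>k\<close> in the cyclic group:
  it expresses the passage from \<open>(u k) (v m)\<close> to \<open>(u v) (k m)\<close> by associators and the braiding.\<close>

lemma vanishing_gauge_sum:
  assumes "vanishes_on H" and "vanishes_on (range l)"
  obtains h where "\<And>x y. x \<in> H \<Longrightarrow> y \<in> H \<Longrightarrow> h x y \<in> N"
    "\<And>x. h 0 x \<in> N \<and> h x 0 \<in> N"
    "abelian_3cocycle.vanishes_on N (gauge3 f h) (gauge2 s h) G"
proof -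
  define q where "q x = l (j x)" for x
  define p where "p x = x - q x" for x
  \<comment> \<open>For \<open>x = u + k\<close> and \<open>y = v + m\<close> the five terms, taken
    in the order last, first, second, third, fourth, follow the path (uk)(vm) -> u(k(vm)) ->
    u((kv)m) -> u((vk)m) -> u(v(km)) -> (uv)(km).\<close>
  define h where "h x y = f (q x) (p y) (q y) - s (q x) (p y) - f (p y) (q x) (q y)
    + f (p x) (p y) (q x + q y) - f (p x) (q x) y" for x y
  have fH [simp]: "f x y z \<in> N" "s x y \<in> N" if "x \<in> H" "y \<in> H" "z \<in> H" for x y z
    using assms(1) that by (auto simp: vanishes_on_def)
  have fL [simp]: "f x y z \<in> N" "s x y \<in> N" if "x \<in> range l" "y \<in> range l" "z \<in> range l" for x y z
    using assms(2) that by (auto simp: vanishes_on_def)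
  have H0 [simp]: "0 \<in> H" using subgroup_H by (rule add_subgroup_zero)
  have Hadd [simp]: "x + y \<in> H" if "x \<in> H" "y \<in> H" for x y
    using subgroup_H that by (rule add_subgroup_add)
  have L0 [simp]: "0 \<in> range l" using l_zero by (metis rangeI)
  have Ladd [simp]: "x + y \<in> range l" if "x \<in> range l" "y \<in> range l" for x y
    using that by (auto simp flip: l_add)
  have pq: "p (u + k) = u" "q (u + k) = k" if "u \<in> H" "k \<in> range l" for u k
    using that j_decompose by (auto simp: p_def q_def)
  have h_sum: "h (u + k) (v + m) = f k v m - s k v - f v k m + f u v (k + m) - f u k (v + m)"
    if "u \<in> H" "k \<in> range l" "v \<in> H" "m \<in> range l" for u k v m
    using that by (simp add: h_def pq)
  have h_uv [simp]: "h u v \<in> N" if "u \<in> H" "v \<in> H" for u v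
    using h_sum[of u 0 v 0] that by (simp add: N_cancel)
  have h_km [simp]: "h k m \<in> N" if "k \<in> range l" "m \<in> range l" for k m
    using h_sum[of 0 k 0 m] that by (simp add: N_cancel)
  have h_um [simp]: "h u m \<in> N" if "u \<in> H" "m \<in> range l" for u m
    using h_sum[of u 0 0 m] that by (simp add: N_cancel)
  have h_kv: "h k v + s k v \<in> N" if "v \<in> H" "k \<in> range l" for k v
    using h_sum[of 0 k v 0] that by (simp add: N_cancel)
  have h_uvm: "h u (v + m) - f u v m \<in> N" if "u \<in> H" "v \<in> H" "m \<in> range l" for u v m
    using h_sum[of u 0 v m] that by (simp add: N_cancel)
  have h_kvm: "h k (v + m) - (f k v m - s k v - f v k m) \<in> N"
    if "k \<in> range l" "v \<in> H" "m \<in> range l" for k v m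
    using h_sum[of 0 k v m] that by (simp add: N_cancel)
  have h_ukm: "h (u + k) m + f u k m \<in> N" if "u \<in> H" "k \<in> range l" "m \<in> range l" for u k m
    using h_sum[of u k 0 m] that by (simp add: N_cancel)
  define F S where "F = gauge3 f h" and "S = gauge2 s h"
  interpret K: abelian_3cocycle N F S
    unfolding F_def S_def by (rule abelian_3cocycle_gauge)
  have F_uvw [simp]: "F u v w \<in> N" if "u \<in> H" "v \<in> H" "w \<in> H" for u v w
    using that by (simp add: F_def gauge3_def N_cancel)
  have F_klm [simp]: "F k m n \<in> N" if "k \<in> range l" "m \<in> range l" "n \<in> range l" for k m n
    using that by (simp add: F_def gauge3_def N_cancel)
  \<comment> \<open>Together with the two facts above, the next three cases come from expanding
    \<open>h\<close>. They are the seeds from which all other values of \<open>F\<close> are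
    reached.\<close>
  have F_uky: "F u k y \<in> N" if "u \<in> H" "k \<in> range l" "y \<in> G" for u k y
  proof -
    obtain v a where v: "v \<in> H" and y: "y = v + l a" using decompose \<open>y \<in> G\<close> by blast
    have "F u k (v + l a) = (h u k - (h k (v + l a) - (f k v (l a) - s k v - f v k (l a))))
      - (h u (v + (k + l a)) - f u v (k + l a))"
      using that v h_sum[of u k v "l a"] by (simp add: F_def gauge3_def algebra_simps)
    then show ?thesis
      using h_kvm[of k v "l a"] h_uvm[of u v "k + l a"] that v by (simp add: y N_cancel)
  qed
  have F_uvm: "F u v m \<in> N" if "u \<in> H" "v \<in> H" "m \<in> range l" for u v m
  proof -
    have "F u v m = (h u v - h v m + h (u + v) m) - (h u (v + m) - f u v m)"
      by (simp add: F_def gauge3_def algebra_simps)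
    then show ?thesis using h_uvm[of u v m] that by (simp add: N_cancel)
  qed
  have F_kvm: "F k v m \<in> N" if "k \<in> range l" "v \<in> H" "m \<in> range l" for k v m
  proof -
    have "F k v m = (h k v + s k v) - h v m + (h (v + k) m + f v k m)
      - (h k (v + m) - (f k v m - s k v - f v k m))"
      by (simp add: F_def gauge3_def algebra_simps)
    then show ?thesis
      by (simp only:) (intro N_diff[OF N_add[OF N_diff[OF h_kv h_um] h_ukm] h_kvm] that)
  qed
  have S_uv [simp]: "S u v \<in> N" if "u \<in> H" "v \<in> H" for u v
    using that by (simp add: S_def gauge2_def N_cancel)
  have S_km [simp]: "S k m \<in> N" if "k \<in> range l" "m \<in> range l" for k m
    using that by (simp add: S_def gauge2_def N_cancel)
  have S_kv [simp]: "S k v \<in> N" if "k \<in> range l" "v \<in> H" for k v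
  proof -
    have "S k v = (h k v + s k v) - h v k"
      by (simp add: S_def gauge2_def algebra_simps)
    then show ?thesis by (simp only:) (intro N_diff h_kv h_um that)
  qed
  have GH [simp]: "u \<in> G" if "u \<in> H" for u using H_le_G that by blast
  have GL [simp]: "k \<in> G" if "k \<in> range l" for k using l_in_G that by blast
  have Gadd [simp]: "x + y \<in> G" if "x \<in> G" "y \<in> G" for x y
    using subgroup_G that by (rule add_subgroup_add)
  have decomp: thesis if "y \<in> G" "\<And>u k. y = u + k \<Longrightarrow> u \<in> H \<Longrightarrow> k \<in> range l \<Longrightarrow> thesis" for y thesis
    by (rule decompose[OF that(1)]) (rule that(2), assumption+, rule rangeI)

  \<comment> \<open>From here on the vanishing of \<open>F\<close> is propagated by the relations
    themselves: each pentagon is chosen so that four of its five terms are already known.\<close>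
  have F_u: "F u y z \<in> N" if "u \<in> H" "y \<in> G" "z \<in> G" for u y z
  proof -
    have F_uvwm: "F u v (w + m) \<in> N" if "v \<in> H" "w \<in> H" "m \<in> range l" for v w m
      by (rule five_term(4)[OF K.pentagon_rel[of v w m u]]) (use that \<open>u \<in> H\<close> in \<open>simp_all add: F_uvm\<close>)
    obtain v k where y: "y = v + k" "v \<in> H" "k \<in> range l"
      by (rule decomp[OF \<open>y \<in> G\<close>])
    obtain w m where z: "z = w + m" "w \<in> H" "m \<in> range l"
      by (rule decomp[OF \<open>z \<in> G\<close>])
    have "F u v (k + z) \<in> N"
      unfolding z(1) add.left_commute[of k w m] using F_uvwm[of v w "k + m"] y z by simp
    then show ?thesis unfolding y(1)
      by (intro five_term(3)[OF K.pentagon_rel[of v k z u]]) (use y that in \<open>simp_all add: F_uvm F_uky\<close>)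
  qed
  have F_shift: "F (v + x) y z \<in> N" if "F x y z \<in> N" "v \<in> H" "x \<in> G" "y \<in> G" "z \<in> G" for v x y z
    by (rule five_term(2)[OF K.pentagon_rel[of x y z v]]) (use that in \<open>simp_all add: F_u\<close>)
  \<comment> \<open>The braiding enters here: \<open>S k _\<close> vanishes on \<open>H\<close> by
    the choice of \<open>h\<close>, so the hexagon that moves \<open>k\<close> past \<open>v\<close>
    and \<open>w\<close> expresses this value through two values of \<open>F\<close> with first
    argument in \<open>H\<close>.\<close>
  have F_kvw: "F k v w \<in> N" if "k \<in> range l" "v \<in> H" "w \<in> H" for k v w
    using K.hexagon2_rel[of k v w] that F_u[of v k w] F_u[of v w k] by (simp add: N_cancel)
  have F_kv: "F k v z \<in> N" if "k \<in> range l" "v \<in> H" "z \<in> G" for k v z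
  proof -
    obtain w m where z: "z = w + m" "w \<in> H" "m \<in> range l"
      by (rule decomp[OF \<open>z \<in> G\<close>])
    have "F (k + v) w m \<in> N"
      unfolding add.commute[of k v] by (rule F_shift) (use that z in \<open>simp_all add: F_kvm\<close>)
    then show ?thesis unfolding z(1)
      by (intro five_term(4)[OF K.pentagon_rel[of v w m k]]) (use z that in \<open>simp_all add: F_u F_kvm F_kvw\<close>)
  qed
  have F_km: "F k m z \<in> N" if "k \<in> range l" "m \<in> range l" "z \<in> G" for k m z
  proof -
    obtain w n where z: "z = w + n" "w \<in> H" "n \<in> range l"
      by (rule decomp[OF \<open>z \<in> G\<close>])
    have F_kmw: "F k m w \<in> N"
      using K.hexagon1_rel[of k m w] that z F_kv[of k w m] F_u[of w k m] by (simp add: N_cancel)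
    have "F (k + w) m n \<in> N"
      unfolding add.commute[of k w] by (rule F_shift) (use that z in simp_all)
    then have "F k (w + m) n \<in> N"
      by (intro five_term(3)[OF K.pentagon_rel[of w m n k]]) (use z that in \<open>simp_all add: F_u F_kvm\<close>)
    then have "F k (m + w) n \<in> N" by (simp only: add.commute[of w m])
    then show ?thesis unfolding z(1)
      by (intro five_term(4)[OF K.pentagon_rel[of m w n k]]) (use z that F_kmw in \<open>simp_all add: F_kvm\<close>)
  qed
  have F_k: "F k y z \<in> N" if "k \<in> range l" "y \<in> G" "z \<in> G" for k y z
  proof -
    obtain v m where y: "y = v + m" "v \<in> H" "m \<in> range l"
      by (rule decomp[OF \<open>y \<in> G\<close>])
    have "F (k + v) m z \<in> N"
      unfolding add.commute[of k v] by (rule F_shift) (use that y in \<open>simp_all add: F_km\<close>)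
    then show ?thesis unfolding y(1)
      by (intro five_term(3)[OF K.pentagon_rel[of v m z k]]) (use y that in \<open>simp_all add: F_u F_kv\<close>)
  qed
  have F_G: "F x y z \<in> N" if "x \<in> G" "y \<in> G" "z \<in> G" for x y z
  proof -
    obtain u k where x: "x = u + k" "u \<in> H" "k \<in> range l"
      by (rule decomp[OF \<open>x \<in> G\<close>])
    then show ?thesis using that F_shift F_k by simp
  qed
  have S_add: "S (x + x') y - S x y - S x' y \<in> N" if "x \<in> G" "x' \<in> G" "y \<in> G" for x x' y
    using K.hexagon1_rel[of x x' y] F_G that by (simp add: N_cancel)
  have S_add2: "S x (y + y') - S x y - S x y' \<in> N" if "x \<in> G" "y \<in> G" "y' \<in> G" for x y y'
    using K.hexagon2_rel[of x y y'] F_G that by (simp add: N_cancel)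
  have S_add_N: "S (x + x') y \<in> N" if "S x y \<in> N" "S x' y \<in> N" "x \<in> G" "x' \<in> G" "y \<in> G" for x x' y
    using S_add[of x x' y] that by (simp add: N_cancel)
  have S_add2_N: "S x (y + y') \<in> N" if "S x y \<in> N" "S x y' \<in> N" "x \<in> G" "y \<in> G" "y' \<in> G" for x y y'
    using S_add2[of x y y'] that by (simp add: N_cancel)
  \<comment> \<open>The choice of \<open>h\<close> makes \<open>S k v\<close> vanish, but not the
    opposite order. As \<open>S\<close> is now bilinear, the diagonal relation at
    \<open>v + k\<close> turns one into the other.\<close>
  have S_vk: "S v k \<in> N" if "v \<in> H" "k \<in> range l" for v k
  proof -
    have "S k (v + k) \<in> N" using that by (intro S_add2_N) simp_all
    then have "S v (v + k) \<in> N"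
      using S_add[of v k "v + k"] K.diagonal_rel[of "v + k"] that by (simp add: N_cancel)
    then show ?thesis
      using S_add2[of v v k] that by (simp add: N_cancel)
  qed
  have S_G: "S x y \<in> N" if "x \<in> G" "y \<in> G" for x y
  proof -
    obtain u k where x: "x = u + k" "u \<in> H" "k \<in> range l"
      by (rule decomp[OF \<open>x \<in> G\<close>])
    obtain v m where y: "y = v + m" "v \<in> H" "m \<in> range l"
      by (rule decomp[OF \<open>y \<in> G\<close>])
    have "S u y \<in> N" "S k y \<in> N"
      unfolding y(1) using S_vk x y by (auto intro!: S_add2_N)
    then show ?thesis using S_add_N x that by simp
  qed
  have "K.vanishes_on G" using F_G S_G by (simp add: K.vanishes_on_def)
  moreover have "h 0 x \<in> N \<and> h x 0 \<in> N" for x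
  proof -
    have "q 0 = 0" "p 0 = 0" using pq[of 0 0] by auto
    then show ?thesis by (simp add: h_def N_cancel)
  qed
  ultimately show ?thesis
    using that[of h] by (simp add: F_def S_def)
qed

end

section \<open>Extending a trivialisation by one generator\<close>

context abelian_3cocycle
begin

lemma normalised_gauge_normalised:
  assumes "normalised" "\<And>x. h 0 x \<in> N" "\<And>x. h x 0 \<in> N"
  shows "abelian_3cocycle.normalised N (gauge3 f h)"
proof -
  interpret K: abelian_3cocycle N "gauge3 f h" "gauge2 s h"
    by (rule abelian_3cocycle_gauge)
  show ?thesis
    using assms by (simp add: normalised_def K.normalised_def gauge3_def N_cancel)
qed

lemma vanishes_on_gauge_iff:
  "abelian_3cocycle.vanishes_on N (gauge3 f h) (gauge2 s h) G \<longleftrightarrow>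
    (\<forall>x\<in>G. \<forall>y\<in>G. gauge2 s h x y \<in> N \<and> (\<forall>z\<in>G. gauge3 f h x y z \<in> N))"
proof -
  interpret K: abelian_3cocycle N "gauge3 f h" "gauge2 s h"
    by (rule abelian_3cocycle_gauge)
  show ?thesis by (rule K.vanishes_on_def)
qed

lemma vanishes_on_gauge_cong:
  assumes "abelian_3cocycle.vanishes_on N (gauge3 f h) (gauge2 s h) G" "add_subgroup G"
    and h: "\<And>x y. x \<in> G \<Longrightarrow> y \<in> G \<Longrightarrow> h' x y - h x y \<in> N"
  shows "abelian_3cocycle.vanishes_on N (gauge3 f h') (gauge2 s h') G"
proof -
  have "gauge2 s h' x y \<in> N" if "x \<in> G" "y \<in> G" for x y
  proof -
    have "gauge2 s h' x y = gauge2 s h x y + (h' x y - h x y) - (h' y x - h y x)"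
      by (simp add: gauge2_def algebra_simps)
    also have "\<dots> \<in> N"
      using assms that unfolding vanishes_on_gauge_iff by (intro N_diff N_add h) auto
    finally show ?thesis .
  qed
  moreover have "gauge3 f h' x y z \<in> N" if "x \<in> G" "y \<in> G" "z \<in> G" for x y z
  proof -
    have "gauge3 f h' x y z = gauge3 f h x y z - (h' y z - h y z) + (h' (x + y) z - h (x + y) z)
      - (h' x (y + z) - h x (y + z)) + (h' x y - h x y)"
      by (simp add: gauge3_def algebra_simps)
    also have "\<dots> \<in> N"
      using assms(1) that add_subgroup_add[OF assms(2)] unfolding vanishes_on_gauge_iff
      by (intro N_diff N_add h) auto
    finally show ?thesis .
  qed
  ultimately show ?thesis by (simp add: vanishes_on_gauge_iff)
qed

end

text \<open>Three corrections are composed: \<open>h\<close> itself, one for the cyclic group and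
  one for the sum. The second is zero on \<open>H\<close>, since \<open>H\<close> meets the cyclic
  group only in 0, and the third lies in \<open>N\<close> there. The result must equal
  \<open>h\<close> on \<open>H\<close> exactly, not just modulo \<open>N\<close>, so that the
  functions along a chain can be glued.\<close>

lemma (in abelian_3cocycle_cyclic_extension) extend_trivialisation:
  assumes van: "abelian_3cocycle.vanishes_on N (gauge3 f h) (gauge2 s h) H"
    and h_zero: "\<And>x. x \<in> H \<Longrightarrow> h 0 x \<in> N \<and> h x 0 \<in> N"
  obtains h' where "\<And>x y. x \<in> H \<Longrightarrow> y \<in> H \<Longrightarrow> h' x y = h x y"
    "\<And>x. h' 0 x \<in> N \<and> h' x 0 \<in> N"
    "abelian_3cocycle.vanishes_on N (gauge3 f h') (gauge2 s h') G"
proof -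
  \<comment> \<open>Cutting \<open>h\<close> off outside \<open>H\<close> makes its normalisation at
    0 hold for all arguments, as the following gauge steps require.\<close>
  define h0 where "h0 x y = (if x \<in> H \<and> y \<in> H then h x y else 0)" for x y
  have H0: "0 \<in> H" using subgroup_H by (rule add_subgroup_zero)
  have h0_zero: "h0 0 x \<in> N" "h0 x 0 \<in> N" for x
    using h_zero by (auto simp: h0_def)
  have van0: "abelian_3cocycle.vanishes_on N (gauge3 f h0) (gauge2 s h0) H"
    using van subgroup_H by (rule vanishes_on_gauge_cong) (simp add: h0_def)
  interpret I1: abelian_3cocycle N "gauge3 f h0" "gauge2 s h0"
    by (rule abelian_3cocycle_gauge)
  interpret I1: abelian_3cocycle_cyclic_extension N "gauge3 f h0" "gauge2 s h0" G H l j
    by unfold_locales (rule normalised_gauge_normalised[where h = h0, OF f_normalised h0_zero])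
  obtain g where g: "\<And>x y. (x, y) \<notin> range l \<times> range l \<Longrightarrow> g x y = 0"
    "\<And>x. g 0 x \<in> N \<and> g x 0 \<in> N" "g 0 0 = 0"
    and van_L: "abelian_3cocycle.vanishes_on N (gauge3 (gauge3 f h0) g) (gauge2 (gauge2 s h0) g) (range l)"
    by (rule I1.vanishing_gauge_cyclic) blast
  have gH: "g x y = 0" if "x \<in> H" "y \<in> H" for x y
    using g(1)[of x y] g(3) H_range_l[OF that(1)] H_range_l[OF that(2)]
    by (cases "(x, y) \<in> range l \<times> range l") auto
  interpret I2: abelian_3cocycle N "gauge3 (gauge3 f h0) g" "gauge2 (gauge2 s h0) g"
    by (rule I1.abelian_3cocycle_gauge)
  interpret I2: abelian_3cocycle_cyclic_extension N "gauge3 (gauge3 f h0) g" "gauge2 (gauge2 s h0) g" G H l j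
    by unfold_locales (rule I1.normalised_gauge_normalised[OF I1.f_normalised], use g(2) in auto)
  have "gauge3 (gauge3 f h0) g x y z = gauge3 f h0 x y z" if "x \<in> H" "y \<in> H" "z \<in> H" for x y z
    using that subgroup_H by (simp add: gauge3_def gH add_subgroup_add)
  moreover have "gauge2 (gauge2 s h0) g x y = gauge2 s h0 x y" if "x \<in> H" "y \<in> H" for x y
    using that by (simp add: gauge2_def gH)
  ultimately have "I2.vanishes_on H"
    using van0 by (simp add: I1.vanishes_on_def I2.vanishes_on_def)
  then obtain k where kH: "\<And>x y. x \<in> H \<Longrightarrow> y \<in> H \<Longrightarrow> k x y \<in> N"
    and k0: "\<And>x. k 0 x \<in> N \<and> k x 0 \<in> N"
    and van_G: "abelian_3cocycle.vanishes_on N (gauge3 (gauge3 (gauge3 f h0) g) k)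
      (gauge2 (gauge2 (gauge2 s h0) g) k) G"
    using I2.vanishing_gauge_sum[OF _ van_L] by blast
  define h1 where "h1 x y = h0 x y + g x y + k x y" for x y
  define h' where "h' x y = (if x \<in> H \<and> y \<in> H then h x y else h1 x y)" for x y
  have "abelian_3cocycle.vanishes_on N (gauge3 f h1) (gauge2 s h1) G"
    using van_G by (simp add: gauge3_gauge3 gauge2_gauge2 h1_def[abs_def] add.assoc)
  then have "abelian_3cocycle.vanishes_on N (gauge3 f h') (gauge2 s h') G"
    using subgroup_G
    by (rule vanishes_on_gauge_cong) (auto simp: h'_def h1_def h0_def gH kH)
  moreover have "h' 0 x \<in> N \<and> h' x 0 \<in> N" for x
    using h_zero[of x] h0_zero[of x] g(2)[of x] k0[of x] by (simp add: h'_def h1_def H0 N_cancel)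
  ultimately show ?thesis using that[of h'] by (simp add: h'_def)
qed

section \<open>Extension along free abelian groups\<close>

lemma lookup_eq_zero_of_keys: "Poly_Mapping.keys x \<subseteq> T \<Longrightarrow> b \<notin> T \<Longrightarrow> Poly_Mapping.lookup x b = 0"
  by (auto simp: in_keys_iff)

lemma add_subgroup_keys:
  assumes K: "add_subgroup K"
  shows "add_subgroup {x \<in> K. Poly_Mapping.keys x \<subseteq> T}"
proof -
  have "x - y \<in> K \<and> Poly_Mapping.keys (x - y) \<subseteq> T"
    if "x \<in> K \<and> Poly_Mapping.keys x \<subseteq> T" "y \<in> K \<and> Poly_Mapping.keys y \<subseteq> T" for x y
    using that add_subgroup_diff[OF K, of x y] keys_diff[of x y] by blast
  then show ?thesis
    using add_subgroup_zero[OF K] by (simp add: add_subgroup_def)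
qed

text \<open>The coefficients at \<open>b\<close> of the elements supported in
  \<open>insert b T\<close> form a nonzero subgroup of the integers, generated by its least positive
  element \<open>n\<close>. An element \<open>g\<close> with coefficient \<open>n\<close> generates
  a complement: \<open>l\<close> takes multiples of \<open>g\<close>, and \<open>j\<close> is the
  coefficient divided by \<open>n\<close>.\<close>

lemma cyclic_extension_coordinate:
  fixes K :: "('b \<Rightarrow>\<^sub>0 int) set"
  assumes K: "add_subgroup K" and "b \<notin> T"
    and ex: "\<exists>x\<in>K. Poly_Mapping.keys x \<subseteq> insert b T \<and> Poly_Mapping.lookup x b \<noteq> 0"
  shows "\<exists>l j. cyclic_extension {x \<in> K. Poly_Mapping.keys x \<subseteq> insert b T} {x \<in> K. Poly_Mapping.keys x \<subseteq> T} l j"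
proof -
  define KT where "KT T = {x \<in> K. Poly_Mapping.keys x \<subseteq> T}" for T
  let ?G = "KT (insert b T)" and ?v = "\<lambda>x :: 'b \<Rightarrow>\<^sub>0 int. Poly_Mapping.lookup x b"
  have KT: "add_subgroup (KT T)" for T
    unfolding KT_def using K by (rule add_subgroup_keys)
  define P where "P n \<longleftrightarrow> 0 < n \<and> (\<exists>x\<in>?G. ?v x = int n)" for n
  have "\<exists>n. P n"
  proof -
    obtain x where x: "x \<in> ?G" "?v x \<noteq> 0" using ex by (auto simp: KT_def)
    have "- x \<in> ?G" using KT x(1) by (rule add_subgroup_minus)
    obtain y where "y \<in> ?G" "0 < ?v y"
    proof (cases "0 < ?v x")
      case True
      with x(1) show ?thesis by (rule that)
    next
      case False
      with x(2) have "0 < ?v (- x)" by simp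
      with \<open>- x \<in> ?G\<close> show ?thesis by (rule that)
    qed
    then have "P (nat (?v y))" unfolding P_def by (intro conjI bexI[of _ y]) auto
    then show ?thesis ..
  qed
  define n where "n = (LEAST n. P n)"
  have "P n" unfolding n_def using \<open>\<exists>n. P n\<close> by (rule LeastI_ex)
  have min: "n \<le> m" if "P m" for m unfolding n_def using that by (rule Least_le)
  obtain g where g: "g \<in> ?G" "?v g = int n" and n: "0 < n" using \<open>P n\<close> unfolding P_def by blast
  define l where "l a = frag_cmul a g" for a
  have l_G: "l a \<in> ?G" for a
    unfolding l_def by (rule add_subgroup_frag_cmul[OF KT g(1)])
  have v_l: "?v (l a) = a * int n" for a by (simp add: l_def g)
  have dvd: "int n dvd ?v x" if "x \<in> ?G" for x
  proof -
    let ?y = "x - l (?v x div int n)"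
    have "?y \<in> ?G" using add_subgroup_diff[OF KT that l_G] .
    moreover have v: "?v ?y = ?v x mod int n"
      by (simp add: lookup_minus v_l minus_div_mult_eq_mod)
    moreover have "0 \<le> ?v x mod int n" "?v x mod int n < int n" using n by simp_all
    moreover have "P (nat (?v x mod int n))" if "0 < ?v x mod int n"
      unfolding P_def using that \<open>?y \<in> ?G\<close> v by (intro conjI bexI[of _ ?y]) auto
    ultimately have "?v x mod int n = 0"
      using min[of "nat (?v x mod int n)"] by linarith
    then show ?thesis by (simp add: dvd_eq_mod_eq_0)
  qed
  have "cyclic_extension ?G (KT T) l (\<lambda>x. ?v x div int n)"
  proof
    show "x \<in> KT T \<Longrightarrow> ?v x div int n = 0" for x
      using lookup_eq_zero_of_keys[of x T b] \<open>b \<notin> T\<close> by (simp add: KT_def)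
    show "?v (x + y) div int n = ?v x div int n + ?v y div int n" if "x \<in> ?G" "y \<in> ?G" for x y
      using dvd[OF that(1)] by (simp add: lookup_add div_plus_div_distrib_dvd_left)
    show "x - l (?v x div int n) \<in> KT T" if "x \<in> ?G" for x
    proof -
      have "x - l (?v x div int n) \<in> ?G" using add_subgroup_diff[OF KT that l_G] .
      moreover have "?v (x - l (?v x div int n)) = 0"
        using dvd[OF that] by (simp add: lookup_minus v_l)
      ultimately show ?thesis by (auto simp: KT_def in_keys_iff)
    qed
    show "?v (l a) div int n = a" for a using n by (simp add: v_l)
  qed (use KT l_G in \<open>auto simp: KT_def l_def frag_cmul_distrib\<close>)
  then show ?thesis unfolding KT_def by blast
qed

lemma ex_mem_chain:
  assumes "\<And>S S'. S \<in> \<C> \<Longrightarrow> S' \<in> \<C> \<Longrightarrow> S \<subseteq> S' \<or> S' \<subseteq> S" "\<C> \<noteq> {}" "finite F" "F \<subseteq> \<Union>\<C>"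
  shows "\<exists>S\<in>\<C>. F \<subseteq> S"
  using assms(3,4)
proof (induction F)
  case empty
  with assms(2) show ?case by auto
next
  case (insert x F)
  then obtain S S' where "S \<in> \<C>" "F \<subseteq> S" "S' \<in> \<C>" "x \<in> S'" by auto
  with assms(1)[of S S'] show ?case by (metis insert_subset subset_iff)
qed

text \<open>Zorn's lemma over the sets \<open>T\<close> of generators: an extension property for infinite cyclic steps
  propagates to every subgroup \<open>K\<close> of a free abelian group along \<open>K \<inter> \<int>[T]\<close>.\<close>

lemma free_abelian_subgroup_extension:
  fixes K :: "('b \<Rightarrow>\<^sub>0 int) set"
    and Q :: "('b \<Rightarrow>\<^sub>0 int) set \<Rightarrow> ('c \<Rightarrow> 'm) \<Rightarrow> bool" and D :: "('b \<Rightarrow>\<^sub>0 int) set \<Rightarrow> 'c set"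
  assumes K: "add_subgroup K"
    and base: "Q {0} h0"
    and step: "\<And>G H l j h. cyclic_extension G H l j \<Longrightarrow> Q H h \<Longrightarrow>
      \<exists>h'. Q G h' \<and> (\<forall>t\<in>D H. h' t = h t)"
    and cong: "\<And>G h h'. \<lbrakk>add_subgroup G; Q G h; \<And>t. t \<in> D G \<Longrightarrow> h' t = h t\<rbrakk> \<Longrightarrow> Q G h'"
    and mono: "\<And>G H. H \<subseteq> G \<Longrightarrow> D H \<subseteq> D G"
    and directed: "\<And>\<G> h. \<lbrakk>\<G> \<noteq> {}; \<And>G H. G \<in> \<G> \<Longrightarrow> H \<in> \<G> \<Longrightarrow> G \<subseteq> H \<or> H \<subseteq> G;
      \<And>G. G \<in> \<G> \<Longrightarrow> Q G h\<rbrakk> \<Longrightarrow> Q (\<Union>\<G>) h"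
  shows "\<exists>h. Q K h"
proof -
  define KT where "KT T = {x \<in> K. Poly_Mapping.keys x \<subseteq> T}" for T
  have KT: "add_subgroup (KT T)" for T
    unfolding KT_def using K by (rule add_subgroup_keys)
  have KT_mono: "KT T \<subseteq> KT T'" if "T \<subseteq> T'" for T T' using that by (auto simp: KT_def)
  have KT_empty: "KT {} = {0}" using add_subgroup_zero[OF K] by (auto simp: KT_def)
  \<comment> \<open>Outside the relevant domain \<open>h\<close> is pinned to
    \<open>undefined\<close>; otherwise two different functions could precede each other and the
    order would not be antisymmetric.\<close>
  define A where "A = {(T, h). Q (KT T) h \<and> (\<forall>t. t \<notin> D (KT T) \<longrightarrow> h t = undefined)}"
  define P where "P = (\<lambda>(T, h) (T', h'). T \<subseteq> T' \<and> (\<forall>t\<in>D (KT T). h' t = (h t :: 'm)))"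
  define cut where "cut T h t = (if t \<in> D (KT T) then h t else undefined)" for T and h :: "'c \<Rightarrow> 'm" and t
  have cut: "(T, cut T h) \<in> A" if "Q (KT T) h" for T h
    using cong[OF KT that, of "cut T h"] by (simp add: A_def cut_def)
  have P_refl: "P a a" for a by (auto simp: P_def)
  have P_trans: "P a c" if "P a b" "P b c" for a b c
  proof -
    obtain T h T' h' T'' h'' where abc: "a = (T, h)" "b = (T', h')" "c = (T'', h'')"
      by (metis surj_pair)
    with that have T: "T \<subseteq> T'" "T' \<subseteq> T''" by (auto simp: P_def)
    with that mono[OF KT_mono[OF T(1)]] show ?thesis unfolding abc P_def by auto
  qed
  have P_antisym: "a = b" if "a \<in> A" "b \<in> A" "P a b" "P b a" for a b
  proof -
    obtain T h T' h' where ab: "a = (T, h)" "b = (T', h')" by fastforce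
    have "T = T'" using that by (auto simp: P_def ab)
    moreover have "h t = h' t" for t
      using that by (cases "t \<in> D (KT T)") (auto simp: P_def A_def ab \<open>T = T'\<close>)
    ultimately show ?thesis using ab by auto
  qed
  have "\<exists>m\<in>A. \<forall>a\<in>A. P m a \<longrightarrow> a = m"
  proof (rule predicate_Zorn)
    show "partial_order_on A (relation_of P A)"
      by (rule partial_order_on_relation_ofI) (use P_refl P_trans P_antisym in blast)+
  next
    fix \<C> assume "\<C> \<in> Chains (relation_of P A)"
    then have \<C>A: "\<C> \<subseteq> A" and chain: "\<And>a b. a \<in> \<C> \<Longrightarrow> b \<in> \<C> \<Longrightarrow> P a b \<or> P b a"
      by (auto simp: Chains_def relation_of_def)
    show "\<exists>u\<in>A. \<forall>a\<in>\<C>. P a u"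
    proof (cases "\<C> = {}")
      case True
      with cut[of "{}" h0] base show ?thesis by (auto simp: KT_empty)
    next
      case False
      define U where "U = \<Union>(fst ` \<C>)"
      \<comment> \<open>The functions of the chain are glued by choosing any member defined at
        \<open>t\<close>; comparability makes the value independent of that choice.\<close>
      define h where "h t = (SOME y. \<exists>a\<in>\<C>. t \<in> D (KT (fst a)) \<and> y = snd a t)" for t
      have h: "h t = snd a t" if "a \<in> \<C>" "t \<in> D (KT (fst a))" for a t
      proof -
        have "\<exists>b\<in>\<C>. t \<in> D (KT (fst b)) \<and> h t = snd b t"
          unfolding h_def by (rule someI_ex) (use that in blast)
        then obtain b where b: "b \<in> \<C>" "t \<in> D (KT (fst b))" "h t = snd b t" by blast
        from chain[OF that(1) b(1)] show ?thesis
          using that b by (auto simp: P_def split: prod.splits)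
      qed
      have chain_T: "S \<subseteq> S' \<or> S' \<subseteq> S" if "S \<in> fst ` \<C>" "S' \<in> fst ` \<C>" for S S'
        using that chain by (fastforce simp: P_def)
      have "KT U = \<Union>(KT ` fst ` \<C>)"
      proof
        show "KT U \<subseteq> \<Union>(KT ` fst ` \<C>)"
        proof
          fix x assume "x \<in> KT U"
          then have "x \<in> K" "Poly_Mapping.keys x \<subseteq> \<Union>(fst ` \<C>)" by (auto simp: KT_def U_def)
          moreover from ex_mem_chain[of "fst ` \<C>", OF chain_T _ _ this(2)] False
          obtain S where "S \<in> fst ` \<C>" "Poly_Mapping.keys x \<subseteq> S" by auto
          ultimately show "x \<in> \<Union>(KT ` fst ` \<C>)" by (auto simp: KT_def)
        qed
        show "\<Union>(KT ` fst ` \<C>) \<subseteq> KT U" by (auto simp: KT_def U_def)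
      qed
      moreover have "Q (\<Union>(KT ` fst ` \<C>)) h"
      proof (rule directed)
        show "KT ` fst ` \<C> \<noteq> {}" using False by simp
        show "G \<subseteq> H \<or> H \<subseteq> G" if "G \<in> KT ` fst ` \<C>" "H \<in> KT ` fst ` \<C>" for G H
          using that chain_T KT_mono by (metis imageE)
        show "Q G h" if "G \<in> KT ` fst ` \<C>" for G
        proof -
          obtain a where a: "a \<in> \<C>" "G = KT (fst a)"
            using \<open>G \<in> KT ` fst ` \<C>\<close> by blast
          then have "Q G (snd a)" using \<C>A by (auto simp: A_def)
          from KT this[unfolded a(2)] h[OF a(1)] show ?thesis unfolding a(2) by (rule cong)
        qed
      qed
      ultimately have "(U, cut U h) \<in> A" using cut by simp
      moreover have "P a (U, cut U h)" if "a \<in> \<C>" for a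
      proof -
        obtain T g where a: "a = (T, g)" by fastforce
        have "T \<subseteq> U" using that by (force simp: U_def a)
        then show ?thesis
          using h[OF that] mono[OF KT_mono[OF \<open>T \<subseteq> U\<close>]] by (auto simp: P_def a cut_def)
      qed
      ultimately show ?thesis by blast
    qed
  qed
  then obtain T h where Th: "(T, h) \<in> A" and max: "\<And>a. a \<in> A \<Longrightarrow> P (T, h) a \<Longrightarrow> a = (T, h)"
    by auto
  have "b \<in> T" for b
  proof (rule ccontr)
    assume "b \<notin> T"
    \<comment> \<open>Either some element supported in \<open>insert b T\<close> involves
      \<open>b\<close>, and a cyclic step applies, or the subgroup does not change and
      \<open>h\<close> is kept.\<close>
    have "\<exists>h'. Q (KT (insert b T)) h' \<and> (\<forall>t\<in>D (KT T). h' t = h t)"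
    proof (cases "\<exists>x\<in>K. Poly_Mapping.keys x \<subseteq> insert b T \<and> Poly_Mapping.lookup x b \<noteq> 0")
      case True
      then obtain l j where "cyclic_extension (KT (insert b T)) (KT T) l j"
        using cyclic_extension_coordinate[OF K \<open>b \<notin> T\<close>] unfolding KT_def by blast
      then show ?thesis using step Th by (auto simp: A_def)
    next
      case False
      then have "KT (insert b T) = KT T" by (auto simp: KT_def in_keys_iff)
      with Th show ?thesis by (auto simp: A_def)
    qed
    then obtain h' where h': "Q (KT (insert b T)) h'" "\<And>t. t \<in> D (KT T) \<Longrightarrow> h' t = h t" by blast
    have "P (T, h) (insert b T, cut (insert b T) h')"
      using h'(2) mono[OF KT_mono[of T "insert b T"]] by (auto simp: P_def cut_def)
    from max[OF cut[OF h'(1)] this] \<open>b \<notin> T\<close> show False by auto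
  qed
  then have "KT T = K" by (auto simp: KT_def)
  with Th show ?thesis by (auto simp: A_def)
qed

section \<open>Symmetric 2-cocycles on subgroups, and descent to a quotient\<close>

context modulus
begin

definition splits2 :: "('p::ab_group_add \<Rightarrow> 'p \<Rightarrow> 'm) \<Rightarrow> 'p set \<Rightarrow> ('p \<Rightarrow> 'm) \<Rightarrow> bool" where
  "splits2 g G e \<longleftrightarrow> (\<forall>x\<in>G. \<forall>y\<in>G. g x y - (e x + e y - e (x + y)) \<in> N)"

text \<open>A symmetric 2-cocycle describes an abelian extension of \<open>G\<close>, and
  \<open>splits2\<close> a splitting of it. A splitting over \<open>H\<close> extends to
  \<open>G\<close> because the generator of the complement can be lifted freely.\<close>

lemma symmetric_2cocycle_cyclic_extension:
  assumes "cyclic_extension G H l j"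
    and cocycle: "\<And>x y z. x \<in> G \<Longrightarrow> y \<in> G \<Longrightarrow> z \<in> G \<Longrightarrow> g y z - g (x + y) z + g x (y + z) - g x y \<in> N"
    and sym: "\<And>x y. x \<in> G \<Longrightarrow> y \<in> G \<Longrightarrow> g x y - g y x \<in> N"
    and g_zero: "\<And>x. g 0 x \<in> N \<and> g x 0 \<in> N"
    and e: "splits2 g H e"
  obtains e' where "\<And>x. x \<in> H \<Longrightarrow> e' x = e x" "splits2 g G e'"
proof -
  interpret cyclic_extension G H l j by fact
  have g0 [simp]: "g 0 x \<in> N" "g x 0 \<in> N" for x using g_zero by auto
  obtain E where E: "E 0 = 0" "\<And>a. E (a + 1) = E a + - g (l 1) (l a)"
    by (rule int_recursion[of "\<lambda>a. - g (l 1) (l a)"]) blast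
  \<comment> \<open>\<open>E\<close> is the splitting over the cyclic group whose value at the
    generator is trivial, and the value at \<open>u + l a\<close> is then forced by
    \<open>g u (l a)\<close>. On \<open>H\<close> this formula would return \<open>e\<close> only
    modulo \<open>N\<close>, hence the separate case.\<close>
  define e' where "e' x = (if x \<in> H then e x else e (x - l (j x)) + E (j x) - g (x - l (j x)) (l (j x)))" for x
  define g' where "g' x y = g x y - (e' x + e' y - e' (x + y))" for x y
  have H0 [simp]: "0 \<in> H" using subgroup_H by (rule add_subgroup_zero)
  have Hadd [simp]: "x + y \<in> H" if "x \<in> H" "y \<in> H" for x y
    using subgroup_H that by (rule add_subgroup_add)
  have GH [simp]: "u \<in> G" if "u \<in> H" for u using H_le_G that by blast
  have GL [simp]: "k \<in> G" if "k \<in> range l" for k using l_in_G that by blast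
  have Gadd [simp]: "x + y \<in> G" if "x \<in> G" "y \<in> G" for x y
    using subgroup_G that by (rule add_subgroup_add)
  have e0: "e 0 \<in> N"
  proof -
    have "g 0 0 - (e 0 + e 0 - e (0 + 0)) \<in> N" using e H0 unfolding splits2_def by blast
    then show ?thesis by (simp add: N_cancel)
  qed
  have e'_sum: "e' (u + l a) - (e u + E a - g u (l a)) \<in> N" if "u \<in> H" for u a
  proof (cases "u + l a \<in> H")
    case True
    then have "a = 0" using j_H[OF True] j_decompose[OF that] by simp
    with that show ?thesis by (simp add: e'_def E)
  next
    case False
    with that show ?thesis by (simp add: e'_def j_decompose)
  qed
  have e'_l: "e' (l a) - E a \<in> N" for a
  proof -
    have "e' (l a) - E a = (e' (0 + l a) - (e 0 + E a - g 0 (l a))) + e 0 - g 0 (l a)"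
      by (simp add: algebra_simps)
    also have "\<dots> \<in> N" by (intro N_diff N_add e'_sum e0) simp_all
    finally show ?thesis .
  qed
  have g'_cocycle: "g' y z - g' (x + y) z + g' x (y + z) - g' x y \<in> N" if "x \<in> G" "y \<in> G" "z \<in> G" for x y z
  proof -
    have "g' y z - g' (x + y) z + g' x (y + z) - g' x y = g y z - g (x + y) z + g x (y + z) - g x y"
      by (simp add: g'_def algebra_simps)
    with cocycle[OF that] show ?thesis by simp
  qed
  have g'_sym: "g' x y \<in> N \<longleftrightarrow> g' y x \<in> N" if "x \<in> G" "y \<in> G" for x y
  proof -
    have "g' x y = g' y x + (g x y - g y x)" by (simp add: g'_def algebra_simps)
    with sym[OF that] show ?thesis by (simp only:) (rule N_cancel)
  qed
  have g'_uv: "g' u v \<in> N" if "u \<in> H" "v \<in> H" for u v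
    using e that by (simp add: g'_def e'_def splits2_def)
  have g'_uk: "g' u (l a) \<in> N" if "u \<in> H" for u a
  proof -
    have "g' u (l a) = (e' (u + l a) - (e u + E a - g u (l a))) - (e' (l a) - E a)"
      using that by (simp add: g'_def e'_def[of u] algebra_simps)
    also have "\<dots> \<in> N" by (intro N_diff e'_sum e'_l that)
    finally show ?thesis .
  qed
  have g'_1k: "g' (l 1) (l a) \<in> N" for a
  proof -
    have "g' (l 1) (l a) = (e' (l (a + 1)) - E (a + 1)) - (e' (l a) - E a) - (e' (l (0 + 1)) - E (0 + 1)) + g (l 1) (l 0)"
      unfolding E by (simp add: g'_def E l_add algebra_simps)
    also have "\<dots> \<in> N" by (rule N_add[OF N_diff[OF N_diff[OF e'_l e'_l] e'_l]]) simp
    finally show ?thesis .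
  qed
  have g'_u: "g' u y \<in> N" if u: "u \<in> H" and "y \<in> G" for u y
  proof -
    obtain v a where v: "v \<in> H" "y = v + l a" by (rule decompose[OF \<open>y \<in> G\<close>])
    then show ?thesis
      using g'_cocycle[of u v "l a"] u g'_uk[of v a] g'_uk[of "u + v" a] g'_uv[of u v]
      by (simp add: N_cancel)
  qed
  \<comment> \<open>The cocycle relation only reaches \<open>g' y (l 1)\<close>; symmetry then
    exchanges the arguments.\<close>
  have g'_1: "g' (l 1) y \<in> N" if "y \<in> G" for y
  proof -
    obtain v a where v: "v \<in> H" "y = v + l a" by (rule decompose[OF \<open>y \<in> G\<close>])
    have "g' (l a) (l 1) \<in> N" using g'_1k g'_sym by simp
    then have "g' y (l 1) \<in> N"
      using g'_cocycle[of v "l a" "l 1"] v g'_u[of v "l a + l 1"] g'_u[of v "l a"]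
      by (simp add: N_cancel)
    then show ?thesis using g'_sym that by simp
  qed
  have g'_k: "g' k y \<in> N" if "k \<in> range l" "y \<in> G" for k y
    using that(1)
  proof (induction rule: range_l_induct)
    case zero
    show ?case using g'_u[of 0 y] that by simp
  next
    case (step k)
    have "g' k y - g' (l 1 + k) y \<in> N"
      using g'_cocycle[of "l 1" k y] g'_1[of "k + y"] g'_1[of k] step that by (simp add: N_cancel)
    then show ?case by (metis N_cancel(3,4) N_commute)
  qed
  have "g' x y \<in> N" if "x \<in> G" "y \<in> G" for x y
  proof -
    obtain u a where u: "u \<in> H" "x = u + l a" by (rule decompose[OF \<open>x \<in> G\<close>])
    then show ?thesis
      using g'_cocycle[of u "l a" y] that g'_k[of "l a" y] g'_u[of u "l a + y"] g'_u[of u "l a"]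
      by (simp add: N_cancel)
  qed
  then show ?thesis
    using that[of e'] by (simp add: e'_def splits2_def g'_def)
qed

text \<open>This is the vanishing of Ext(K, A) for a subgroup \<open>K\<close> of a free abelian
  group, obtained from the same induction over sets of generators and without choosing a basis of
  \<open>K\<close>.\<close>

lemma symmetric_2cocycle_free_abelian_subgroup:
  fixes K :: "('b \<Rightarrow>\<^sub>0 int) set"
  assumes K: "add_subgroup K"
    and cocycle: "\<And>x y z. x \<in> K \<Longrightarrow> y \<in> K \<Longrightarrow> z \<in> K \<Longrightarrow> g y z - g (x + y) z + g x (y + z) - g x y \<in> N"
    and sym: "\<And>x y. x \<in> K \<Longrightarrow> y \<in> K \<Longrightarrow> g x y - g y x \<in> N"
    and g_zero: "\<And>x. g 0 x \<in> N \<and> g x 0 \<in> N"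
  obtains e where "splits2 g K e"
proof -
  have "\<exists>e. K \<subseteq> K \<longrightarrow> splits2 g K e"
  \<comment> \<open>The induction asks for its step at every cyclic extension, whereas the cocycle
    relation is known only on \<open>K\<close>; hence the guard \<open>G \<subseteq> K\<close> in
    the property.\<close>
  proof (rule free_abelian_subgroup_extension[where D = "\<lambda>G. G" and Q = "\<lambda>G e. G \<subseteq> K \<longrightarrow> splits2 g G e" and ?h0.0 = "\<lambda>_. 0"])
    show "{0} \<subseteq> K \<longrightarrow> splits2 g {0} (\<lambda>_. 0)" using g_zero by (simp add: splits2_def)
  next
    fix G H l j and e :: "('b \<Rightarrow>\<^sub>0 int) \<Rightarrow> 'm"
    assume ext: "cyclic_extension G H l j" and e: "H \<subseteq> K \<longrightarrow> splits2 g H e"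
    show "\<exists>e'. (G \<subseteq> K \<longrightarrow> splits2 g G e') \<and> (\<forall>t\<in>H. e' t = e t)"
    proof (cases "G \<subseteq> K")
      case True
      then have "splits2 g H e" using e cyclic_extension.H_le_G[OF ext] by blast
      with True g_zero obtain e' where "\<And>x. x \<in> H \<Longrightarrow> e' x = e x" "splits2 g G e'"
        by (elim symmetric_2cocycle_cyclic_extension[OF ext, of g e, rotated 4])
          (auto intro!: cocycle sym dest: subsetD)
      then show ?thesis by blast
    qed auto
  next
    fix G and e e' :: "('b \<Rightarrow>\<^sub>0 int) \<Rightarrow> 'm"
    assume "add_subgroup G" "G \<subseteq> K \<longrightarrow> splits2 g G e" "\<And>t. t \<in> G \<Longrightarrow> e' t = e t"
    then show "G \<subseteq> K \<longrightarrow> splits2 g G e'" by (simp add: splits2_def add_subgroup_add)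
  next
    fix \<G> :: "('b \<Rightarrow>\<^sub>0 int) set set" and e
    assume \<G>: "\<And>G H. G \<in> \<G> \<Longrightarrow> H \<in> \<G> \<Longrightarrow> G \<subseteq> H \<or> H \<subseteq> G" "\<And>G. G \<in> \<G> \<Longrightarrow> G \<subseteq> K \<longrightarrow> splits2 g G e"
    show "\<Union>\<G> \<subseteq> K \<longrightarrow> splits2 g (\<Union>\<G>) e"
    proof
      assume "\<Union>\<G> \<subseteq> K"
      show "splits2 g (\<Union>\<G>) e"
        unfolding splits2_def
      proof (intro ballI)
        fix x y assume "x \<in> \<Union>\<G>" "y \<in> \<Union>\<G>"
        then obtain G where G: "G \<in> \<G>" "x \<in> G" "y \<in> G" by (meson UnionE \<G>(1) subsetD)
        then have "splits2 g G e" using \<G>(2) \<open>\<Union>\<G> \<subseteq> K\<close> by blast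
        with G show "g x y - (e x + e y - e (x + y)) \<in> N" by (simp add: splits2_def)
      qed
    qed
  qed (use K in auto)
  with that show ?thesis by auto
qed

text \<open>Subtracting the coboundary of a 1-cochain from \<open>h\<close> changes neither
  \<open>gauge3\<close> nor \<open>gauge2\<close>, so it is enough to make \<open>h' k x\<close>
  constant modulo \<open>N\<close> for \<open>k\<close> in \<open>K\<close>. The
  \<open>gauge3\<close> relation with first argument in \<open>K\<close> then gives invariance on
  the left, and the \<open>gauge2\<close> relation carries it to the right, since \<open>S\<close>
  is invariant.\<close>

lemma descend_trivialisation:
  fixes F :: "'p::ab_group_add \<Rightarrow> 'p \<Rightarrow> 'p \<Rightarrow> 'm" and S :: "'p \<Rightarrow> 'p \<Rightarrow> 'm"
  assumes K: "add_subgroup K"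
    and S_inv: "\<And>x y k. k \<in> K \<Longrightarrow> S (k + x) y = S x y" "\<And>x y k. k \<in> K \<Longrightarrow> S x (k + y) = S x y"
    and F_K: "\<And>k x y. k \<in> K \<Longrightarrow> F k x y \<in> N"
    and F_h: "\<And>x y z. gauge3 F h x y z \<in> N" and S_h: "\<And>x y. gauge2 S h x y \<in> N"
    and e: "splits2 h K e"
  obtains h' where "\<And>x y z. gauge3 F h' x y z \<in> N"
    "\<And>x y k. k \<in> K \<Longrightarrow> h' (k + x) y - h' x y \<in> N" "\<And>x y k. k \<in> K \<Longrightarrow> h' x (k + y) - h' x y \<in> N"
proof -
  define \<sigma> where "\<sigma> x = (SOME y. x - y \<in> K)" for x
  have "x - \<sigma> x \<in> K" for x
    unfolding \<sigma>_def by (rule someI[of _ x]) (use add_subgroup_zero[OF K] in simp)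
  note \<sigma> = this
  have \<sigma>_add: "\<sigma> (k + x) = \<sigma> x" if "k \<in> K" for k x
  proof -
    have "k + x - y \<in> K \<longleftrightarrow> x - y \<in> K" for y
      using add_subgroup_add[OF K that, of "x - y"] add_subgroup_diff[OF K _ that, of "k + x - y"]
      by (auto simp: algebra_simps)
    then show ?thesis by (simp add: \<sigma>_def)
  qed
  \<comment> \<open>Writing \<open>x = t + \<sigma> x\<close> with \<open>t\<close> in
    \<open>K\<close>, this is the value that makes \<open>h' t (\<sigma> x)\<close> trivial if
    \<open>e'\<close> agrees with \<open>e\<close> at \<open>t\<close> and is trivial at the
    representative \<open>\<sigma> x\<close>.\<close>
  define e' where "e' x = e (x - \<sigma> x) - h (x - \<sigma> x) (\<sigma> x)" for x
  define h' where "h' x y = h x y - (e' x + e' y - e' (x + y))" for x y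
  have F_h': "gauge3 F h' x y z \<in> N" for x y z
  proof -
    have "gauge3 F h' x y z = gauge3 F h x y z" by (simp add: gauge3_def h'_def algebra_simps)
    with F_h show ?thesis by simp
  qed
  have S_h': "gauge2 S h' x y \<in> N" for x y
  proof -
    have "gauge2 S h' x y = gauge2 S h x y" by (simp add: gauge2_def h'_def algebra_simps)
    with S_h show ?thesis by simp
  qed
  have \<sigma>0: "\<sigma> 0 \<in> K" using add_subgroup_minus[OF K \<sigma>[of 0]] by simp
  \<comment> \<open>The representative of \<open>K\<close> itself need not be 0, which is why a
    constant \<open>e (\<sigma> 0)\<close> is left over; it cancels in the differences that
    matter.\<close>
  have h'_const: "h' k x - e (\<sigma> 0) \<in> N" if "k \<in> K" for k x
  proof -
    define t where "t = x - \<sigma> x"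
    have t: "t \<in> K" "x = t + \<sigma> x" using \<sigma> by (auto simp: t_def)
    have \<sigma>k: "\<sigma> k = \<sigma> 0" using \<sigma>_add[OF that, of 0] by simp
    have k0: "k - \<sigma> 0 \<in> K" using add_subgroup_diff[OF K that \<sigma>0] .
    have A: "h t (\<sigma> x) - h (k + t) (\<sigma> x) + h k x - h k t \<in> N"
      using F_h[of k t "\<sigma> x"] F_K[OF that, of t "\<sigma> x"] t(2) by (simp add: gauge3_def N_cancel)
    have B: "h k t - (e k + e t - e (k + t)) \<in> N"
      using e that t(1) by (simp add: splits2_def)
    have C: "h (k - \<sigma> 0) (\<sigma> 0) - (e (k - \<sigma> 0) + e (\<sigma> 0) - e k) \<in> N"
      using e[unfolded splits2_def, rule_format, OF k0 \<sigma>0] by simp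
    have eqs: "e' x = e t - h t (\<sigma> x)" "e' (k + x) = e (k + t) - h (k + t) (\<sigma> x)"
      "e' k = e (k - \<sigma> 0) - h (k - \<sigma> 0) (\<sigma> 0)"
      by (simp_all add: e'_def t_def \<sigma>_add[OF that] \<sigma>k algebra_simps)
    have "h' k x - e (\<sigma> 0) = (h t (\<sigma> x) - h (k + t) (\<sigma> x) + h k x - h k t)
      + (h k t - (e k + e t - e (k + t))) + (h (k - \<sigma> 0) (\<sigma> 0) - (e (k - \<sigma> 0) + e (\<sigma> 0) - e k))"
      unfolding h'_def eqs by (simp add: algebra_simps)
    also have "\<dots> \<in> N" by (intro N_add A B C)
    finally show ?thesis .
  qed
  have left: "h' (k + x) y - h' x y \<in> N" if "k \<in> K" for k x y
  proof -
    have "h' (k + x) y - h' x y = gauge3 F h' k x y - F k x y + (h' k (x + y) - e (\<sigma> 0)) - (h' k x - e (\<sigma> 0))"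
      by (simp add: gauge3_def algebra_simps)
    also have "\<dots> \<in> N" by (intro N_diff N_add F_h' F_K h'_const that)
    finally show ?thesis .
  qed
  have "h' x (k + y) - h' x y \<in> N" if "k \<in> K" for k x y
  proof -
    have "h' x (k + y) - h' x y = gauge2 S h' x (k + y) - gauge2 S h' x y + (h' (k + y) x - h' y x)"
      using S_inv(2)[OF that, of x y] by (simp add: gauge2_def algebra_simps)
    also have "\<dots> \<in> N" by (intro N_diff N_add S_h' left that)
    finally show ?thesis .
  qed
  with F_h' left show ?thesis by (rule that)
qed

end

text \<open>Invariance under \<open>K\<close> says that \<open>F\<close> and \<open>S\<close> are
  pulled back from the quotient by \<open>K\<close>, and invariance of \<open>h\<close> modulo
  \<open>N\<close> that the trivialisation comes from there too.\<close>

lemma (in modulus) abelian_3cocycle_trivial: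
  fixes K :: "('b \<Rightarrow>\<^sub>0 int) set"
  assumes "abelian_3cocycle N F S" and K: "add_subgroup K"
    and F_inv: "\<And>x y z k. k \<in> K \<Longrightarrow> F (k + x) y z = F x y z" "\<And>x y z k. k \<in> K \<Longrightarrow> F x (k + y) z = F x y z"
      "\<And>x y z k. k \<in> K \<Longrightarrow> F x y (k + z) = F x y z"
    and S_inv: "\<And>x y k. k \<in> K \<Longrightarrow> S (k + x) y = S x y" "\<And>x y k. k \<in> K \<Longrightarrow> S x (k + y) = S x y"
  obtains h where "\<And>x y z. gauge3 F h x y z \<in> N"
    "\<And>x y k. k \<in> K \<Longrightarrow> h (k + x) y - h x y \<in> N" "\<And>x y k. k \<in> K \<Longrightarrow> h x (k + y) - h x y \<in> N"
proof -
  interpret F: abelian_3cocycle N F S by fact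
  define n where "n x y = F 0 0 y - F x 0 0" for x y
  define F1 S1 where "F1 = gauge3 F n" and "S1 = gauge2 S n"
  interpret F1: abelian_3cocycle N F1 S1
    unfolding F1_def S1_def by (rule F.abelian_3cocycle_gauge)
  have F1_normalised: F1.normalised
    unfolding F1_def n_def[abs_def] by (rule F.normalised_gauge)
  have n_inv: "n (k + x) y = n x y" "n x (k + y) = n x y" if "k \<in> K" for k x y
    using F_inv(1,3)[OF that] by (simp_all add: n_def)
  have F1_inv: "F1 (k + x) y z = F1 x y z" if "k \<in> K" for k x y z
    using F_inv(1)[OF that] n_inv[OF that] by (simp add: F1_def gauge3_def add.assoc)
  have S1_inv: "S1 (k + x) y = S1 x y" "S1 x (k + y) = S1 x y" if "k \<in> K" for k x y
    using S_inv[OF that] n_inv[OF that] by (simp_all add: S1_def gauge2_def)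
  have F1_zero: "F1 0 x y \<in> N" for x y using F1_normalised by (simp add: F1.normalised_def)
  \<comment> \<open>Normalisation and invariance together: \<open>k\<close> acts like 0 in the first
    argument. This is what makes \<open>h\<close> a 2-cocycle on \<open>K\<close>.\<close>
  have F1_K: "F1 k x y \<in> N" if "k \<in> K" for k x y
    using F1_inv[OF that, of 0 x y] F1_zero by simp

  \<comment> \<open>The extension principle treats functions of one argument, so \<open>h\<close>
    lives on pairs. The normalisation at 0 is carried along because
    \<open>extend_trivialisation\<close> asks for it.\<close>
  define Q where "Q G h \<longleftrightarrow> (let h = curry h in
      abelian_3cocycle.vanishes_on N (gauge3 F1 h) (gauge2 S1 h) G \<and> (\<forall>x\<in>G. h 0 x \<in> N \<and> h x 0 \<in> N))"
    for G :: "('b \<Rightarrow>\<^sub>0 int) set" and h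
  have "\<exists>h. Q UNIV h"
  proof (rule free_abelian_subgroup_extension[where D = "\<lambda>G. G \<times> G" and ?h0.0 = "\<lambda>_. 0"])
    show "add_subgroup UNIV" by (simp add: add_subgroup_def)
    have "S1 0 0 \<in> N" by (rule F1.diagonal_rel)
    then show "Q {0} (\<lambda>_. 0)"
      using F1_zero by (simp add: Q_def F1.vanishes_on_gauge_iff gauge3_def gauge2_def)
  next
    fix G H l j and h :: "('b \<Rightarrow>\<^sub>0 int) \<times> ('b \<Rightarrow>\<^sub>0 int) \<Rightarrow> 'm"
    assume "cyclic_extension G H l j" and Q: "Q H h"
    then interpret cyclic_extension G H l j by simp
    interpret abelian_3cocycle_cyclic_extension N F1 S1 G H l j
      by unfold_locales (rule F1_normalised)
    obtain h' where "\<And>x y. x \<in> H \<Longrightarrow> y \<in> H \<Longrightarrow> h' x y = curry h x y"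
      "\<And>x. h' 0 x \<in> N \<and> h' x 0 \<in> N"
      "abelian_3cocycle.vanishes_on N (gauge3 F1 h') (gauge2 S1 h') G"
      by (rule extend_trivialisation[of "curry h"]) (use Q in \<open>auto simp: Q_def Let_def\<close>)
    then show "\<exists>h'. Q G h' \<and> (\<forall>t\<in>H \<times> H. h' t = h t)"
      by (intro exI[of _ "case_prod h'"]) (auto simp: Q_def Let_def)
  next
    fix G and h h' :: "('b \<Rightarrow>\<^sub>0 int) \<times> ('b \<Rightarrow>\<^sub>0 int) \<Rightarrow> 'm"
    assume G: "add_subgroup G" and Q: "Q G h" and eq: "\<And>t. t \<in> G \<times> G \<Longrightarrow> h' t = h t"
    have "abelian_3cocycle.vanishes_on N (gauge3 F1 (curry h')) (gauge2 S1 (curry h')) G"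
      by (rule F1.vanishes_on_gauge_cong[OF _ G, of "curry h"]) (use Q eq in \<open>auto simp: Q_def Let_def\<close>)
    with Q eq add_subgroup_zero[OF G] show "Q G h'" by (simp add: Q_def Let_def)
  next
    fix \<G> :: "('b \<Rightarrow>\<^sub>0 int) set set" and h
    assume \<G>: "\<G> \<noteq> {}" "\<And>G H. G \<in> \<G> \<Longrightarrow> H \<in> \<G> \<Longrightarrow> G \<subseteq> H \<or> H \<subseteq> G" "\<And>G. G \<in> \<G> \<Longrightarrow> Q G h"
    have "gauge2 S1 (curry h) x y \<in> N \<and> gauge3 F1 (curry h) x y z \<in> N"
      if xyz: "x \<in> \<Union>\<G>" "y \<in> \<Union>\<G>" "z \<in> \<Union>\<G>" for x y z
    proof -
      obtain G where "G \<in> \<G>" "{x, y, z} \<subseteq> G"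
        using ex_mem_chain[OF \<G>(2,1), of "{x, y, z}"] xyz by auto
      with \<G>(3)[of G] show ?thesis by (simp add: Q_def F1.vanishes_on_gauge_iff Let_def)
    qed
    moreover have "curry h 0 x \<in> N \<and> curry h x 0 \<in> N" if "x \<in> \<Union>\<G>" for x
      using that \<G>(3) by (auto simp: Q_def Let_def)
    ultimately show "Q (\<Union>\<G>) h"
      unfolding Q_def Let_def F1.vanishes_on_gauge_iff by blast
  qed auto
  then obtain h0 where h0: "Q UNIV h0" ..
  define h where "h = curry h0"
  have h: "gauge3 F1 h x y z \<in> N" "gauge2 S1 h x y \<in> N" "h 0 x \<in> N \<and> h x 0 \<in> N" for x y z
    using h0 by (simp_all add: Q_def F1.vanishes_on_gauge_iff Let_def h_def)
  obtain e where e: "splits2 h K e"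
  proof (rule symmetric_2cocycle_free_abelian_subgroup[OF K])
    show "h y z - h (x + y) z + h x (y + z) - h x y \<in> N" if "x \<in> K" for x y z
      using h(1)[of x y z] F1_K[OF that] by (simp add: gauge3_def N_cancel)
    \<comment> \<open>On \<open>K\<close> the braiding \<open>S1\<close> takes its value at
      \<open>0 0\<close>, which lies in \<open>N\<close>; what remains of \<open>gauge2\<close> is
      the symmetry of \<open>h\<close>.\<close>
    show "h x y - h y x \<in> N" if "x \<in> K" "y \<in> K" for x y
      using h(2)[of x y] S1_inv(1)[OF that(1), of 0 y] S1_inv(2)[OF that(2), of 0 0] F1.diagonal_rel[of 0]
      by (simp add: gauge2_def N_cancel add_diff_eq[symmetric])
  qed (use h(3) in auto)
  obtain h' where h': "\<And>x y z. gauge3 F1 h' x y z \<in> N"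
    "\<And>x y k. k \<in> K \<Longrightarrow> h' (k + x) y - h' x y \<in> N" "\<And>x y k. k \<in> K \<Longrightarrow> h' x (k + y) - h' x y \<in> N"
    by (rule descend_trivialisation[OF K S1_inv F1_K h(1,2) e])
      (assumption | rule that | simp)+
  show ?thesis
  proof (rule that)
    show "gauge3 F (\<lambda>x y. n x y + h' x y) x y z \<in> N" for x y z
      using h'(1)[of x y z] by (simp add: F1_def gauge3_gauge3)
  qed (simp_all add: n_inv h')
qed

section \<open>Groups with carriers as quotients of free abelian groups\<close>

lemma (in comm_group) free_abelian_evaluation:
  obtains ev :: "('a \<Rightarrow>\<^sub>0 int) \<Rightarrow> 'a"
  where "\<And>x. x \<in> carrier G \<Longrightarrow> ev (frag_of x) = x" "\<And>x. ev x \<in> carrier G"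
    "\<And>x y. ev (x + y) = ev x \<otimes> ev y" "\<And>x y. ev (x - y) = ev x \<otimes> inv (ev y)" "ev 0 = \<one>"
proof -
  \<comment> \<open>The free group has the whole type as its generators; those outside the carrier
    are sent to the unit.\<close>
  define g where "g x = (if x \<in> carrier G then x else \<one>)" for x
  have "g ` UNIV \<subseteq> carrier G" by (auto simp: g_def)
  then obtain ev where ev: "ev \<in> hom (free_Abelian_group UNIV) G" "\<And>x. ev (frag_of x) = g x"
    by (rule free_Abelian_group_universal[where S = UNIV]) auto
  interpret ev: group_hom "free_Abelian_group UNIV" G ev
    using ev(1) by (simp add: group_hom_def group_hom_axioms_def)
  have closed: "ev x \<in> carrier G" for x using ev.hom_closed[of x] by simp
  have add: "ev (x + y) = ev x \<otimes> ev y" for x y using ev.hom_mult[of x y] by simp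
  have zero: "ev 0 = \<one>" using ev.hom_one by simp
  have "ev (x - y) = ev x \<otimes> inv (ev y)" for x y
    using add[of "x - y" y] closed by (simp add: inv_solve_right)
  with ev(2) closed add zero show ?thesis by (intro that[of ev]) (simp_all add: g_def)
qed

text \<open>Both groups are presented: \<open>A\<close> through \<open>ev\<close> with kernel
  \<open>N\<close>, \<open>B\<close> through \<open>\<pi>\<close> with kernel \<open>K\<close>.
  \<open>F\<close> and \<open>S\<close> lift the values of \<open>f\<close> and \<open>s\<close> to
  basis elements; such lifts are not additive, so the cocycle relations hold for them only modulo
  \<open>N\<close>.\<close>

lemma alternating_3cocycle_coboundary:
  fixes A :: "('a, 'v) monoid_scheme" and B :: "('b, 'w) monoid_scheme"
  assumes "comm_group A" "comm_group B"
    and f: "\<And>x y z. \<lbrakk>x \<in> carrier B; y \<in> carrier B; z \<in> carrier B\<rbrakk> \<Longrightarrow> f x y z \<in> carrier A"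
    and s: "\<And>x y. \<lbrakk>x \<in> carrier B; y \<in> carrier B\<rbrakk> \<Longrightarrow> s x y \<in> carrier A"
    and pentagon: "\<And>w x y z. \<lbrakk>w \<in> carrier B; x \<in> carrier B; y \<in> carrier B; z \<in> carrier B\<rbrakk> \<Longrightarrow>
      f (w \<otimes>\<^bsub>B\<^esub> x) y z \<otimes>\<^bsub>A\<^esub> f w x (y \<otimes>\<^bsub>B\<^esub> z) = f w x y \<otimes>\<^bsub>A\<^esub> f w (x \<otimes>\<^bsub>B\<^esub> y) z \<otimes>\<^bsub>A\<^esub> f x y z"
    and hexagon1: "\<And>x x' y. \<lbrakk>x \<in> carrier B; x' \<in> carrier B; y \<in> carrier B\<rbrakk> \<Longrightarrow>
      s (x \<otimes>\<^bsub>B\<^esub> x') y \<otimes>\<^bsub>A\<^esub> f x y x' = f x x' y \<otimes>\<^bsub>A\<^esub> s x' y \<otimes>\<^bsub>A\<^esub> s x y \<otimes>\<^bsub>A\<^esub> f y x x'"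
    and hexagon2: "\<And>x y y'. \<lbrakk>x \<in> carrier B; y \<in> carrier B; y' \<in> carrier B\<rbrakk> \<Longrightarrow>
      s x (y \<otimes>\<^bsub>B\<^esub> y') \<otimes>\<^bsub>A\<^esub> f x y y' \<otimes>\<^bsub>A\<^esub> f y y' x = s x y \<otimes>\<^bsub>A\<^esub> f y x y' \<otimes>\<^bsub>A\<^esub> s x y'"
    and diagonal: "\<And>x. x \<in> carrier B \<Longrightarrow> s x x = \<one>\<^bsub>A\<^esub>"
  shows "coboundary3 A B f"
proof -
  interpret A: comm_group A by fact
  interpret B: comm_group B by fact
  obtain ev :: "('a \<Rightarrow>\<^sub>0 int) \<Rightarrow> 'a" where ev_of: "\<And>a. a \<in> carrier A \<Longrightarrow> ev (frag_of a) = a"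
    and ev_closed [simp]: "\<And>x. ev x \<in> carrier A" and ev_add: "\<And>x y. ev (x + y) = ev x \<otimes>\<^bsub>A\<^esub> ev y"
    and ev_diff: "\<And>x y. ev (x - y) = ev x \<otimes>\<^bsub>A\<^esub> inv\<^bsub>A\<^esub> ev y" and ev_zero: "ev 0 = \<one>\<^bsub>A\<^esub>"
    by (rule A.free_abelian_evaluation) (rule that)
  obtain \<pi> :: "('b \<Rightarrow>\<^sub>0 int) \<Rightarrow> 'b" where \<pi>_of: "\<And>b. b \<in> carrier B \<Longrightarrow> \<pi> (frag_of b) = b"
    and \<pi>_closed [simp]: "\<And>x. \<pi> x \<in> carrier B" and \<pi>_add: "\<And>x y. \<pi> (x + y) = \<pi> x \<otimes>\<^bsub>B\<^esub> \<pi> y"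
    and \<pi>_diff: "\<And>x y. \<pi> (x - y) = \<pi> x \<otimes>\<^bsub>B\<^esub> inv\<^bsub>B\<^esub> \<pi> y" and \<pi>_zero: "\<pi> 0 = \<one>\<^bsub>B\<^esub>"
    by (rule B.free_abelian_evaluation) (rule that)
  define N where "N = {x. ev x = \<one>\<^bsub>A\<^esub>}"
  define K where "K = {x. \<pi> x = \<one>\<^bsub>B\<^esub>}"
  define F where "F x y z = frag_of (f (\<pi> x) (\<pi> y) (\<pi> z))" for x y z
  define S where "S x y = frag_of (s (\<pi> x) (\<pi> y))" for x y
  have ev_F: "ev (F x y z) = f (\<pi> x) (\<pi> y) (\<pi> z)" for x y z
    using ev_of f by (simp add: F_def)
  have ev_S: "ev (S x y) = s (\<pi> x) (\<pi> y)" for x y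
    using ev_of s by (simp add: S_def)
  have N_iff: "x - y \<in> N \<longleftrightarrow> ev x = ev y" for x y
    by (simp add: N_def ev_diff) (metis A.inv_closed A.inv_equality A.inv_inv A.r_inv ev_closed)
  interpret modulus N
    by unfold_locales (auto simp: add_subgroup_def N_def ev_zero ev_diff)
  have K: "add_subgroup K" by (auto simp: add_subgroup_def K_def \<pi>_zero \<pi>_diff)
  have cocycle: "abelian_3cocycle N F S"
  proof
    fix w x y z
    have "F x y z - F (w + x) y z + F w (x + y) z - F w x (y + z) + F w x y
      = (F w x y + F w (x + y) z + F x y z) - (F (w + x) y z + F w x (y + z))"
      by (simp add: algebra_simps)
    also have "\<dots> \<in> N"
      using pentagon[of "\<pi> w" "\<pi> x" "\<pi> y" "\<pi> z"] by (simp add: N_iff ev_add ev_F \<pi>_add)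
    finally show "F x y z - F (w + x) y z + F w (x + y) z - F w x (y + z) + F w x y \<in> N" .
  next
    fix x x' y
    have "S (x + x') y - S x y - S x' y - (F x x' y - F x y x' + F y x x')
      = (S (x + x') y + F x y x') - (F x x' y + S x' y + S x y + F y x x')"
      by (simp add: algebra_simps)
    also have "\<dots> \<in> N"
      using hexagon1[of "\<pi> x" "\<pi> x'" "\<pi> y"] by (simp add: N_iff ev_add ev_F ev_S \<pi>_add)
    finally show "S (x + x') y - S x y - S x' y - (F x x' y - F x y x' + F y x x') \<in> N" .
  next
    fix x y y'
    have "S x (y + y') - S x y - S x y' + (F x y y' - F y x y' + F y y' x)
      = (S x (y + y') + F x y y' + F y y' x) - (S x y + F y x y' + S x y')"
      by (simp add: algebra_simps)
    also have "\<dots> \<in> N"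
      using hexagon2[of "\<pi> x" "\<pi> y" "\<pi> y'"] by (simp add: N_iff ev_add ev_F ev_S \<pi>_add)
    finally show "S x (y + y') - S x y - S x y' + (F x y y' - F y x y' + F y y' x) \<in> N" .
  next
    show "S x x \<in> N" for x using diagonal by (simp add: N_def ev_S)
  qed
  have \<pi>_K: "\<pi> (k + x) = \<pi> x" if "k \<in> K" for k x
    using that by (simp add: \<pi>_add K_def)
  obtain h where h: "\<And>x y z. gauge3 F h x y z \<in> N"
    and h_left: "\<And>x y k. k \<in> K \<Longrightarrow> h (k + x) y - h x y \<in> N"
    and h_right: "\<And>x y k. k \<in> K \<Longrightarrow> h x (k + y) - h x y \<in> N"
    by (rule abelian_3cocycle_trivial[OF cocycle K]) (rule that | assumption | simp add: F_def S_def \<pi>_K)+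
  \<comment> \<open>The cochain on \<open>B\<close> is read off at basis elements. A sum of two
    basis elements is not one, but differs from the right one by an element of \<open>K\<close>, and
    there invariance of \<open>h\<close> applies.\<close>
  have split: "\<exists>k\<in>K. frag_of x + frag_of y = k + frag_of (x \<otimes>\<^bsub>B\<^esub> y)"
    if "x \<in> carrier B" "y \<in> carrier B" for x y
    using that by (intro bexI[of _ "frag_of x + frag_of y - frag_of (x \<otimes>\<^bsub>B\<^esub> y)"])
      (simp_all add: K_def \<pi>_diff \<pi>_add \<pi>_of)
  define h' where "h' x y = ev (h (frag_of x) (frag_of y))" for x y
  have "f x y z = h' y z \<otimes>\<^bsub>A\<^esub> inv\<^bsub>A\<^esub> h' (x \<otimes>\<^bsub>B\<^esub> y) z \<otimes>\<^bsub>A\<^esub> h' x (y \<otimes>\<^bsub>B\<^esub> z) \<otimes>\<^bsub>A\<^esub> inv\<^bsub>A\<^esub> h' x y"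
    if xyz: "x \<in> carrier B" "y \<in> carrier B" "z \<in> carrier B" for x y z
  proof -
    have "f x y z = ev (F (frag_of x) (frag_of y) (frag_of z))" by (simp add: ev_F \<pi>_of xyz)
    also have "\<dots> = ev (h (frag_of y) (frag_of z) - h (frag_of x + frag_of y) (frag_of z)
        + h (frag_of x) (frag_of y + frag_of z) - h (frag_of x) (frag_of y))"
      using h[of "frag_of x" "frag_of y" "frag_of z"] by (simp only: gauge3_def N_iff)
    also have "ev (h (frag_of x + frag_of y) (frag_of z)) = h' (x \<otimes>\<^bsub>B\<^esub> y) z"
      using split[OF xyz(1,2)] h_left by (auto simp: h'_def N_iff)
    moreover have "ev (h (frag_of x) (frag_of y + frag_of z)) = h' x (y \<otimes>\<^bsub>B\<^esub> z)"
      using split[OF xyz(2,3)] h_right by (auto simp: h'_def N_iff)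
    ultimately show ?thesis by (simp add: ev_diff ev_add h'_def)
  qed
  moreover have "h' \<in> carrier B \<rightarrow> carrier B \<rightarrow> carrier A" by (simp add: h'_def)
  ultimately show ?thesis unfolding coboundary3_def by blast
qed

section \<open>Group-like monoidal groupoids\<close>

context category
begin

text \<open>The axioms speak of \<open>Hom\<close>. The rules below speak of \<open>Arr\<close>,
  \<open>Dom\<close> and \<open>Cod\<close> instead, so that the simplifier computes the domains and
  codomains it needs.\<close>

lemma Hom_iff: "u \<in> Hom C X Y \<longleftrightarrow> u \<in> Arr C \<and> Dom C u = X \<and> Cod C u = Y"
  by (auto simp: Hom_def)

lemma Dom_Obj [simp]: "u \<in> Arr C \<Longrightarrow> Dom C u \<in> Obj C"
  and Cod_Obj [simp]: "u \<in> Arr C \<Longrightarrow> Cod C u \<in> Obj C"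
  by (rule Dom_in_Obj Cod_in_Obj, assumption)+

lemma Ident_arr [simp]:
  assumes "X \<in> Obj C"
  shows "Ident C X \<in> Arr C" "Dom C (Ident C X) = X" "Cod C (Ident C X) = X"
  using Ident_in_Hom[OF assms] by (auto simp: Hom_iff)

lemma Comp_arr [simp]:
  assumes "u \<in> Arr C" "v \<in> Arr C" "Dom C v = Cod C u"
  shows "v \<cdot> u \<in> Arr C" "Dom C (v \<cdot> u) = Dom C u" "Cod C (v \<cdot> u) = Cod C v"
  using Comp_in_Hom[of u "Dom C u" "Cod C u" v "Cod C v"] assms by (auto simp: Hom_iff)

lemma Comp_Ident_right [simp]: "u \<in> Arr C \<Longrightarrow> Dom C u = X \<Longrightarrow> u \<cdot> Ident C X = u"
  and Ident_Comp_left [simp]: "u \<in> Arr C \<Longrightarrow> Cod C u = Y \<Longrightarrow> Ident C Y \<cdot> u = u"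
  using Comp_Ident Ident_Comp by (auto simp: Hom_iff)

lemma Comp_assoc' [simp]:
  assumes "u \<in> Arr C" "v \<in> Arr C" "w \<in> Arr C" "Dom C v = Cod C u" "Dom C w = Cod C v"
  shows "(w \<cdot> v) \<cdot> u = w \<cdot> v \<cdot> u"
  using assms Comp_assoc by (simp add: Hom_iff)

end

context monoidal_category
begin

lemma TObj_Obj [simp]: "X \<in> Obj C \<Longrightarrow> Y \<in> Obj C \<Longrightarrow> X \<boxdot> Y \<in> Obj C"
  and TUnit_Obj [simp]: "TUnit C \<in> Obj C"
  by (fact TObj_in_Obj TUnit_in_Obj)+

lemma TArr_arr [simp]:
  assumes "u \<in> Arr C" "v \<in> Arr C"
  shows "u \<boxtimes> v \<in> Arr C" "Dom C (u \<boxtimes> v) = Dom C u \<boxdot> Dom C v" "Cod C (u \<boxtimes> v) = Cod C u \<boxdot> Cod C v"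
  using TArr_in_Hom[of u "Dom C u" "Cod C u" v "Dom C v" "Cod C v"] assms by (auto simp: Hom_iff)

lemma TArr_Ident_Ident [simp]: "X \<in> Obj C \<Longrightarrow> Y \<in> Obj C \<Longrightarrow> Ident C X \<boxtimes> Ident C Y = Ident C (X \<boxdot> Y)"
  by (rule TArr_Ident)

lemma TArr_Comp':
  assumes "u \<in> Arr C" "u' \<in> Arr C" "v \<in> Arr C" "v' \<in> Arr C" "Dom C u' = Cod C u" "Dom C v' = Cod C v"
  shows "(u' \<boxtimes> v') \<cdot> (u \<boxtimes> v) = (u' \<cdot> u) \<boxtimes> (v' \<cdot> v)"
  using TArr_Comp[of u "Dom C u" "Cod C u" u' "Cod C u'" v "Dom C v" "Cod C v" v' "Cod C v'"] assms
  by (simp add: Hom_iff)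

lemma Assoc_arr [simp]:
  assumes "X \<in> Obj C" "Y \<in> Obj C" "Z \<in> Obj C"
  shows "Assoc C X Y Z \<in> Arr C" "Dom C (Assoc C X Y Z) = X \<boxdot> (Y \<boxdot> Z)"
    "Cod C (Assoc C X Y Z) = (X \<boxdot> Y) \<boxdot> Z"
  using Assoc_in_Isom[OF assms] by (auto simp: Isom_def Hom_iff)

lemma LUnit_arr [simp]:
  assumes "X \<in> Obj C"
  shows "LUnit C X \<in> Arr C" "Dom C (LUnit C X) = TUnit C \<boxdot> X" "Cod C (LUnit C X) = X"
  using LUnit_in_Isom[OF assms] by (auto simp: Isom_def Hom_iff)

lemma RUnit_arr [simp]:
  assumes "X \<in> Obj C"
  shows "RUnit C X \<in> Arr C" "Dom C (RUnit C X) = X \<boxdot> TUnit C" "Cod C (RUnit C X) = X"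
  using RUnit_in_Isom[OF assms] by (auto simp: Isom_def Hom_iff)

lemma Assoc_nat:
  assumes "u \<in> Arr C" "v \<in> Arr C" "w \<in> Arr C"
  shows "((u \<boxtimes> v) \<boxtimes> w) \<cdot> Assoc C (Dom C u) (Dom C v) (Dom C w)
    = Assoc C (Cod C u) (Cod C v) (Cod C w) \<cdot> (u \<boxtimes> (v \<boxtimes> w))"
  by (rule Assoc_natural[symmetric]) (use assms in \<open>auto simp: Hom_iff\<close>)

lemma LUnit_nat: "u \<in> Arr C \<Longrightarrow> LUnit C (Cod C u) \<cdot> (Ident C (TUnit C) \<boxtimes> u) = u \<cdot> LUnit C (Dom C u)"
  and RUnit_nat: "u \<in> Arr C \<Longrightarrow> RUnit C (Cod C u) \<cdot> (u \<boxtimes> Ident C (TUnit C)) = u \<cdot> RUnit C (Dom C u)"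
  by (rule LUnit_natural RUnit_natural, simp add: Hom_iff)+

end

section \<open>Invertible objects and the scalars Aut(I)\<close>

context grouplike_monoidal_groupoid
begin

lemma inv_arr:
  assumes "u \<in> Arr C"
  shows inv_arr_arr [simp]: "inv_arr C u \<in> Arr C"
    and Dom_inv_arr [simp]: "Dom C (inv_arr C u) = Cod C u" and Cod_inv_arr [simp]: "Cod C (inv_arr C u) = Dom C u"
    and inv_arr_Comp [simp]: "inv_arr C u \<cdot> u = Ident C (Dom C u)"
    and Comp_inv_arr [simp]: "u \<cdot> inv_arr C u = Ident C (Cod C u)"
proof -
  obtain v where v: "inverse_arrows C u v" using all_invertible[OF assms] by blast
  have "w = v" if "inverse_arrows C u w" for w
  proof -
    have w: "w \<in> Arr C" "Dom C w = Cod C u" "Cod C w = Dom C u" "w \<cdot> u = Ident C (Dom C u)"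
      using that by (auto simp: inverse_arrows_def Hom_iff)
    have v': "v \<in> Arr C" "Dom C v = Cod C u" "Cod C v = Dom C u" "u \<cdot> v = Ident C (Cod C u)"
      using v by (auto simp: inverse_arrows_def Hom_iff)
    have "w = w \<cdot> (u \<cdot> v)" unfolding v'(4) using w(1-3) assms by simp
    also have "\<dots> = (w \<cdot> u) \<cdot> v" using w(1-3) v'(1-3) assms by simp
    also have "\<dots> = v" unfolding w(4) using v'(1-3) assms by simp
    finally show ?thesis .
  qed
  with v have "inverse_arrows C u (inv_arr C u)" unfolding inv_arr_def by (rule theI)
  then show "inv_arr C u \<in> Arr C" "Dom C (inv_arr C u) = Cod C u" "Cod C (inv_arr C u) = Dom C u"
    "inv_arr C u \<cdot> u = Ident C (Dom C u)" "u \<cdot> inv_arr C u = Ident C (Cod C u)"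
    by (auto simp: inverse_arrows_def Hom_iff)
qed

lemma Isom_eq_Hom: "Isom C X Y = Hom C X Y"
  using all_invertible by (auto simp: Isom_def Hom_def)

lemma inv_arr_Comp_left [simp]:
  assumes "u \<in> Arr C" "v \<in> Arr C" "Cod C v = Dom C u"
  shows "inv_arr C u \<cdot> u \<cdot> v = v"
  using Comp_assoc'[of v u "inv_arr C u"] assms by simp

lemma Comp_inv_arr_left [simp]:
  assumes "u \<in> Arr C" "v \<in> Arr C" "Cod C v = Cod C u"
  shows "u \<cdot> inv_arr C u \<cdot> v = v"
  using Comp_assoc'[of v "inv_arr C u" u] assms by simp

lemma Comp_left_cancel:
  assumes "w \<cdot> u = w \<cdot> v" "u \<in> Arr C" "v \<in> Arr C" "w \<in> Arr C" "Dom C w = Cod C u" "Dom C w = Cod C v"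
  shows "u = v"
proof -
  have "u = inv_arr C w \<cdot> w \<cdot> u" using assms(2-) by simp
  also have "\<dots> = inv_arr C w \<cdot> w \<cdot> v" unfolding assms(1) ..
  also have "\<dots> = v" using assms(3,4,6) by simp
  finally show ?thesis .
qed

lemma Comp_right_cancel:
  assumes "u \<cdot> w = v \<cdot> w" "u \<in> Arr C" "v \<in> Arr C" "w \<in> Arr C" "Dom C u = Cod C w" "Dom C v = Cod C w"
  shows "u = v"
proof -
  have "u = (u \<cdot> w) \<cdot> inv_arr C w" using assms(2,4,5) by simp
  also have "\<dots> = (v \<cdot> w) \<cdot> inv_arr C w" unfolding assms(1) ..
  also have "\<dots> = v" using assms(3,4,6) by simp
  finally show ?thesis .
qed

text \<open>Tensoring with \<open>X\<close> and then with \<open>Y\<close> is naturally isomorphic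
  to the identity, through (ZX)Y -> Z(XY) -> ZI -> Z. Faithfulness and fullness of tensoring with an
  invertible object follow from this.\<close>

lemma tensor_inverse_natural:
  assumes X: "X \<in> Obj C" and Y: "Y \<in> Obj C" and "Isom C (X \<boxdot> Y) (TUnit C) \<noteq> {}"
  obtains \<theta> where "\<And>Z. Z \<in> Obj C \<Longrightarrow> \<theta> Z \<in> Hom C ((Z \<boxdot> X) \<boxdot> Y) Z"
    "\<And>u. u \<in> Arr C \<Longrightarrow> \<theta> (Cod C u) \<cdot> ((u \<boxtimes> Ident C X) \<boxtimes> Ident C Y) = u \<cdot> \<theta> (Dom C u)"
proof -
  obtain k where k: "k \<in> Arr C" "Dom C k = X \<boxdot> Y" "Cod C k = TUnit C"
    using assms(3) by (auto simp: Isom_eq_Hom Hom_iff)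
  define \<theta> where "\<theta> Z = RUnit C Z \<cdot> (Ident C Z \<boxtimes> k) \<cdot> inv_arr C (Assoc C Z X Y)" for Z
  have \<theta>: "\<theta> Z \<in> Arr C" "Dom C (\<theta> Z) = (Z \<boxdot> X) \<boxdot> Y" "Cod C (\<theta> Z) = Z" if "Z \<in> Obj C" for Z
    using that k X Y by (simp_all add: \<theta>_def)
  have "\<theta> (Cod C u) \<cdot> ((u \<boxtimes> Ident C X) \<boxtimes> Ident C Y) = u \<cdot> \<theta> (Dom C u)" if u: "u \<in> Arr C" for u
  proof (rule Comp_right_cancel)
    let ?a = "Assoc C (Dom C u) X Y"
    have "(\<theta> (Cod C u) \<cdot> ((u \<boxtimes> Ident C X) \<boxtimes> Ident C Y)) \<cdot> ?a
      = \<theta> (Cod C u) \<cdot> Assoc C (Cod C u) X Y \<cdot> (u \<boxtimes> Ident C (X \<boxdot> Y))"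
      using Assoc_nat[of u "Ident C X" "Ident C Y"] \<theta> u X Y by simp
    also have "\<dots> = RUnit C (Cod C u) \<cdot> (Ident C (Cod C u) \<boxtimes> k) \<cdot> (u \<boxtimes> Ident C (X \<boxdot> Y))"
      using u X Y k by (simp add: \<theta>_def)
    also have "(Ident C (Cod C u) \<boxtimes> k) \<cdot> (u \<boxtimes> Ident C (X \<boxdot> Y))
      = (u \<boxtimes> Ident C (TUnit C)) \<cdot> (Ident C (Dom C u) \<boxtimes> k)"
      using u X Y k by (simp add: TArr_Comp')
    also have "RUnit C (Cod C u) \<cdot> \<dots> = (RUnit C (Cod C u) \<cdot> (u \<boxtimes> Ident C (TUnit C))) \<cdot> (Ident C (Dom C u) \<boxtimes> k)"
      using u X Y k by simp
    also have "\<dots> = u \<cdot> RUnit C (Dom C u) \<cdot> (Ident C (Dom C u) \<boxtimes> k)"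
      using u X Y k by (simp add: RUnit_nat)
    also have "\<dots> = (u \<cdot> \<theta> (Dom C u)) \<cdot> ?a"
      using u X Y k by (simp add: \<theta>_def)
    finally show "(\<theta> (Cod C u) \<cdot> ((u \<boxtimes> Ident C X) \<boxtimes> Ident C Y)) \<cdot> ?a = (u \<cdot> \<theta> (Dom C u)) \<cdot> ?a" .
  qed (use u X Y \<theta> in simp_all)
  with \<theta> show ?thesis by (intro that[of \<theta>]) (simp_all add: Hom_iff)
qed

lemma tensor_right_faithful:
  assumes X: "X \<in> Obj C" and u: "u \<in> Arr C" and v: "v \<in> Arr C" and "Dom C u = Dom C v" "Cod C u = Cod C v"
    and eq: "u \<boxtimes> Ident C X = v \<boxtimes> Ident C X"
  shows "u = v"
proof -
  obtain Y where Y: "Y \<in> Obj C" "Isom C (X \<boxdot> Y) (TUnit C) \<noteq> {}" using objects_invertible[OF X] by blast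
  obtain \<theta> where \<theta>: "\<And>Z. Z \<in> Obj C \<Longrightarrow> \<theta> Z \<in> Hom C ((Z \<boxdot> X) \<boxdot> Y) Z"
    "\<And>u. u \<in> Arr C \<Longrightarrow> \<theta> (Cod C u) \<cdot> ((u \<boxtimes> Ident C X) \<boxtimes> Ident C Y) = u \<cdot> \<theta> (Dom C u)"
    by (rule tensor_inverse_natural[OF X Y]) blast
  have "u \<cdot> \<theta> (Dom C u) = v \<cdot> \<theta> (Dom C u)"
    using \<theta>(2)[OF u] \<theta>(2)[OF v] assms by simp
  then show ?thesis
    by (rule Comp_right_cancel) (use \<theta>(1)[of "Dom C u"] assms in \<open>simp_all add: Hom_iff\<close>)
qed

text \<open>Conjugating \<open>w \<boxtimes> Ident C Y\<close> by \<open>\<theta>\<close> gives the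
  candidate \<open>u\<close>. By naturality \<open>u \<boxtimes> Ident C X\<close> and
  \<open>w\<close> agree after tensoring with \<open>Y\<close>, which is faithful.\<close>

lemma tensor_right_full:
  assumes X: "X \<in> Obj C" and w: "w \<in> Hom C (Z \<boxdot> X) (Z' \<boxdot> X)" and Z: "Z \<in> Obj C" "Z' \<in> Obj C"
  obtains u where "u \<in> Hom C Z Z'" "w = u \<boxtimes> Ident C X"
proof -
  obtain Y where Y: "Y \<in> Obj C" "Isom C (X \<boxdot> Y) (TUnit C) \<noteq> {}" using objects_invertible[OF X] by blast
  obtain \<theta> where \<theta>: "\<And>Z. Z \<in> Obj C \<Longrightarrow> \<theta> Z \<in> Hom C ((Z \<boxdot> X) \<boxdot> Y) Z"
    "\<And>u. u \<in> Arr C \<Longrightarrow> \<theta> (Cod C u) \<cdot> ((u \<boxtimes> Ident C X) \<boxtimes> Ident C Y) = u \<cdot> \<theta> (Dom C u)"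
    by (rule tensor_inverse_natural[OF X Y]) blast
  have \<theta>_arr [simp]: "\<theta> Z \<in> Arr C" "Dom C (\<theta> Z) = (Z \<boxdot> X) \<boxdot> Y" "Cod C (\<theta> Z) = Z" if "Z \<in> Obj C" for Z
    using \<theta>(1)[OF that] by (auto simp: Hom_iff)
  have w': "w \<in> Arr C" "Dom C w = Z \<boxdot> X" "Cod C w = Z' \<boxdot> X" using w by (auto simp: Hom_iff)
  define u where "u = \<theta> Z' \<cdot> (w \<boxtimes> Ident C Y) \<cdot> inv_arr C (\<theta> Z)"
  have u: "u \<in> Arr C" "Dom C u = Z" "Cod C u = Z'"
    using w' Z X Y by (simp_all add: u_def)
  have "\<theta> Z' \<cdot> ((u \<boxtimes> Ident C X) \<boxtimes> Ident C Y) = u \<cdot> \<theta> Z"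
    using \<theta>(2)[of u] u by simp
  also have "\<dots> = \<theta> Z' \<cdot> (w \<boxtimes> Ident C Y)"
    using w' Z X Y by (simp add: u_def)
  finally have "(u \<boxtimes> Ident C X) \<boxtimes> Ident C Y = w \<boxtimes> Ident C Y"
    by (rule Comp_left_cancel) (use u w' Z X Y in simp_all)
  then have "u \<boxtimes> Ident C X = w"
    by (rule tensor_right_faithful[OF Y(1), rotated 4]) (use u w' Z X in simp_all)
  with u that[of u] show ?thesis by (simp add: Hom_iff)
qed

lemma left_aut_arr [simp]:
  assumes "X \<in> Obj C" "a \<in> Arr C" "Dom C a = TUnit C" "Cod C a = TUnit C"
  shows "left_aut C X a \<in> Arr C" "Dom C (left_aut C X a) = X" "Cod C (left_aut C X a) = X"
  using assms by (simp_all add: left_aut_def)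

lemma right_aut_arr [simp]:
  assumes "X \<in> Obj C" "a \<in> Arr C" "Dom C a = TUnit C" "Cod C a = TUnit C"
  shows "right_aut C X a \<in> Arr C" "Dom C (right_aut C X a) = X" "Cod C (right_aut C X a) = X"
  using assms by (simp_all add: right_aut_def)

lemma left_aut_LUnit:
  assumes "X \<in> Obj C" "a \<in> Arr C" "Dom C a = TUnit C" "Cod C a = TUnit C"
  shows "left_aut C X a \<cdot> LUnit C X = LUnit C X \<cdot> (a \<boxtimes> Ident C X)"
  using assms by (simp add: left_aut_def)

lemma right_aut_RUnit:
  assumes "X \<in> Obj C" "a \<in> Arr C" "Dom C a = TUnit C" "Cod C a = TUnit C"
  shows "right_aut C X a \<cdot> RUnit C X = RUnit C X \<cdot> (Ident C X \<boxtimes> a)"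
  using assms by (simp add: right_aut_def)

lemma left_aut_Comp:
  assumes "X \<in> Obj C" "a \<in> Hom C (TUnit C) (TUnit C)" "b \<in> Hom C (TUnit C) (TUnit C)"
  shows "left_aut C X (a \<cdot> b) = left_aut C X a \<cdot> left_aut C X b"
proof -
  have ab: "a \<in> Arr C" "Dom C a = TUnit C" "Cod C a = TUnit C" "b \<in> Arr C" "Dom C b = TUnit C" "Cod C b = TUnit C"
    using assms(2,3) by (auto simp: Hom_iff)
  have "(a \<cdot> b) \<boxtimes> Ident C X = (a \<boxtimes> Ident C X) \<cdot> (b \<boxtimes> Ident C X)"
    using ab assms(1) by (simp add: TArr_Comp')
  then show ?thesis using ab assms(1) by (simp add: left_aut_def)
qed

lemma left_aut_Ident [simp]: "X \<in> Obj C \<Longrightarrow> left_aut C X (Ident C (TUnit C)) = Ident C X"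
  by (simp add: left_aut_def)

lemma left_aut_natural:
  assumes u: "u \<in> Arr C" and a: "a \<in> Hom C (TUnit C) (TUnit C)"
  shows "u \<cdot> left_aut C (Dom C u) a = left_aut C (Cod C u) a \<cdot> u"
proof (rule Comp_right_cancel)
  have a': "a \<in> Arr C" "Dom C a = TUnit C" "Cod C a = TUnit C" using a by (auto simp: Hom_iff)
  let ?I = "Ident C (TUnit C)"
  have "(u \<cdot> left_aut C (Dom C u) a) \<cdot> LUnit C (Dom C u) = (u \<cdot> LUnit C (Dom C u)) \<cdot> (a \<boxtimes> Ident C (Dom C u))"
    using a' u by (simp add: left_aut_LUnit)
  also have "\<dots> = LUnit C (Cod C u) \<cdot> (?I \<boxtimes> u) \<cdot> (a \<boxtimes> Ident C (Dom C u))"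
    using a' u by (simp flip: LUnit_nat)
  also have "(?I \<boxtimes> u) \<cdot> (a \<boxtimes> Ident C (Dom C u)) = (a \<boxtimes> Ident C (Cod C u)) \<cdot> (?I \<boxtimes> u)"
    using a' u by (simp add: TArr_Comp')
  also have "LUnit C (Cod C u) \<cdot> \<dots> = (LUnit C (Cod C u) \<cdot> (a \<boxtimes> Ident C (Cod C u))) \<cdot> (?I \<boxtimes> u)"
    using a' u by simp
  also have "\<dots> = left_aut C (Cod C u) a \<cdot> LUnit C (Cod C u) \<cdot> (?I \<boxtimes> u)"
    using a' u by (simp flip: left_aut_LUnit)
  also have "\<dots> = (left_aut C (Cod C u) a \<cdot> u) \<cdot> LUnit C (Dom C u)"
    using a' u by (simp add: LUnit_nat)
  finally show "(u \<cdot> left_aut C (Dom C u) a) \<cdot> LUnit C (Dom C u) = (left_aut C (Cod C u) a \<cdot> u) \<cdot> LUnit C (Dom C u)" .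
qed (use u a in \<open>simp_all add: Hom_iff\<close>)

lemma right_aut_natural:
  assumes u: "u \<in> Arr C" and a: "a \<in> Hom C (TUnit C) (TUnit C)"
  shows "u \<cdot> right_aut C (Dom C u) a = right_aut C (Cod C u) a \<cdot> u"
proof (rule Comp_right_cancel)
  have a': "a \<in> Arr C" "Dom C a = TUnit C" "Cod C a = TUnit C" using a by (auto simp: Hom_iff)
  let ?I = "Ident C (TUnit C)"
  have "(u \<cdot> right_aut C (Dom C u) a) \<cdot> RUnit C (Dom C u) = (u \<cdot> RUnit C (Dom C u)) \<cdot> (Ident C (Dom C u) \<boxtimes> a)"
    using a' u by (simp add: right_aut_RUnit)
  also have "\<dots> = RUnit C (Cod C u) \<cdot> (u \<boxtimes> ?I) \<cdot> (Ident C (Dom C u) \<boxtimes> a)"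
    using a' u by (simp flip: RUnit_nat)
  also have "(u \<boxtimes> ?I) \<cdot> (Ident C (Dom C u) \<boxtimes> a) = (Ident C (Cod C u) \<boxtimes> a) \<cdot> (u \<boxtimes> ?I)"
    using a' u by (simp add: TArr_Comp')
  also have "RUnit C (Cod C u) \<cdot> \<dots> = (RUnit C (Cod C u) \<cdot> (Ident C (Cod C u) \<boxtimes> a)) \<cdot> (u \<boxtimes> ?I)"
    using a' u by simp
  also have "\<dots> = right_aut C (Cod C u) a \<cdot> RUnit C (Cod C u) \<cdot> (u \<boxtimes> ?I)"
    using a' u by (simp flip: right_aut_RUnit)
  also have "\<dots> = (right_aut C (Cod C u) a \<cdot> u) \<cdot> RUnit C (Dom C u)"
    using a' u by (simp add: RUnit_nat)
  finally show "(u \<cdot> right_aut C (Dom C u) a) \<cdot> RUnit C (Dom C u) = (right_aut C (Cod C u) a \<cdot> u) \<cdot> RUnit C (Dom C u)" .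
qed (use u a in \<open>simp_all add: Hom_iff\<close>)

lemma left_aut_inj:
  assumes "X \<in> Obj C" "a \<in> Hom C (TUnit C) (TUnit C)" "b \<in> Hom C (TUnit C) (TUnit C)"
    and eq: "left_aut C X a = left_aut C X b"
  shows "a = b"
proof -
  have ab: "a \<in> Arr C" "Dom C a = TUnit C" "Cod C a = TUnit C" "b \<in> Arr C" "Dom C b = TUnit C" "Cod C b = TUnit C"
    using assms(2,3) by (auto simp: Hom_iff)
  have "LUnit C X \<cdot> (a \<boxtimes> Ident C X) = LUnit C X \<cdot> (b \<boxtimes> Ident C X)"
    using ab assms(1) eq left_aut_LUnit[of X a] left_aut_LUnit[of X b] by simp
  then have "a \<boxtimes> Ident C X = b \<boxtimes> Ident C X"
    by (rule Comp_left_cancel) (use ab assms(1) in simp_all)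
  then show ?thesis
    by (rule tensor_right_faithful[rotated 5]) (use ab assms(1) in simp_all)
qed

text \<open>Fullness of tensoring with \<open>X\<close>, transported along the left unit
  isomorphism. With \<open>left_aut_inj\<close> this identifies Aut(I) with Aut(X).\<close>

lemma left_aut_surj:
  assumes "X \<in> Obj C" "w \<in> Hom C X X"
  obtains a where "a \<in> Hom C (TUnit C) (TUnit C)" "left_aut C X a = w"
proof -
  have w: "w \<in> Arr C" "Dom C w = X" "Cod C w = X" using assms(2) by (auto simp: Hom_iff)
  have "inv_arr C (LUnit C X) \<cdot> w \<cdot> LUnit C X \<in> Hom C (TUnit C \<boxdot> X) (TUnit C \<boxdot> X)"
    using w assms(1) by (simp add: Hom_iff)
  then obtain a where a: "a \<in> Hom C (TUnit C) (TUnit C)"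
    "inv_arr C (LUnit C X) \<cdot> w \<cdot> LUnit C X = a \<boxtimes> Ident C X"
    by (rule tensor_right_full[OF assms(1)]) simp_all
  have "left_aut C X a = LUnit C X \<cdot> (inv_arr C (LUnit C X) \<cdot> w \<cdot> LUnit C X) \<cdot> inv_arr C (LUnit C X)"
    by (simp add: left_aut_def a(2))
  also have "\<dots> = w" using w assms(1) by simp
  finally show ?thesis using a(1) that by blast
qed

text \<open>Kelly's argument: the identity holds after applying the faithful functor \<open>I \<boxdot> _\<close>.\<close>

lemma LUnit_TObj:
  assumes X: "X \<in> Obj C" and Y: "Y \<in> Obj C"
  shows "(LUnit C X \<boxtimes> Ident C Y) \<cdot> Assoc C (TUnit C) X Y = LUnit C (X \<boxdot> Y)"
proof -
  let ?I = "TUnit C" and ?i = "Ident C (TUnit C)"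
  let ?k = "(LUnit C X \<boxtimes> Ident C Y) \<cdot> Assoc C ?I X Y"
  have "Assoc C ?I X Y \<cdot> (?i \<boxtimes> LUnit C (X \<boxdot> Y))
    = Assoc C ?I X Y \<cdot> (RUnit C ?I \<boxtimes> (Ident C X \<boxtimes> Ident C Y)) \<cdot> Assoc C ?I ?I (X \<boxdot> Y)"
    using X Y triangle[of ?I "X \<boxdot> Y"] by simp
  also have "\<dots> = (Assoc C ?I X Y \<cdot> (RUnit C ?I \<boxtimes> (Ident C X \<boxtimes> Ident C Y))) \<cdot> Assoc C ?I ?I (X \<boxdot> Y)"
    using X Y by (simp del: TArr_Ident_Ident)
  also have "Assoc C ?I X Y \<cdot> (RUnit C ?I \<boxtimes> (Ident C X \<boxtimes> Ident C Y))
    = ((RUnit C ?I \<boxtimes> Ident C X) \<boxtimes> Ident C Y) \<cdot> Assoc C (?I \<boxdot> ?I) X Y"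
    using X Y Assoc_nat[of "RUnit C ?I" "Ident C X" "Ident C Y"] by simp
  also have "\<dots> \<cdot> Assoc C ?I ?I (X \<boxdot> Y)
    = ((RUnit C ?I \<boxtimes> Ident C X) \<boxtimes> Ident C Y) \<cdot> Assoc C (?I \<boxdot> ?I) X Y \<cdot> Assoc C ?I ?I (X \<boxdot> Y)"
    using X Y by simp
  also have "\<dots> = (((RUnit C ?I \<boxtimes> Ident C X) \<boxtimes> Ident C Y) \<cdot> (Assoc C ?I ?I X \<boxtimes> Ident C Y))
      \<cdot> Assoc C ?I (?I \<boxdot> X) Y \<cdot> (?i \<boxtimes> Assoc C ?I X Y)"
    using X Y by (simp add: pentagon)
  also have "((RUnit C ?I \<boxtimes> Ident C X) \<boxtimes> Ident C Y) \<cdot> (Assoc C ?I ?I X \<boxtimes> Ident C Y)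
    = (?i \<boxtimes> LUnit C X) \<boxtimes> Ident C Y"
    using X Y triangle[of ?I X] by (simp add: TArr_Comp')
  also have "((?i \<boxtimes> LUnit C X) \<boxtimes> Ident C Y) \<cdot> Assoc C ?I (?I \<boxdot> X) Y \<cdot> (?i \<boxtimes> Assoc C ?I X Y)
    = (((?i \<boxtimes> LUnit C X) \<boxtimes> Ident C Y) \<cdot> Assoc C ?I (?I \<boxdot> X) Y) \<cdot> (?i \<boxtimes> Assoc C ?I X Y)"
    using X Y by simp
  also have "((?i \<boxtimes> LUnit C X) \<boxtimes> Ident C Y) \<cdot> Assoc C ?I (?I \<boxdot> X) Y
    = Assoc C ?I X Y \<cdot> (?i \<boxtimes> (LUnit C X \<boxtimes> Ident C Y))"
    using X Y Assoc_nat[of ?i "LUnit C X" "Ident C Y"] by simp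
  also have "\<dots> \<cdot> (?i \<boxtimes> Assoc C ?I X Y) = Assoc C ?I X Y \<cdot> (?i \<boxtimes> ?k)"
    using X Y by (simp add: TArr_Comp')
  finally have "?i \<boxtimes> LUnit C (X \<boxdot> Y) = ?i \<boxtimes> ?k"
    by (rule Comp_left_cancel) (use X Y in simp_all)
  \<comment> \<open>Naturality of the left unit strips off the tensor factor
    \<open>I\<close>.\<close>
  then have "LUnit C (X \<boxdot> Y) \<cdot> LUnit C (?I \<boxdot> (X \<boxdot> Y)) = ?k \<cdot> LUnit C (?I \<boxdot> (X \<boxdot> Y))"
    using X Y LUnit_nat[of "LUnit C (X \<boxdot> Y)"] LUnit_nat[of ?k] by simp
  then show ?thesis
    by (rule Comp_right_cancel[symmetric]) (use X Y in simp_all)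
qed

lemma left_aut_TObj:
  assumes X: "X \<in> Obj C" and Y: "Y \<in> Obj C" and a: "a \<in> Hom C (TUnit C) (TUnit C)"
  shows "left_aut C X a \<boxtimes> Ident C Y = left_aut C (X \<boxdot> Y) a"
proof (rule Comp_right_cancel)
  have a': "a \<in> Arr C" "Dom C a = TUnit C" "Cod C a = TUnit C" using a by (auto simp: Hom_iff)
  let ?a = "Assoc C (TUnit C) X Y"
  have "(left_aut C X a \<boxtimes> Ident C Y) \<cdot> LUnit C (X \<boxdot> Y)
    = ((left_aut C X a \<boxtimes> Ident C Y) \<cdot> (LUnit C X \<boxtimes> Ident C Y)) \<cdot> ?a"
    using X Y a' by (simp flip: LUnit_TObj)
  also have "(left_aut C X a \<boxtimes> Ident C Y) \<cdot> (LUnit C X \<boxtimes> Ident C Y)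
    = (LUnit C X \<boxtimes> Ident C Y) \<cdot> ((a \<boxtimes> Ident C X) \<boxtimes> Ident C Y)"
    using X Y a' by (simp add: TArr_Comp' left_aut_LUnit)
  also have "\<dots> \<cdot> ?a = (LUnit C X \<boxtimes> Ident C Y) \<cdot> ?a \<cdot> (a \<boxtimes> Ident C (X \<boxdot> Y))"
    using X Y a' Assoc_nat[of a "Ident C X" "Ident C Y"] by simp
  also have "\<dots> = ((LUnit C X \<boxtimes> Ident C Y) \<cdot> ?a) \<cdot> (a \<boxtimes> Ident C (X \<boxdot> Y))"
    using X Y a' by simp
  also have "\<dots> = left_aut C (X \<boxdot> Y) a \<cdot> LUnit C (X \<boxdot> Y)"
    using X Y a' by (simp only: LUnit_TObj) (simp add: left_aut_LUnit)
  finally show "(left_aut C X a \<boxtimes> Ident C Y) \<cdot> LUnit C (X \<boxdot> Y) = left_aut C (X \<boxdot> Y) a \<cdot> LUnit C (X \<boxdot> Y)" .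
qed (use X Y a in \<open>simp_all add: Hom_iff\<close>)

text \<open>The triangle axiom lets a scalar acting on the left of \<open>Y\<close> pass to the
  right of \<open>X\<close>. Combined with centrality, scalars can be extracted from either factor
  of a tensor product.\<close>

lemma right_aut_TObj:
  assumes X: "X \<in> Obj C" and Y: "Y \<in> Obj C" and a: "a \<in> Hom C (TUnit C) (TUnit C)"
  shows "Ident C X \<boxtimes> left_aut C Y a = right_aut C X a \<boxtimes> Ident C Y"
proof (rule Comp_right_cancel)
  have a': "a \<in> Arr C" "Dom C a = TUnit C" "Cod C a = TUnit C" using a by (auto simp: Hom_iff)
  let ?a = "Assoc C X (TUnit C) Y"
  have "(Ident C X \<boxtimes> left_aut C Y a) \<cdot> (Ident C X \<boxtimes> LUnit C Y)
    = (Ident C X \<boxtimes> LUnit C Y) \<cdot> (Ident C X \<boxtimes> (a \<boxtimes> Ident C Y))"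
    using X Y a' by (simp add: TArr_Comp' left_aut_LUnit)
  also have "\<dots> = (RUnit C X \<boxtimes> Ident C Y) \<cdot> ?a \<cdot> (Ident C X \<boxtimes> (a \<boxtimes> Ident C Y))"
    using X Y a' by (simp flip: triangle)
  also have "?a \<cdot> (Ident C X \<boxtimes> (a \<boxtimes> Ident C Y)) = ((Ident C X \<boxtimes> a) \<boxtimes> Ident C Y) \<cdot> ?a"
    using X Y a' Assoc_nat[of "Ident C X" a "Ident C Y"] by simp
  also have "(RUnit C X \<boxtimes> Ident C Y) \<cdot> \<dots> = ((RUnit C X \<boxtimes> Ident C Y) \<cdot> ((Ident C X \<boxtimes> a) \<boxtimes> Ident C Y)) \<cdot> ?a"
    using X Y a' by simp
  also have "(RUnit C X \<boxtimes> Ident C Y) \<cdot> ((Ident C X \<boxtimes> a) \<boxtimes> Ident C Y)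
    = (right_aut C X a \<boxtimes> Ident C Y) \<cdot> (RUnit C X \<boxtimes> Ident C Y)"
    using X Y a' by (simp add: TArr_Comp' right_aut_RUnit)
  also have "\<dots> \<cdot> ?a = (right_aut C X a \<boxtimes> Ident C Y) \<cdot> (Ident C X \<boxtimes> LUnit C Y)"
    using X Y a' by (simp flip: triangle)
  finally show "(Ident C X \<boxtimes> left_aut C Y a) \<cdot> (Ident C X \<boxtimes> LUnit C Y)
    = (right_aut C X a \<boxtimes> Ident C Y) \<cdot> (Ident C X \<boxtimes> LUnit C Y)" .
qed (use X Y a in \<open>simp_all add: Hom_iff\<close>)

end

section \<open>The cocycle and the commutator\<close>

text \<open>\<open>central\<close> is the triviality of the \<open>B\<close>-module structure in its
  usable form; \<open>central_if_trivial_action\<close> derives it from the definition of the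
  action.\<close>

locale central_grouplike_groupoid = grouplike_monoidal_groupoid C + A: comm_group A
  for C :: "('o, 'm, 'z) monoidal_category_scheme" (structure)
    and A :: "('a, 'v) monoid_scheme" +
  fixes \<alpha> :: "'a \<Rightarrow> 'm"
  assumes \<alpha>_iso: "\<alpha> \<in> iso A (pi1 C)"
    and central: "\<lbrakk>X \<in> Obj C; a \<in> carrier A\<rbrakk> \<Longrightarrow> left_aut C X (\<alpha> a) = right_aut C X (\<alpha> a)"
begin

lemma carrier_pi1: "carrier (pi1 C) = Hom C (TUnit C) (TUnit C)"
  by (simp add: pi1_def aut_group_def Isom_eq_Hom)

lemma \<alpha>_Hom: "a \<in> carrier A \<Longrightarrow> \<alpha> a \<in> Hom C (TUnit C) (TUnit C)"
  using \<alpha>_iso by (auto simp: iso_def hom_def carrier_pi1)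

lemma \<alpha>_arr [simp]:
  assumes "a \<in> carrier A"
  shows "\<alpha> a \<in> Arr C" "Dom C (\<alpha> a) = TUnit C" "Cod C (\<alpha> a) = TUnit C"
  using \<alpha>_Hom[OF assms] by (auto simp: Hom_iff)

lemma \<alpha>_mult: "a \<in> carrier A \<Longrightarrow> b \<in> carrier A \<Longrightarrow> \<alpha> (a \<otimes>\<^bsub>A\<^esub> b) = \<alpha> a \<cdot> \<alpha> b"
  using \<alpha>_iso by (auto simp: iso_def hom_def pi1_def aut_group_def)

lemma \<alpha>_one: "\<alpha> \<one>\<^bsub>A\<^esub> = Ident C (TUnit C)"
proof (rule Comp_left_cancel)
  show "\<alpha> \<one>\<^bsub>A\<^esub> \<cdot> \<alpha> \<one>\<^bsub>A\<^esub> = \<alpha> \<one>\<^bsub>A\<^esub> \<cdot> Ident C (TUnit C)"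
    using \<alpha>_mult[of "\<one>\<^bsub>A\<^esub>" "\<one>\<^bsub>A\<^esub>"] by simp
qed simp_all

text \<open>This makes every nonempty set of arrows between two objects a torsor under
  \<open>A\<close>. The rules below pull scalars out of compositions and tensor products, and
  \<open>act_cancel\<close> then turns an equation of arrows into one in \<open>A\<close>.\<close>

definition act :: "'a \<Rightarrow> 'm \<Rightarrow> 'm" (infixr \<open>\<bullet>\<close> 75) where
  "a \<bullet> u = left_aut C (Cod C u) (\<alpha> a) \<cdot> u"

lemma act_arr [simp]:
  assumes "a \<in> carrier A" "u \<in> Arr C"
  shows "a \<bullet> u \<in> Arr C" "Dom C (a \<bullet> u) = Dom C u" "Cod C (a \<bullet> u) = Cod C u"
  using assms by (simp_all add: act_def)

lemma act_one [simp]: "u \<in> Arr C \<Longrightarrow> \<one>\<^bsub>A\<^esub> \<bullet> u = u"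
  by (simp add: act_def \<alpha>_one)

lemma act_act [simp]:
  assumes "a \<in> carrier A" "b \<in> carrier A" "u \<in> Arr C"
  shows "a \<bullet> (b \<bullet> u) = (a \<otimes>\<^bsub>A\<^esub> b) \<bullet> u"
proof -
  have "left_aut C (Cod C u) (\<alpha> a \<cdot> \<alpha> b) = left_aut C (Cod C u) (\<alpha> a) \<cdot> left_aut C (Cod C u) (\<alpha> b)"
    using assms by (simp add: left_aut_Comp \<alpha>_Hom)
  with assms show ?thesis by (simp add: act_def \<alpha>_mult)
qed

lemma act_Comp [simp]:
  assumes "a \<in> carrier A" "u \<in> Arr C" "v \<in> Arr C" "Dom C v = Cod C u"
  shows "(a \<bullet> v) \<cdot> u = a \<bullet> (v \<cdot> u)" "v \<cdot> (a \<bullet> u) = a \<bullet> (v \<cdot> u)"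
proof -
  show "(a \<bullet> v) \<cdot> u = a \<bullet> (v \<cdot> u)" using assms by (simp add: act_def)
  have "v \<cdot> (a \<bullet> u) = (v \<cdot> left_aut C (Dom C v) (\<alpha> a)) \<cdot> u"
    using assms by (simp add: act_def)
  also have "\<dots> = (left_aut C (Cod C v) (\<alpha> a) \<cdot> v) \<cdot> u"
    by (simp only: left_aut_natural[OF assms(3) \<alpha>_Hom[OF assms(1)]])
  also have "\<dots> = a \<bullet> (v \<cdot> u)"
    using assms by (simp add: act_def)
  finally show "v \<cdot> (a \<bullet> u) = a \<bullet> (v \<cdot> u)" .
qed

lemma act_TArr [simp]:
  assumes "a \<in> carrier A" "u \<in> Arr C" "v \<in> Arr C"
  shows "(a \<bullet> u) \<boxtimes> v = a \<bullet> (u \<boxtimes> v)" "u \<boxtimes> (a \<bullet> v) = a \<bullet> (u \<boxtimes> v)"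
proof -
  have "(left_aut C (Cod C u) (\<alpha> a) \<boxtimes> Ident C (Cod C v)) \<cdot> (u \<boxtimes> v) = (a \<bullet> u) \<boxtimes> v"
    using assms by (simp add: TArr_Comp' act_def)
  then show "(a \<bullet> u) \<boxtimes> v = a \<bullet> (u \<boxtimes> v)"
    using assms by (simp add: left_aut_TObj \<alpha>_Hom act_def[of a "u \<boxtimes> v"])
  \<comment> \<open>For the right factor the scalar must cross \<open>Cod C u\<close>, which is
    where centrality is used.\<close>
  have "(Ident C (Cod C u) \<boxtimes> left_aut C (Cod C v) (\<alpha> a)) \<cdot> (u \<boxtimes> v) = u \<boxtimes> (a \<bullet> v)"
    using assms by (simp add: TArr_Comp' act_def)
  then show "u \<boxtimes> (a \<bullet> v) = a \<bullet> (u \<boxtimes> v)"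
    using assms by (simp add: right_aut_TObj left_aut_TObj \<alpha>_Hom act_def[of a "u \<boxtimes> v"] flip: central)
qed

lemma act_cancel:
  assumes "a \<bullet> u = b \<bullet> u" "a \<in> carrier A" "b \<in> carrier A" "u \<in> Arr C"
  shows "a = b"
proof -
  have "left_aut C (Cod C u) (\<alpha> a) = left_aut C (Cod C u) (\<alpha> b)"
    using assms(1)[unfolded act_def] by (rule Comp_right_cancel) (use assms in simp_all)
  then have "\<alpha> a = \<alpha> b"
    by (rule left_aut_inj[rotated 3]) (use assms \<alpha>_Hom in simp_all)
  then show ?thesis
    using \<alpha>_iso assms by (auto simp: iso_def bij_betw_def inj_on_def)
qed

lemma act_transitive:
  assumes "u \<in> Arr C" "v \<in> Arr C" "Dom C u = Dom C v" "Cod C u = Cod C v"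
  obtains a where "a \<in> carrier A" "u = a \<bullet> v"
proof -
  have "u \<cdot> inv_arr C v \<in> Hom C (Cod C v) (Cod C v)" using assms by (simp add: Hom_iff)
  then obtain b where b: "b \<in> Hom C (TUnit C) (TUnit C)" "left_aut C (Cod C v) b = u \<cdot> inv_arr C v"
    by (rule left_aut_surj[OF Cod_Obj[OF assms(2)]])
  then obtain a where a: "a \<in> carrier A" "b = \<alpha> a"
    using \<alpha>_iso by (auto simp: iso_def bij_betw_def carrier_pi1)
  have "a \<bullet> v = u" using b(2) a assms by (simp add: act_def)
  with a that show ?thesis by blast
qed

end

section \<open>The cocycle as the associativity defect of a product of arrows\<close>

locale grouplike_cocycle = central_grouplike_groupoid C A \<alpha> + B: comm_group B
  for C :: "('o, 'm, 'z) monoidal_category_scheme" (structure)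
    and A :: "('a, 'v) monoid_scheme" and \<alpha> :: "'a \<Rightarrow> 'm"
    and B :: "('b, 'w) monoid_scheme" +
  fixes \<beta> :: "'o set \<Rightarrow> 'b" and X :: "'b \<Rightarrow> 'o" and c :: "'b \<Rightarrow> 'b \<Rightarrow> 'm"
  assumes data: "cocycle_data C B \<beta> X c"
begin

lemma X_Obj [simp]: "x \<in> carrier B \<Longrightarrow> X x \<in> Obj C"
  using data by (simp add: cocycle_data_def)

lemma c_arr [simp]:
  assumes "x \<in> carrier B" "y \<in> carrier B"
  shows "c x y \<in> Arr C" "Dom C (c x y) = X x \<boxdot> X y" "Cod C (c x y) = X (x \<otimes>\<^bsub>B\<^esub> y)"
  using data assms by (auto simp: cocycle_data_def Hom_iff)

abbreviation f :: "'b \<Rightarrow> 'b \<Rightarrow> 'b \<Rightarrow> 'a" where "f \<equiv> cocycle C A B \<alpha> X c"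

text \<open>The definite description in \<open>cocycle\<close> is justified by the torsor structure:
  the two sides are parallel arrows, so they differ by exactly one scalar.\<close>

lemma cocycle_spec:
  assumes [simp]: "x \<in> carrier B" "y \<in> carrier B" "z \<in> carrier B"
  shows cocycle_closed: "f x y z \<in> carrier A"
    and cocycle_eq: "c (x \<otimes>\<^bsub>B\<^esub> y) z \<cdot> (c x y \<boxtimes> Ident C (X z)) \<cdot> Assoc C (X x) (X y) (X z)
      = f x y z \<bullet> (c x (y \<otimes>\<^bsub>B\<^esub> z) \<cdot> (Ident C (X x) \<boxtimes> c y z))"
proof -
  let ?L = "c (x \<otimes>\<^bsub>B\<^esub> y) z \<cdot> (c x y \<boxtimes> Ident C (X z)) \<cdot> Assoc C (X x) (X y) (X z)"
  let ?R = "c x (y \<otimes>\<^bsub>B\<^esub> z) \<cdot> (Ident C (X x) \<boxtimes> c y z)"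
  have "?L \<in> Arr C" "?R \<in> Arr C" "Dom C ?L = Dom C ?R" "Cod C ?L = Cod C ?R"
    by (simp_all add: B.m_assoc)
  then obtain a where a: "a \<in> carrier A" "?L = a \<bullet> ?R" by (rule act_transitive)
  have R: "left_aut C (X (x \<otimes>\<^bsub>B\<^esub> y \<otimes>\<^bsub>B\<^esub> z)) (\<alpha> b) \<cdot> ?R = b \<bullet> ?R" for b
    by (simp add: act_def B.m_assoc)
  have "f x y z = (THE b. b \<in> carrier A \<and> ?L = b \<bullet> ?R)"
    unfolding cocycle_def R ..
  also have "\<dots> = a"
    using a act_cancel[of _ ?R a] by (intro the_equality) auto
  finally show "f x y z \<in> carrier A" "?L = f x y z \<bullet> ?R" using a by simp_all
qed

text \<open>The product of arrows into \<open>X x\<close> and \<open>X y\<close>. It is associative up to \<open>f\<close>, which turns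
  the diagram chases below into computations in \<open>A\<close>.\<close>

definition m :: "'b \<Rightarrow> 'b \<Rightarrow> 'm \<Rightarrow> 'm \<Rightarrow> 'm" where
  "m x y p q = c x y \<cdot> (p \<boxtimes> q)"

abbreviation over :: "'b \<Rightarrow> 'm \<Rightarrow> bool" where
  "over x p \<equiv> x \<in> carrier B \<and> p \<in> Arr C \<and> Cod C p = X x"

lemma m_arr [simp]:
  assumes "over x p" "over y q"
  shows "m x y p q \<in> Arr C" "Cod C (m x y p q) = X (x \<otimes>\<^bsub>B\<^esub> y)" "Dom C (m x y p q) = Dom C p \<boxdot> Dom C q"
  using assms by (simp_all add: m_def)

lemma m_Comp:
  assumes "over x p" "over y q" "u \<in> Arr C" "v \<in> Arr C" "Dom C p = Cod C u" "Dom C q = Cod C v"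
  shows "m x y p q \<cdot> (u \<boxtimes> v) = m x y (p \<cdot> u) (q \<cdot> v)"
  using assms by (simp add: m_def TArr_Comp')

lemma m_Comp_left:
  assumes "over x p" "over y q" "u \<in> Arr C" "Dom C p = Cod C u" "Z = Dom C q"
  shows "m x y p q \<cdot> (u \<boxtimes> Ident C Z) = m x y (p \<cdot> u) q"
  using assms by (subst m_Comp) simp_all

lemma m_Comp_right:
  assumes "over x p" "over y q" "u \<in> Arr C" "Dom C q = Cod C u" "Z = Dom C p"
  shows "m x y p q \<cdot> (Ident C Z \<boxtimes> u) = m x y p (q \<cdot> u)"
  using assms by (subst m_Comp) simp_all

lemma m_act [simp]:
  assumes "over x p" "over y q" "a \<in> carrier A"
  shows "m x y (a \<bullet> p) q = a \<bullet> m x y p q" "m x y p (a \<bullet> q) = a \<bullet> m x y p q"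
  using assms by (simp_all add: m_def)

lemma m_Ident: "x \<in> carrier B \<Longrightarrow> y \<in> carrier B \<Longrightarrow> m x y (Ident C (X x)) (Ident C (X y)) = c x y"
  by (simp add: m_def)

lemma m_assoc:
  assumes "over x p" "over y q" "over z r" "P = Dom C p" "Q = Dom C q" "R = Dom C r"
  shows "m (x \<otimes>\<^bsub>B\<^esub> y) z (m x y p q) r \<cdot> Assoc C P Q R = f x y z \<bullet> m x (y \<otimes>\<^bsub>B\<^esub> z) p (m y z q r)"
proof -
  have xyz [simp]: "x \<in> carrier B" "y \<in> carrier B" "z \<in> carrier B"
    using assms by simp_all
  note [simp] = assms cocycle_closed
  have "(c x y \<boxtimes> Ident C (X z)) \<cdot> ((p \<boxtimes> q) \<boxtimes> r) = m x y p q \<boxtimes> r"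
    by (simp add: TArr_Comp' m_def)
  then have "m (x \<otimes>\<^bsub>B\<^esub> y) z (m x y p q) r \<cdot> Assoc C P Q R
    = c (x \<otimes>\<^bsub>B\<^esub> y) z \<cdot> ((c x y \<boxtimes> Ident C (X z)) \<cdot> ((p \<boxtimes> q) \<boxtimes> r)) \<cdot> Assoc C P Q R"
    by (simp add: m_def[of "x \<otimes>\<^bsub>B\<^esub> y"])
  also have "\<dots> = c (x \<otimes>\<^bsub>B\<^esub> y) z \<cdot> (c x y \<boxtimes> Ident C (X z)) \<cdot> ((p \<boxtimes> q) \<boxtimes> r) \<cdot> Assoc C P Q R"
    by simp
  also have "((p \<boxtimes> q) \<boxtimes> r) \<cdot> Assoc C P Q R = Assoc C (X x) (X y) (X z) \<cdot> (p \<boxtimes> (q \<boxtimes> r))"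
    using Assoc_nat[of p q r] by simp
  also have "c (x \<otimes>\<^bsub>B\<^esub> y) z \<cdot> (c x y \<boxtimes> Ident C (X z)) \<cdot> \<dots>
    = (c (x \<otimes>\<^bsub>B\<^esub> y) z \<cdot> (c x y \<boxtimes> Ident C (X z)) \<cdot> Assoc C (X x) (X y) (X z)) \<cdot> (p \<boxtimes> (q \<boxtimes> r))"
    by simp
  also have "\<dots> = f x y z \<bullet> (c x (y \<otimes>\<^bsub>B\<^esub> z) \<cdot> (Ident C (X x) \<boxtimes> c y z) \<cdot> (p \<boxtimes> (q \<boxtimes> r)))"
    by (simp only: cocycle_eq xyz) simp
  also have "(Ident C (X x) \<boxtimes> c y z) \<cdot> (p \<boxtimes> (q \<boxtimes> r)) = p \<boxtimes> m y z q r"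
    by (simp add: TArr_Comp' m_def)
  finally show ?thesis by (simp add: m_def[of x])
qed

text \<open>The scalar stays on the side of the inverse associator, so no inverses in
  \<open>A\<close> appear; the hexagons collect such factors on their left-hand sides.\<close>

lemma m_assoc_inv:
  assumes "over x p" "over y q" "over z r" "P = Dom C p" "Q = Dom C q" "R = Dom C r"
  shows "f x y z \<bullet> (m x (y \<otimes>\<^bsub>B\<^esub> z) p (m y z q r) \<cdot> inv_arr C (Assoc C P Q R)) = m (x \<otimes>\<^bsub>B\<^esub> y) z (m x y p q) r"
proof -
  have xyz [simp]: "x \<in> carrier B" "y \<in> carrier B" "z \<in> carrier B"
    using assms by simp_all
  have "f x y z \<bullet> (m x (y \<otimes>\<^bsub>B\<^esub> z) p (m y z q r) \<cdot> inv_arr C (Assoc C P Q R))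
    = (m (x \<otimes>\<^bsub>B\<^esub> y) z (m x y p q) r \<cdot> Assoc C P Q R) \<cdot> inv_arr C (Assoc C P Q R)"
    by (simp only: m_assoc[OF assms]) (use assms cocycle_closed in simp)
  also have "\<dots> = m (x \<otimes>\<^bsub>B\<^esub> y) z (m x y p q) r" using assms by simp
  finally show ?thesis .
qed

text \<open>The fourfold product bracketed to the left is composed with both sides of the pentagon.
  Each associator contributes one value of \<open>f\<close>, and both routes end at the product
  bracketed to the right.\<close>

lemma cocycle_pentagon:
  assumes [simp]: "w \<in> carrier B" "x \<in> carrier B" "y \<in> carrier B" "z \<in> carrier B"
  shows "f (w \<otimes>\<^bsub>B\<^esub> x) y z \<otimes>\<^bsub>A\<^esub> f w x (y \<otimes>\<^bsub>B\<^esub> z) = f w x y \<otimes>\<^bsub>A\<^esub> f w (x \<otimes>\<^bsub>B\<^esub> y) z \<otimes>\<^bsub>A\<^esub> f x y z"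
proof -
  note [simp] = cocycle_closed
  let ?i = "\<lambda>x. Ident C (X x)"
  let ?W = "X w" and ?X = "X x" and ?Y = "X y" and ?Z = "X z"
  let ?l = "m (w \<otimes>\<^bsub>B\<^esub> x \<otimes>\<^bsub>B\<^esub> y) z (m (w \<otimes>\<^bsub>B\<^esub> x) y (m w x (?i w) (?i x)) (?i y)) (?i z)"
  let ?r = "m w (x \<otimes>\<^bsub>B\<^esub> (y \<otimes>\<^bsub>B\<^esub> z)) (?i w) (m x (y \<otimes>\<^bsub>B\<^esub> z) (?i x) (m y z (?i y) (?i z)))"
  have "?l \<cdot> Assoc C (?W \<boxdot> ?X) ?Y ?Z \<cdot> Assoc C ?W ?X (?Y \<boxdot> ?Z)
    = (?l \<cdot> Assoc C (?W \<boxdot> ?X) ?Y ?Z) \<cdot> Assoc C ?W ?X (?Y \<boxdot> ?Z)" by simp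
  also have "\<dots> = f (w \<otimes>\<^bsub>B\<^esub> x) y z \<bullet>
      (m (w \<otimes>\<^bsub>B\<^esub> x) (y \<otimes>\<^bsub>B\<^esub> z) (m w x (?i w) (?i x)) (m y z (?i y) (?i z)) \<cdot> Assoc C ?W ?X (?Y \<boxdot> ?Z))"
    by (subst m_assoc) simp_all
  also have "\<dots> = (f (w \<otimes>\<^bsub>B\<^esub> x) y z \<otimes>\<^bsub>A\<^esub> f w x (y \<otimes>\<^bsub>B\<^esub> z)) \<bullet> ?r"
    by (subst m_assoc) simp_all
  finally have 1: "?l \<cdot> Assoc C (?W \<boxdot> ?X) ?Y ?Z \<cdot> Assoc C ?W ?X (?Y \<boxdot> ?Z)
    = (f (w \<otimes>\<^bsub>B\<^esub> x) y z \<otimes>\<^bsub>A\<^esub> f w x (y \<otimes>\<^bsub>B\<^esub> z)) \<bullet> ?r" .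
  have "?l \<cdot> Assoc C (?W \<boxdot> ?X) ?Y ?Z \<cdot> Assoc C ?W ?X (?Y \<boxdot> ?Z)
    = (?l \<cdot> (Assoc C ?W ?X ?Y \<boxtimes> Ident C ?Z)) \<cdot> Assoc C ?W (?X \<boxdot> ?Y) ?Z \<cdot> (Ident C ?W \<boxtimes> Assoc C ?X ?Y ?Z)"
    by (simp add: pentagon)
  also have "?l \<cdot> (Assoc C ?W ?X ?Y \<boxtimes> Ident C ?Z)
    = f w x y \<bullet> m (w \<otimes>\<^bsub>B\<^esub> (x \<otimes>\<^bsub>B\<^esub> y)) z (m w (x \<otimes>\<^bsub>B\<^esub> y) (?i w) (m x y (?i x) (?i y))) (?i z)"
    by (subst m_Comp_left) (simp_all add: m_assoc B.m_assoc flip: B.m_assoc)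
  also have "\<dots> \<cdot> Assoc C ?W (?X \<boxdot> ?Y) ?Z \<cdot> (Ident C ?W \<boxtimes> Assoc C ?X ?Y ?Z)
    = f w x y \<bullet> ((m (w \<otimes>\<^bsub>B\<^esub> (x \<otimes>\<^bsub>B\<^esub> y)) z (m w (x \<otimes>\<^bsub>B\<^esub> y) (?i w) (m x y (?i x) (?i y))) (?i z)
        \<cdot> Assoc C ?W (?X \<boxdot> ?Y) ?Z) \<cdot> (Ident C ?W \<boxtimes> Assoc C ?X ?Y ?Z))"
    by simp
  also have "\<dots> = (f w x y \<otimes>\<^bsub>A\<^esub> f w (x \<otimes>\<^bsub>B\<^esub> y) z) \<bullet>
      (m w (x \<otimes>\<^bsub>B\<^esub> y \<otimes>\<^bsub>B\<^esub> z) (?i w) (m (x \<otimes>\<^bsub>B\<^esub> y) z (m x y (?i x) (?i y)) (?i z)) \<cdot> (Ident C ?W \<boxtimes> Assoc C ?X ?Y ?Z))"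
    by (subst m_assoc) simp_all
  also have "m w (x \<otimes>\<^bsub>B\<^esub> y \<otimes>\<^bsub>B\<^esub> z) (?i w) (m (x \<otimes>\<^bsub>B\<^esub> y) z (m x y (?i x) (?i y)) (?i z)) \<cdot> (Ident C ?W \<boxtimes> Assoc C ?X ?Y ?Z)
    = m w (x \<otimes>\<^bsub>B\<^esub> y \<otimes>\<^bsub>B\<^esub> z) (?i w) (f x y z \<bullet> m x (y \<otimes>\<^bsub>B\<^esub> z) (?i x) (m y z (?i y) (?i z)))"
    by (subst m_Comp_right) (simp_all add: m_assoc)
  also have "\<dots> = f x y z \<bullet> ?r"
    by (simp add: B.m_assoc)
  also have "(f w x y \<otimes>\<^bsub>A\<^esub> f w (x \<otimes>\<^bsub>B\<^esub> y) z) \<bullet> \<dots>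
    = (f w x y \<otimes>\<^bsub>A\<^esub> f w (x \<otimes>\<^bsub>B\<^esub> y) z \<otimes>\<^bsub>A\<^esub> f x y z) \<bullet> ?r"
    by simp
  finally show ?thesis
    unfolding 1 by (rule act_cancel) simp_all
qed

end

section \<open>The pentagon's companions: scalars of a commutator section and their hexagons\<close>

lemma (in grouplike_cocycle) commutator_sections:
  assumes s: "\<And>x y. \<lbrakk>x \<in> carrier B; y \<in> carrier B\<rbrakk> \<Longrightarrow> s x y \<in> commutator_fibre C X x y"
  obtains \<sigma> where "\<And>x y. \<lbrakk>x \<in> carrier B; y \<in> carrier B\<rbrakk> \<Longrightarrow> \<sigma> x y \<in> carrier A"
    "\<And>x y. \<lbrakk>x \<in> carrier B; y \<in> carrier B\<rbrakk> \<Longrightarrow> c x y \<cdot> s x y = \<sigma> x y \<bullet> c y x"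
proof -
  have "\<exists>a. a \<in> carrier A \<and> c x y \<cdot> s x y = a \<bullet> c y x" if xy: "x \<in> carrier B" "y \<in> carrier B" for x y
  proof -
    have "s x y \<in> Arr C" "Dom C (s x y) = X y \<boxdot> X x" "Cod C (s x y) = X x \<boxdot> X y"
      using s[OF xy] by (auto simp: commutator_fibre_def Isom_eq_Hom Hom_iff)
    \<comment> \<open>Since \<open>B\<close> is commutative, both arrows run from
      \<open>X y \<boxdot> X x\<close> to the object chosen for the sum, so they differ by a
      scalar.\<close>
    then obtain a where "a \<in> carrier A" "c x y \<cdot> s x y = a \<bullet> c y x"
      by (rule_tac act_transitive[of "c x y \<cdot> s x y" "c y x"]) (use xy in \<open>simp_all add: B.m_comm\<close>)
    then show ?thesis by blast
  qed
  then show ?thesis using that by metis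
qed

locale grouplike_commutator = grouplike_cocycle C A \<alpha> B \<beta> X c
  for C :: "('o, 'm, 'z) monoidal_category_scheme" (structure)
    and A :: "('a, 'v) monoid_scheme" and \<alpha> :: "'a \<Rightarrow> 'm"
    and B :: "('b, 'w) monoid_scheme" and \<beta> :: "'o set \<Rightarrow> 'b" and X :: "'b \<Rightarrow> 'o" and c :: "'b \<Rightarrow> 'b \<Rightarrow> 'm" +
  fixes s :: "'b \<Rightarrow> 'b \<Rightarrow> 'm" and \<sigma> :: "'b \<Rightarrow> 'b \<Rightarrow> 'a"
  assumes s_fibre: "\<lbrakk>x \<in> carrier B; y \<in> carrier B\<rbrakk> \<Longrightarrow> s x y \<in> commutator_fibre C X x y"
    and \<sigma>_closed [simp]: "\<lbrakk>x \<in> carrier B; y \<in> carrier B\<rbrakk> \<Longrightarrow> \<sigma> x y \<in> carrier A"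
    and c_s: "\<lbrakk>x \<in> carrier B; y \<in> carrier B\<rbrakk> \<Longrightarrow> c x y \<cdot> s x y = \<sigma> x y \<bullet> c y x"
begin

lemma s_arr [simp]:
  assumes "x \<in> carrier B" "y \<in> carrier B"
  shows "s x y \<in> Arr C" "Dom C (s x y) = X y \<boxdot> X x" "Cod C (s x y) = X x \<boxdot> X y"
  using s_fibre[OF assms] by (auto simp: commutator_fibre_def Isom_eq_Hom Hom_iff)

abbreviation i :: "'b \<Rightarrow> 'm" where "i x \<equiv> Ident C (X x)"

lemma commutator_diagonal:
  assumes "x \<in> carrier B" "s x x = commutator_diagonal C X x"
  shows "\<sigma> x x = \<one>\<^bsub>A\<^esub>"
proof (rule act_cancel)
  show "\<sigma> x x \<bullet> c x x = \<one>\<^bsub>A\<^esub> \<bullet> c x x"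
    using c_s[of x x] assms by (simp add: commutator_diagonal_def)
qed (use assms in simp_all)

text \<open>The product of arrows is pushed through the chain defining
  \<open>commutator_plus1\<close>: an associator contributes a value of \<open>f\<close>, a
  commutator arrow a value of \<open>\<sigma>\<close>, and the single inverse associator the factor
  \<open>f x y x'\<close> on the left.\<close>

lemma commutator_hexagon1:
  assumes [simp]: "x \<in> carrier B" "x' \<in> carrier B" "y \<in> carrier B"
    and plus1: "s (x \<otimes>\<^bsub>B\<^esub> x') y = commutator_plus1 C X c x x' y (s x y) (s x' y)"
  shows "\<sigma> (x \<otimes>\<^bsub>B\<^esub> x') y \<otimes>\<^bsub>A\<^esub> f x y x' = f x x' y \<otimes>\<^bsub>A\<^esub> \<sigma> x' y \<otimes>\<^bsub>A\<^esub> \<sigma> x y \<otimes>\<^bsub>A\<^esub> f y x x'"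
proof -
  note [simp] = cocycle_closed m_Ident
  let ?X = "X x" and ?X' = "X x'" and ?Y = "X y"
  let ?a1 = "Assoc C ?X ?X' ?Y" and ?a2 = "inv_arr C (Assoc C ?X ?Y ?X')" and ?a3 = "Assoc C ?Y ?X ?X'"
  let ?l = "c (x \<otimes>\<^bsub>B\<^esub> x') y \<cdot> (c x x' \<boxtimes> i y)"
  let ?r = "m y (x \<otimes>\<^bsub>B\<^esub> x') (i y) (c x x')"
  have l: "?l = m (x \<otimes>\<^bsub>B\<^esub> x') y (c x x') (i y)" by (simp add: m_def)
  \<comment> \<open>Composing with \<open>c x x'\<close> at the source removes its inverse from the
    chain.\<close>
  have s_chain: "s (x \<otimes>\<^bsub>B\<^esub> x') y \<cdot> (i y \<boxtimes> c x x')
    = (c x x' \<boxtimes> i y) \<cdot> ?a1 \<cdot> (i x \<boxtimes> s x' y) \<cdot> ?a2 \<cdot> (s x y \<boxtimes> i x') \<cdot> ?a3"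
    unfolding plus1 by (simp add: commutator_plus1_def TArr_Comp')
  have "(c (x \<otimes>\<^bsub>B\<^esub> x') y \<cdot> s (x \<otimes>\<^bsub>B\<^esub> x') y) \<cdot> (i y \<boxtimes> c x x') = \<sigma> (x \<otimes>\<^bsub>B\<^esub> x') y \<bullet> ?r"
    by (simp add: c_s m_def)
  then have 1: "\<sigma> (x \<otimes>\<^bsub>B\<^esub> x') y \<bullet> ?r
    = ?l \<cdot> ?a1 \<cdot> (i x \<boxtimes> s x' y) \<cdot> ?a2 \<cdot> (s x y \<boxtimes> i x') \<cdot> ?a3"
    by (simp add: s_chain)
  have steps: "?l \<cdot> ?a1 = f x x' y \<bullet> m x (x' \<otimes>\<^bsub>B\<^esub> y) (i x) (c x' y)"
    "m x (x' \<otimes>\<^bsub>B\<^esub> y) (i x) (c x' y) \<cdot> (i x \<boxtimes> s x' y)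
    = \<sigma> x' y \<bullet> m x (y \<otimes>\<^bsub>B\<^esub> x') (i x) (c y x')"
    "f x y x' \<bullet> (m x (y \<otimes>\<^bsub>B\<^esub> x') (i x) (c y x') \<cdot> ?a2) = m (x \<otimes>\<^bsub>B\<^esub> y) x' (c x y) (i x')"
    "m (x \<otimes>\<^bsub>B\<^esub> y) x' (c x y) (i x') \<cdot> (s x y \<boxtimes> i x') = \<sigma> x y \<bullet> m (y \<otimes>\<^bsub>B\<^esub> x) x' (c y x) (i x')"
    "m (y \<otimes>\<^bsub>B\<^esub> x) x' (c y x) (i x') \<cdot> ?a3 = f y x x' \<bullet> ?r"
  proof -
    show "?l \<cdot> ?a1 = f x x' y \<bullet> m x (x' \<otimes>\<^bsub>B\<^esub> y) (i x) (c x' y)"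
      using m_assoc[of x "i x" x' "i x'" y "i y"] by (simp only: l) simp
    show "m x (x' \<otimes>\<^bsub>B\<^esub> y) (i x) (c x' y) \<cdot> (i x \<boxtimes> s x' y)
    = \<sigma> x' y \<bullet> m x (y \<otimes>\<^bsub>B\<^esub> x') (i x) (c y x')"
      by (subst m_Comp_right) (simp_all add: c_s B.m_comm[of x' y])
    show "f x y x' \<bullet> (m x (y \<otimes>\<^bsub>B\<^esub> x') (i x) (c y x') \<cdot> ?a2) = m (x \<otimes>\<^bsub>B\<^esub> y) x' (c x y) (i x')"
      using m_assoc_inv[of x "i x" y "i y" x' "i x'"] by simp
    show "m (x \<otimes>\<^bsub>B\<^esub> y) x' (c x y) (i x') \<cdot> (s x y \<boxtimes> i x') = \<sigma> x y \<bullet> m (y \<otimes>\<^bsub>B\<^esub> x) x' (c y x) (i x')"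
      by (subst m_Comp_left) (simp_all add: c_s B.m_comm[of x y])
    show "m (y \<otimes>\<^bsub>B\<^esub> x) x' (c y x) (i x') \<cdot> ?a3 = f y x x' \<bullet> ?r"
      using m_assoc[of y "i y" x "i x" x' "i x'"] by simp
  qed
  have "f x y x' \<bullet> (\<sigma> (x \<otimes>\<^bsub>B\<^esub> x') y \<bullet> ?r)
    = f x y x' \<bullet> ((?l \<cdot> ?a1) \<cdot> (i x \<boxtimes> s x' y) \<cdot> ?a2 \<cdot> (s x y \<boxtimes> i x') \<cdot> ?a3)"
    unfolding 1 by simp
  also have "\<dots> = f x y x' \<bullet> (f x x' y \<bullet> ((m x (x' \<otimes>\<^bsub>B\<^esub> y) (i x) (c x' y) \<cdot> (i x \<boxtimes> s x' y)) \<cdot> ?a2 \<cdot> (s x y \<boxtimes> i x') \<cdot> ?a3))"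
    unfolding steps(1) by simp
  also have "\<dots> = (f x x' y \<otimes>\<^bsub>A\<^esub> \<sigma> x' y) \<bullet> (f x y x' \<bullet> (m x (y \<otimes>\<^bsub>B\<^esub> x') (i x) (c y x') \<cdot> ?a2) \<cdot> (s x y \<boxtimes> i x') \<cdot> ?a3)"
    unfolding steps(2) by (simp add: A.m_ac)
  also have "\<dots> = (f x x' y \<otimes>\<^bsub>A\<^esub> \<sigma> x' y) \<bullet> ((m (x \<otimes>\<^bsub>B\<^esub> y) x' (c x y) (i x') \<cdot> (s x y \<boxtimes> i x')) \<cdot> ?a3)"
    unfolding steps(3) by simp
  also have "\<dots> = (f x x' y \<otimes>\<^bsub>A\<^esub> \<sigma> x' y) \<bullet> (\<sigma> x y \<bullet> (m (y \<otimes>\<^bsub>B\<^esub> x) x' (c y x) (i x') \<cdot> ?a3))"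
    unfolding steps(4) by simp
  also have "\<dots> = (f x x' y \<otimes>\<^bsub>A\<^esub> \<sigma> x' y \<otimes>\<^bsub>A\<^esub> \<sigma> x y \<otimes>\<^bsub>A\<^esub> f y x x') \<bullet> ?r"
    unfolding steps(5) by (simp add: A.m_assoc)
  finally have "(\<sigma> (x \<otimes>\<^bsub>B\<^esub> x') y \<otimes>\<^bsub>A\<^esub> f x y x') \<bullet> ?r
    = (f x x' y \<otimes>\<^bsub>A\<^esub> \<sigma> x' y \<otimes>\<^bsub>A\<^esub> \<sigma> x y \<otimes>\<^bsub>A\<^esub> f y x x') \<bullet> ?r"
    by (simp add: A.m_comm)
  then show ?thesis by (rule act_cancel) simp_all
qed

text \<open>The same evaluation for the second law. Here two of the three associators occur
  inverted, so two values of \<open>f\<close> stand on the left.\<close>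

lemma commutator_hexagon2:
  assumes [simp]: "x \<in> carrier B" "y \<in> carrier B" "y' \<in> carrier B"
    and plus2: "s x (y \<otimes>\<^bsub>B\<^esub> y') = commutator_plus2 C X c x y y' (s x y) (s x y')"
  shows "\<sigma> x (y \<otimes>\<^bsub>B\<^esub> y') \<otimes>\<^bsub>A\<^esub> f x y y' \<otimes>\<^bsub>A\<^esub> f y y' x = \<sigma> x y \<otimes>\<^bsub>A\<^esub> f y x y' \<otimes>\<^bsub>A\<^esub> \<sigma> x y'"
proof -
  note [simp] = cocycle_closed m_Ident
  let ?X = "X x" and ?Y = "X y" and ?Y' = "X y'"
  let ?a1 = "inv_arr C (Assoc C ?X ?Y ?Y')" and ?a2 = "Assoc C ?Y ?X ?Y'" and ?a3 = "Assoc C ?Y ?Y' ?X"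
  let ?l = "c x (y \<otimes>\<^bsub>B\<^esub> y') \<cdot> (i x \<boxtimes> c y y')"
  let ?r = "m y (y' \<otimes>\<^bsub>B\<^esub> x) (i y) (c y' x)"
  have l: "?l = m x (y \<otimes>\<^bsub>B\<^esub> y') (i x) (c y y')" by (simp add: m_def)
  \<comment> \<open>Composing also with the associator \<open>?a3\<close> removes both inverse
    arrows at the source of the chain.\<close>
  have s_chain: "s x (y \<otimes>\<^bsub>B\<^esub> y') \<cdot> (c y y' \<boxtimes> i x) \<cdot> ?a3
    = (i x \<boxtimes> c y y') \<cdot> ?a1 \<cdot> (s x y \<boxtimes> i y') \<cdot> ?a2 \<cdot> (i y \<boxtimes> s x y')"
  proof -
    have "s x (y \<otimes>\<^bsub>B\<^esub> y') \<cdot> (c y y' \<boxtimes> i x)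
      = (i x \<boxtimes> c y y') \<cdot> ?a1 \<cdot> (s x y \<boxtimes> i y') \<cdot> ?a2 \<cdot> (i y \<boxtimes> s x y') \<cdot> inv_arr C ?a3"
      unfolding plus2 by (simp add: commutator_plus2_def TArr_Comp')
    then have "(s x (y \<otimes>\<^bsub>B\<^esub> y') \<cdot> (c y y' \<boxtimes> i x)) \<cdot> ?a3
      = ((i x \<boxtimes> c y y') \<cdot> ?a1 \<cdot> (s x y \<boxtimes> i y') \<cdot> ?a2 \<cdot> (i y \<boxtimes> s x y') \<cdot> inv_arr C ?a3) \<cdot> ?a3"
      by (simp only:)
    then show ?thesis by simp
  qed
  have "(c x (y \<otimes>\<^bsub>B\<^esub> y') \<cdot> s x (y \<otimes>\<^bsub>B\<^esub> y')) \<cdot> (c y y' \<boxtimes> i x) \<cdot> ?a3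
    = \<sigma> x (y \<otimes>\<^bsub>B\<^esub> y') \<bullet> (m (y \<otimes>\<^bsub>B\<^esub> y') x (c y y') (i x) \<cdot> ?a3)"
    by (simp add: c_s m_def)
  also have "m (y \<otimes>\<^bsub>B\<^esub> y') x (c y y') (i x) \<cdot> ?a3 = f y y' x \<bullet> ?r"
    using m_assoc[of y "i y" y' "i y'" x "i x"] by simp
  finally have 1: "\<sigma> x (y \<otimes>\<^bsub>B\<^esub> y') \<bullet> (f y y' x \<bullet> ?r)
    = ?l \<cdot> ?a1 \<cdot> (s x y \<boxtimes> i y') \<cdot> ?a2 \<cdot> (i y \<boxtimes> s x y')"
    by (simp add: s_chain)
  have steps: "f x y y' \<bullet> (?l \<cdot> ?a1) = m (x \<otimes>\<^bsub>B\<^esub> y) y' (c x y) (i y')"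
    "m (x \<otimes>\<^bsub>B\<^esub> y) y' (c x y) (i y') \<cdot> (s x y \<boxtimes> i y') = \<sigma> x y \<bullet> m (y \<otimes>\<^bsub>B\<^esub> x) y' (c y x) (i y')"
    "m (y \<otimes>\<^bsub>B\<^esub> x) y' (c y x) (i y') \<cdot> ?a2 = f y x y' \<bullet> m y (x \<otimes>\<^bsub>B\<^esub> y') (i y) (c x y')"
    "m y (x \<otimes>\<^bsub>B\<^esub> y') (i y) (c x y') \<cdot> (i y \<boxtimes> s x y') = \<sigma> x y' \<bullet> ?r"
  proof -
    show "f x y y' \<bullet> (?l \<cdot> ?a1) = m (x \<otimes>\<^bsub>B\<^esub> y) y' (c x y) (i y')"
      using m_assoc_inv[of x "i x" y "i y" y' "i y'"] by (simp only: l) simp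
    show "m (x \<otimes>\<^bsub>B\<^esub> y) y' (c x y) (i y') \<cdot> (s x y \<boxtimes> i y') = \<sigma> x y \<bullet> m (y \<otimes>\<^bsub>B\<^esub> x) y' (c y x) (i y')"
      by (subst m_Comp_left) (simp_all add: c_s B.m_comm[of x y])
    show "m (y \<otimes>\<^bsub>B\<^esub> x) y' (c y x) (i y') \<cdot> ?a2 = f y x y' \<bullet> m y (x \<otimes>\<^bsub>B\<^esub> y') (i y) (c x y')"
      using m_assoc[of y "i y" x "i x" y' "i y'"] by simp
    show "m y (x \<otimes>\<^bsub>B\<^esub> y') (i y) (c x y') \<cdot> (i y \<boxtimes> s x y') = \<sigma> x y' \<bullet> ?r"
      by (subst m_Comp_right) (simp_all add: c_s B.m_comm[of x y'])
  qed
  have "f x y y' \<bullet> (\<sigma> x (y \<otimes>\<^bsub>B\<^esub> y') \<bullet> (f y y' x \<bullet> ?r))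
    = f x y y' \<bullet> (?l \<cdot> ?a1) \<cdot> (s x y \<boxtimes> i y') \<cdot> ?a2 \<cdot> (i y \<boxtimes> s x y')"
    unfolding 1 by simp
  also have "\<dots> = (m (x \<otimes>\<^bsub>B\<^esub> y) y' (c x y) (i y') \<cdot> (s x y \<boxtimes> i y')) \<cdot> ?a2 \<cdot> (i y \<boxtimes> s x y')"
    unfolding steps(1) by simp
  also have "\<dots> = \<sigma> x y \<bullet> ((m (y \<otimes>\<^bsub>B\<^esub> x) y' (c y x) (i y') \<cdot> ?a2) \<cdot> (i y \<boxtimes> s x y'))"
    unfolding steps(2) by simp
  also have "\<dots> = \<sigma> x y \<bullet> (f y x y' \<bullet> (m y (x \<otimes>\<^bsub>B\<^esub> y') (i y) (c x y') \<cdot> (i y \<boxtimes> s x y')))"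
    unfolding steps(3) by simp
  also have "\<dots> = (\<sigma> x y \<otimes>\<^bsub>A\<^esub> f y x y' \<otimes>\<^bsub>A\<^esub> \<sigma> x y') \<bullet> ?r"
    unfolding steps(4) by (simp add: A.m_assoc)
  finally have "(\<sigma> x (y \<otimes>\<^bsub>B\<^esub> y') \<otimes>\<^bsub>A\<^esub> f x y y' \<otimes>\<^bsub>A\<^esub> f y y' x) \<bullet> ?r
    = (\<sigma> x y \<otimes>\<^bsub>A\<^esub> f y x y' \<otimes>\<^bsub>A\<^esub> \<sigma> x y') \<bullet> ?r"
    by (simp add: A.m_ac)
  then show ?thesis by (rule act_cancel) simp_all
qed

end

section \<open>The monoidal equivalence\<close>

context grouplike_monoidal_groupoid
begin

lemma iso_class_iff: "Y \<in> iso_class C X \<longleftrightarrow> Y \<in> Obj C \<and> Hom C X Y \<noteq> {}"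
  by (simp add: iso_class_def Isom_eq_Hom)

lemma iso_class_eq_iff:
  assumes "X \<in> Obj C" "Y \<in> Obj C"
  shows "iso_class C X = iso_class C Y \<longleftrightarrow> Hom C X Y \<noteq> {}"
proof
  assume "iso_class C X = iso_class C Y"
  moreover have "Y \<in> iso_class C Y"
    using Ident_in_Hom[OF assms(2)] assms by (auto simp: iso_class_iff)
  ultimately show "Hom C X Y \<noteq> {}" by (metis iso_class_iff)
next
  assume "Hom C X Y \<noteq> {}"
  then obtain u where u: "u \<in> Hom C X Y" by blast
  then have u': "inv_arr C u \<in> Hom C Y X" by (simp add: Hom_iff)
  have "Hom C X Z \<noteq> {} \<longleftrightarrow> Hom C Y Z \<noteq> {}" for Z
    using Comp_in_Hom[OF u, of _ Z] Comp_in_Hom[OF u', of _ Z] by blast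
  then show "iso_class C X = iso_class C Y" by (auto simp: iso_class_iff)
qed

lemma iso_class_in_pi0: "X \<in> Obj C \<Longrightarrow> iso_class C X \<in> carrier (pi0 C)"
  by (simp add: pi0_def)

lemma iso_class_TObj:
  assumes X: "X \<in> Obj C" and Y: "Y \<in> Obj C"
  shows "iso_class C X \<otimes>\<^bsub>pi0 C\<^esub> iso_class C Y = iso_class C (X \<boxdot> Y)"
proof -
  have "Hom C (X \<boxdot> Y) Z \<noteq> {}" if "Hom C (X' \<boxdot> Y') Z \<noteq> {}" "X' \<in> iso_class C X" "Y' \<in> iso_class C Y" for X' Y' Z
  proof -
    from that obtain u v w where "u \<in> Hom C X X'" "v \<in> Hom C Y Y'" "w \<in> Hom C (X' \<boxdot> Y') Z"
      by (auto simp: iso_class_iff)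
    then have "w \<cdot> (u \<boxtimes> v) \<in> Hom C (X \<boxdot> Y) Z" by (rule Comp_in_Hom[OF TArr_in_Hom])
    then show ?thesis by blast
  qed
  moreover have "X \<in> iso_class C X" "Y \<in> iso_class C Y"
    using Ident_in_Hom X Y by (auto simp: iso_class_iff)
  ultimately have "(\<exists>X'\<in>iso_class C X. \<exists>Y'\<in>iso_class C Y. Hom C (X' \<boxdot> Y') Z \<noteq> {}) \<longleftrightarrow> Hom C (X \<boxdot> Y) Z \<noteq> {}" for Z
    by blast
  then show ?thesis by (simp add: pi0_def iso_class_def[of _ "X \<boxdot> Y"] Isom_eq_Hom)
qed

lemma pi0_iso:
  assumes "\<beta> \<in> iso (pi0 C) B"
  shows pi0_iso_closed: "X \<in> Obj C \<Longrightarrow> \<beta> (iso_class C X) \<in> carrier B"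
    and pi0_iso_eq_iff: "X \<in> Obj C \<Longrightarrow> Y \<in> Obj C \<Longrightarrow> \<beta> (iso_class C X) = \<beta> (iso_class C Y) \<longleftrightarrow> Hom C X Y \<noteq> {}"
    and pi0_iso_TObj: "X \<in> Obj C \<Longrightarrow> Y \<in> Obj C \<Longrightarrow>
      \<beta> (iso_class C (X \<boxdot> Y)) = \<beta> (iso_class C X) \<otimes>\<^bsub>B\<^esub> \<beta> (iso_class C Y)"
proof -
  have hom: "\<beta> \<in> hom (pi0 C) B" and inj: "inj_on \<beta> (carrier (pi0 C))"
    using assms by (auto simp: iso_def bij_betw_def)
  show "X \<in> Obj C \<Longrightarrow> \<beta> (iso_class C X) \<in> carrier B"
    using hom iso_class_in_pi0 by (auto simp: hom_def)
  show "X \<in> Obj C \<Longrightarrow> Y \<in> Obj C \<Longrightarrow> \<beta> (iso_class C X) = \<beta> (iso_class C Y) \<longleftrightarrow> Hom C X Y \<noteq> {}"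
    using inj iso_class_in_pi0 by (simp add: inj_on_eq_iff iso_class_eq_iff)
  show "X \<in> Obj C \<Longrightarrow> Y \<in> Obj C \<Longrightarrow> \<beta> (iso_class C (X \<boxdot> Y)) = \<beta> (iso_class C X) \<otimes>\<^bsub>B\<^esub> \<beta> (iso_class C Y)"
    using hom_mult[OF hom] iso_class_in_pi0 by (simp flip: iso_class_TObj)
qed

text \<open>\<^const>\<open>module_action\<close> is a definite description: it has to be shown that the right action of
  \<open>a\<close> is given by an element \<open>a'\<close> which does not depend on the object within its class.\<close>

lemma central_if_trivial_action:
  assumes "comm_group A" and \<alpha>: "\<alpha> \<in> iso A (pi1 C)" and \<beta>: "\<beta> \<in> iso (pi0 C) B"
    and trivial: "\<forall>x\<in>carrier B. \<forall>a\<in>carrier A. module_action C A \<alpha> \<beta> x a = a"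
    and X: "X \<in> Obj C" and a: "a \<in> carrier A"
  shows "left_aut C X (\<alpha> a) = right_aut C X (\<alpha> a)"
proof -
  have bij: "bij_betw \<alpha> (carrier A) (Hom C (TUnit C) (TUnit C))"
    using \<alpha> by (simp add: iso_def pi1_def aut_group_def Isom_eq_Hom)
  then have \<alpha>_Hom: "\<alpha> b \<in> Hom C (TUnit C) (TUnit C)" if "b \<in> carrier A" for b
    using that by (auto simp: bij_betw_def)
  then have \<alpha>_arr [simp]: "\<alpha> b \<in> Arr C" "Dom C (\<alpha> b) = TUnit C" "Cod C (\<alpha> b) = TUnit C" if "b \<in> carrier A" for b
    using that by (auto simp: Hom_iff)
  define P where "P b \<longleftrightarrow> b \<in> carrier A \<and> (\<forall>Y\<in>Obj C. \<beta> (iso_class C Y) = \<beta> (iso_class C X) \<longrightarrow>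
    left_aut C Y (\<alpha> b) = right_aut C Y (\<alpha> a))" for b
  have "right_aut C X (\<alpha> a) \<in> Hom C X X" using X a by (simp add: Hom_iff)
  with X obtain g where g: "g \<in> Hom C (TUnit C) (TUnit C)" "left_aut C X g = right_aut C X (\<alpha> a)"
    by (rule left_aut_surj)
  have "g \<in> \<alpha> ` carrier A" using bij g(1) by (simp add: bij_betw_def)
  then obtain b where b: "b \<in> carrier A" "left_aut C X (\<alpha> b) = right_aut C X (\<alpha> a)"
    using g(2) by blast
  have "left_aut C Y (\<alpha> b) = right_aut C Y (\<alpha> a)"
    if Y: "Y \<in> Obj C" "\<beta> (iso_class C Y) = \<beta> (iso_class C X)" for Y
  proof -
    obtain u where "u \<in> Hom C X Y" using pi0_iso_eq_iff[OF \<beta> X Y(1)] Y(2) by auto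
    then have u: "u \<in> Arr C" "Dom C u = X" "Cod C u = Y" by (auto simp: Hom_iff)
    have "left_aut C Y (\<alpha> b) \<cdot> u = u \<cdot> left_aut C X (\<alpha> b)"
      using left_aut_natural[OF u(1) \<alpha>_Hom[OF b(1)]] u by simp
    also have "\<dots> = right_aut C Y (\<alpha> a) \<cdot> u"
      using right_aut_natural[OF u(1) \<alpha>_Hom[OF a]] u b(2) by simp
    finally show ?thesis by (rule Comp_right_cancel) (use u Y b a in simp_all)
  qed
  with b have "P b" by (simp add: P_def)
  moreover have "b' = b" if "P b'" for b'
  proof -
    have b': "b' \<in> carrier A" "left_aut C X (\<alpha> b') = left_aut C X (\<alpha> b)"
      using that b X by (auto simp: P_def)
    then have "\<alpha> b' = \<alpha> b" using left_aut_inj[OF X \<alpha>_Hom \<alpha>_Hom] b by blast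
    with bij b b' show ?thesis by (auto simp: bij_betw_def inj_on_def)
  qed
  ultimately have "P (THE b. P b)" by (rule theI)
  moreover have "(THE b. P b) = a"
    using trivial pi0_iso_closed[OF \<beta> X] a by (simp add: module_action_def P_def)
  ultimately show ?thesis using X by (simp add: P_def)
qed

end

section \<open>Rescaling the chosen arrows, and the equivalence with the trivial groupoid\<close>

context grouplike_cocycle
begin

lemma cocycle_eqI:
  assumes [simp]: "x \<in> carrier B" "y \<in> carrier B" "z \<in> carrier B" and a: "a \<in> carrier A"
    and "c (x \<otimes>\<^bsub>B\<^esub> y) z \<cdot> (c x y \<boxtimes> Ident C (X z)) \<cdot> Assoc C (X x) (X y) (X z)
      = a \<bullet> (c x (y \<otimes>\<^bsub>B\<^esub> z) \<cdot> (Ident C (X x) \<boxtimes> c y z))"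
  shows "f x y z = a"
  using assms(5)[unfolded cocycle_eq[OF assms(1-3)]]
  by (rule act_cancel) (use a cocycle_closed in simp_all)

text \<open>Multiplying \<open>c\<close> by \<open>h\<close> divides the cocycle by the coboundary
  of \<open>h\<close>, because \<open>m\<close> is bilinear for the action of
  \<open>A\<close>.\<close>

lemma trivialised_data:
  assumes h: "h \<in> carrier B \<rightarrow> carrier B \<rightarrow> carrier A"
    and f: "\<And>x y z. \<lbrakk>x \<in> carrier B; y \<in> carrier B; z \<in> carrier B\<rbrakk> \<Longrightarrow>
      f x y z = h y z \<otimes>\<^bsub>A\<^esub> inv\<^bsub>A\<^esub> h (x \<otimes>\<^bsub>B\<^esub> y) z \<otimes>\<^bsub>A\<^esub> h x (y \<otimes>\<^bsub>B\<^esub> z) \<otimes>\<^bsub>A\<^esub> inv\<^bsub>A\<^esub> h x y"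
  shows "grouplike_cocycle C A \<alpha> B \<beta> X (\<lambda>x y. h x y \<bullet> c x y)"
    and "\<lbrakk>x \<in> carrier B; y \<in> carrier B; z \<in> carrier B\<rbrakk> \<Longrightarrow>
      cocycle C A B \<alpha> X (\<lambda>x y. h x y \<bullet> c x y) x y z = \<one>\<^bsub>A\<^esub>"
proof -
  have h_closed [simp]: "h x y \<in> carrier A" if "x \<in> carrier B" "y \<in> carrier B" for x y
    using h that by blast
  show "grouplike_cocycle C A \<alpha> B \<beta> X (\<lambda>x y. h x y \<bullet> c x y)"
    by unfold_locales (use data in \<open>simp add: cocycle_data_def Hom_iff\<close>)
  then interpret c': grouplike_cocycle C A \<alpha> B \<beta> X "\<lambda>x y. h x y \<bullet> c x y" .
  show "cocycle C A B \<alpha> X (\<lambda>x y. h x y \<bullet> c x y) x y z = \<one>\<^bsub>A\<^esub>"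
    if xyz [simp]: "x \<in> carrier B" "y \<in> carrier B" "z \<in> carrier B"
  proof (rule c'.cocycle_eqI)
    let ?R = "c x (y \<otimes>\<^bsub>B\<^esub> z) \<cdot> (Ident C (X x) \<boxtimes> c y z)"
    \<comment> \<open>Brings each value of \<open>h\<close> next to its inverse.\<close>
    have ac: "(a \<otimes>\<^bsub>A\<^esub> b) \<otimes>\<^bsub>A\<^esub> (q \<otimes>\<^bsub>A\<^esub> a' \<otimes>\<^bsub>A\<^esub> p \<otimes>\<^bsub>A\<^esub> b') = (a \<otimes>\<^bsub>A\<^esub> a') \<otimes>\<^bsub>A\<^esub> (b \<otimes>\<^bsub>A\<^esub> b') \<otimes>\<^bsub>A\<^esub> (p \<otimes>\<^bsub>A\<^esub> q)"
      if "a \<in> carrier A" "b \<in> carrier A" "q \<in> carrier A" "a' \<in> carrier A" "p \<in> carrier A" "b' \<in> carrier A"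
      for a b q a' p b' using that by (simp add: A.m_ac)
    have "(h (x \<otimes>\<^bsub>B\<^esub> y) z \<bullet> c (x \<otimes>\<^bsub>B\<^esub> y) z) \<cdot> ((h x y \<bullet> c x y) \<boxtimes> Ident C (X z)) \<cdot> Assoc C (X x) (X y) (X z)
      = (h (x \<otimes>\<^bsub>B\<^esub> y) z \<otimes>\<^bsub>A\<^esub> h x y) \<bullet> (f x y z \<bullet> ?R)"
      by (simp add: A.m_comm flip: cocycle_eq)
    also have "\<dots> = ((h (x \<otimes>\<^bsub>B\<^esub> y) z \<otimes>\<^bsub>A\<^esub> h x y) \<otimes>\<^bsub>A\<^esub> f x y z) \<bullet> ?R"
      using cocycle_closed by (intro act_act) simp_all
    also have "(h (x \<otimes>\<^bsub>B\<^esub> y) z \<otimes>\<^bsub>A\<^esub> h x y) \<otimes>\<^bsub>A\<^esub> f x y z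
      = (h (x \<otimes>\<^bsub>B\<^esub> y) z \<otimes>\<^bsub>A\<^esub> inv\<^bsub>A\<^esub> h (x \<otimes>\<^bsub>B\<^esub> y) z) \<otimes>\<^bsub>A\<^esub> (h x y \<otimes>\<^bsub>A\<^esub> inv\<^bsub>A\<^esub> h x y) \<otimes>\<^bsub>A\<^esub> (h x (y \<otimes>\<^bsub>B\<^esub> z) \<otimes>\<^bsub>A\<^esub> h y z)"
      unfolding f[OF xyz] by (rule ac) simp_all
    also have "\<dots> = h x (y \<otimes>\<^bsub>B\<^esub> z) \<otimes>\<^bsub>A\<^esub> h y z" by simp
    also have "\<dots> \<bullet> ?R = \<one>\<^bsub>A\<^esub> \<bullet> ((h x (y \<otimes>\<^bsub>B\<^esub> z) \<bullet> c x (y \<otimes>\<^bsub>B\<^esub> z)) \<cdot> (Ident C (X x) \<boxtimes> (h y z \<bullet> c y z)))"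
      by (simp add: A.m_comm)
    finally show "(h (x \<otimes>\<^bsub>B\<^esub> y) z \<bullet> c (x \<otimes>\<^bsub>B\<^esub> y) z) \<cdot> ((h x y \<bullet> c x y) \<boxtimes> Ident C (X z)) \<cdot> Assoc C (X x) (X y) (X z)
      = \<one>\<^bsub>A\<^esub> \<bullet> ((h x (y \<otimes>\<^bsub>B\<^esub> z) \<bullet> c x (y \<otimes>\<^bsub>B\<^esub> z)) \<cdot> (Ident C (X x) \<boxtimes> (h y z \<bullet> c y z)))" .
  qed simp_all
qed

end

lemma Isom_trivial_monoidal_groupoid:
  assumes "group A" "group B"
  shows "u \<in> Isom (trivial_monoidal_groupoid B A) x y \<longleftrightarrow> x = y \<and> x \<in> carrier B \<and> u \<in> {x} \<times> carrier A"
proof -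
  interpret A: group A by fact
  interpret B: group B by fact
  have "\<exists>v. inverse_arrows (trivial_monoidal_groupoid B A) (x, a) v" if "x \<in> carrier B" "a \<in> carrier A" for x a
    by (rule exI[of _ "(x, inv\<^bsub>A\<^esub> a)"])
      (use that in \<open>simp add: inverse_arrows_def Hom_def trivial_monoidal_groupoid_def\<close>)
  then show ?thesis
    by (cases u) (auto simp: Isom_def Hom_def trivial_monoidal_groupoid_def)
qed

text \<open>Arrows \<open>\<theta> Z\<close> to the chosen representatives give every arrow a
  coordinate \<open>F u\<close> in \<open>A\<close>. The scalar \<open>\<mu> Y Z\<close> compares
  \<open>\<theta>\<close> of a tensor product with the product of the two \<open>\<theta>\<close>;
  it is coherent because the product \<open>m\<close> is strictly associative up to associators when
  \<open>f\<close> is 1.\<close>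

lemma (in grouplike_cocycle) monoidally_equivalent_trivial:
  assumes \<beta>: "\<beta> \<in> iso (pi0 C) B"
    and f: "\<And>x y z. \<lbrakk>x \<in> carrier B; y \<in> carrier B; z \<in> carrier B\<rbrakk> \<Longrightarrow> f x y z = \<one>\<^bsub>A\<^esub>"
  shows "monoidally_equivalent C (trivial_monoidal_groupoid B A)"
proof -
  let ?D = "trivial_monoidal_groupoid B A"
  note D = trivial_monoidal_groupoid_def
  note Isom_D = Isom_trivial_monoidal_groupoid[OF A.group_axioms B.group_axioms]
  define cl where "cl Z = \<beta> (iso_class C Z)" for Z
  have cl [simp]: "cl Z \<in> carrier B" if "Z \<in> Obj C" for Z
    using pi0_iso_closed[OF \<beta> that] by (simp add: cl_def)
  have cl_TObj [simp]: "cl (Y \<boxdot> Z) = cl Y \<otimes>\<^bsub>B\<^esub> cl Z" if "Y \<in> Obj C" "Z \<in> Obj C" for Y Z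
    using pi0_iso_TObj[OF \<beta> that] by (simp add: cl_def)
  have cl_eq: "cl Y = cl Z \<longleftrightarrow> Hom C Y Z \<noteq> {}" if "Y \<in> Obj C" "Z \<in> Obj C" for Y Z
    using pi0_iso_eq_iff[OF \<beta> that] by (simp add: cl_def)
  have cl_Cod [simp]: "cl (Cod C u) = cl (Dom C u)" if "u \<in> Arr C" for u
    using cl_eq[of "Dom C u" "Cod C u"] that by (auto simp: Hom_def)
  have cl_X [simp]: "cl (X x) = x" if "x \<in> carrier B" for x
    using data that by (simp add: cocycle_data_def cl_def)
  have cl_I [simp]: "cl (TUnit C) = \<one>\<^bsub>B\<^esub>"
  proof -
    have "cl (TUnit C) \<otimes>\<^bsub>B\<^esub> cl (TUnit C) = cl (TUnit C)"
      using cl_Cod[of "LUnit C (TUnit C)"] by simp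
    then show ?thesis using B.r_cancel_one cl TUnit_Obj by blast
  qed
  have "\<exists>u. u \<in> Hom C Z (X (cl Z))" if "Z \<in> Obj C" for Z
    using cl_eq[of Z "X (cl Z)"] that by auto
  then obtain \<theta> where \<theta>: "\<And>Z. Z \<in> Obj C \<Longrightarrow> \<theta> Z \<in> Hom C Z (X (cl Z))" by metis
  then have \<theta>_arr [simp]: "\<theta> Z \<in> Arr C" "Dom C (\<theta> Z) = Z" "Cod C (\<theta> Z) = X (cl Z)" if "Z \<in> Obj C" for Z
    using that by (auto simp: Hom_iff)

  define ratio where "ratio u v = (SOME a. a \<in> carrier A \<and> u = a \<bullet> v)" for u v
  have ratio: "ratio u v \<in> carrier A" "ratio u v \<bullet> v = u"
    if "u \<in> Arr C" "v \<in> Arr C" "Dom C u = Dom C v" "Cod C u = Cod C v" for u v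
  proof -
    have "\<exists>a. a \<in> carrier A \<and> u = a \<bullet> v" using act_transitive[OF that] by blast
    then show "ratio u v \<in> carrier A" "ratio u v \<bullet> v = u"
      unfolding ratio_def by (metis (mono_tags, lifting) someI_ex)+
  qed
  define F where "F u = ratio (\<theta> (Cod C u) \<cdot> u) (\<theta> (Dom C u))" for u
  have F_closed [simp]: "F u \<in> carrier A" and F: "F u \<bullet> \<theta> (Dom C u) = \<theta> (Cod C u) \<cdot> u" if "u \<in> Arr C" for u
    using ratio[of "\<theta> (Cod C u) \<cdot> u" "\<theta> (Dom C u)"] that by (simp_all add: F_def)
  have F_eqI: "F u = a" if "\<theta> (Cod C u) \<cdot> u = a \<bullet> \<theta> (Dom C u)" "u \<in> Arr C" "a \<in> carrier A" for u a
    by (rule act_cancel[of _ "\<theta> (Dom C u)"]) (use that F[of u] in simp_all)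
  have F_Comp: "F (v \<cdot> u) = F v \<otimes>\<^bsub>A\<^esub> F u" if [simp]: "u \<in> Arr C" "v \<in> Arr C" "Dom C v = Cod C u" for u v
  proof (rule F_eqI)
    have "\<theta> (Cod C (v \<cdot> u)) \<cdot> v \<cdot> u = (\<theta> (Cod C v) \<cdot> v) \<cdot> u" by simp
    also have "\<dots> = F v \<bullet> (\<theta> (Cod C u) \<cdot> u)" by (simp flip: F)
    also have "\<dots> = (F v \<otimes>\<^bsub>A\<^esub> F u) \<bullet> \<theta> (Dom C (v \<cdot> u))" by (simp flip: F)
    finally show "\<theta> (Cod C (v \<cdot> u)) \<cdot> v \<cdot> u = (F v \<otimes>\<^bsub>A\<^esub> F u) \<bullet> \<theta> (Dom C (v \<cdot> u))" .
  qed simp_all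
  have F_Ident [simp]: "F (Ident C Z) = \<one>\<^bsub>A\<^esub>" if "Z \<in> Obj C" for Z
    by (rule F_eqI) (use that in simp_all)

  define \<theta>2 where "\<theta>2 Y Z = m (cl Y) (cl Z) (\<theta> Y) (\<theta> Z)" for Y Z
  have \<theta>2_arr [simp]: "\<theta>2 Y Z \<in> Arr C" "Dom C (\<theta>2 Y Z) = Y \<boxdot> Z" "Cod C (\<theta>2 Y Z) = X (cl Y \<otimes>\<^bsub>B\<^esub> cl Z)"
    if "Y \<in> Obj C" "Z \<in> Obj C" for Y Z
    using that by (simp_all add: \<theta>2_def)
  define \<mu> where "\<mu> Y Z = ratio (\<theta> (Y \<boxdot> Z)) (\<theta>2 Y Z)" for Y Z
  have \<mu>_closed [simp]: "\<mu> Y Z \<in> carrier A" and \<mu>: "\<theta> (Y \<boxdot> Z) = \<mu> Y Z \<bullet> \<theta>2 Y Z" if "Y \<in> Obj C" "Z \<in> Obj C" for Y Z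
    using ratio[of "\<theta> (Y \<boxdot> Z)" "\<theta>2 Y Z"] that by (simp_all add: \<mu>_def)

  have \<mu>_natural: "\<mu> (Cod C u) (Cod C v) \<otimes>\<^bsub>A\<^esub> (F u \<otimes>\<^bsub>A\<^esub> F v) = F (u \<boxtimes> v) \<otimes>\<^bsub>A\<^esub> \<mu> (Dom C u) (Dom C v)"
    if [simp]: "u \<in> Arr C" "v \<in> Arr C" for u v
  proof (rule act_cancel)
    have "\<theta>2 (Cod C u) (Cod C v) \<cdot> (u \<boxtimes> v) = m (cl (Dom C u)) (cl (Dom C v)) (\<theta> (Cod C u) \<cdot> u) (\<theta> (Cod C v) \<cdot> v)"
      by (simp add: \<theta>2_def m_Comp)
    also have "\<dots> = (F u \<otimes>\<^bsub>A\<^esub> F v) \<bullet> \<theta>2 (Dom C u) (Dom C v)"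
      by (simp add: \<theta>2_def A.m_comm flip: F)
    finally have 1: "\<theta>2 (Cod C u) (Cod C v) \<cdot> (u \<boxtimes> v) = (F u \<otimes>\<^bsub>A\<^esub> F v) \<bullet> \<theta>2 (Dom C u) (Dom C v)" .
    have "(\<mu> (Cod C u) (Cod C v) \<otimes>\<^bsub>A\<^esub> (F u \<otimes>\<^bsub>A\<^esub> F v)) \<bullet> \<theta>2 (Dom C u) (Dom C v)
      = \<mu> (Cod C u) (Cod C v) \<bullet> ((F u \<otimes>\<^bsub>A\<^esub> F v) \<bullet> \<theta>2 (Dom C u) (Dom C v))"
      by simp
    also have "\<dots> = (\<mu> (Cod C u) (Cod C v) \<bullet> \<theta>2 (Cod C u) (Cod C v)) \<cdot> (u \<boxtimes> v)"
      unfolding 1[symmetric] by simp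
    also have "\<dots> = \<theta> (Cod C (u \<boxtimes> v)) \<cdot> (u \<boxtimes> v)" by (simp add: \<mu>)
    also have "\<dots> = F (u \<boxtimes> v) \<bullet> \<theta> (Dom C (u \<boxtimes> v))" by (rule F[symmetric]) simp
    also have "\<dots> = (F (u \<boxtimes> v) \<otimes>\<^bsub>A\<^esub> \<mu> (Dom C u) (Dom C v)) \<bullet> \<theta>2 (Dom C u) (Dom C v)" by (simp add: \<mu>)
    finally show "(\<mu> (Cod C u) (Cod C v) \<otimes>\<^bsub>A\<^esub> (F u \<otimes>\<^bsub>A\<^esub> F v)) \<bullet> \<theta>2 (Dom C u) (Dom C v)
      = (F (u \<boxtimes> v) \<otimes>\<^bsub>A\<^esub> \<mu> (Dom C u) (Dom C v)) \<bullet> \<theta>2 (Dom C u) (Dom C v)" .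
  qed simp_all

  have \<mu>_assoc: "F (Assoc C P Q R) \<otimes>\<^bsub>A\<^esub> (\<mu> P (Q \<boxdot> R) \<otimes>\<^bsub>A\<^esub> \<mu> Q R) = \<mu> (P \<boxdot> Q) R \<otimes>\<^bsub>A\<^esub> \<mu> P Q"
    if [simp]: "P \<in> Obj C" "Q \<in> Obj C" "R \<in> Obj C" for P Q R
  proof (rule act_cancel)
    let ?t = "m (cl P) (cl Q \<otimes>\<^bsub>B\<^esub> cl R) (\<theta> P) (\<theta>2 Q R)"
    have "(F (Assoc C P Q R) \<otimes>\<^bsub>A\<^esub> (\<mu> P (Q \<boxdot> R) \<otimes>\<^bsub>A\<^esub> \<mu> Q R)) \<bullet> ?t
      = F (Assoc C P Q R) \<bullet> (\<mu> P (Q \<boxdot> R) \<bullet> m (cl P) (cl Q \<otimes>\<^bsub>B\<^esub> cl R) (\<theta> P) (\<mu> Q R \<bullet> \<theta>2 Q R))"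
      by (simp add: A.m_assoc)
    also have "\<dots> = F (Assoc C P Q R) \<bullet> \<theta> (Dom C (Assoc C P Q R))"
      by (simp add: \<theta>2_def[of P] \<mu>[of P] flip: \<mu>[of Q R])
    also have "\<dots> = \<theta> ((P \<boxdot> Q) \<boxdot> R) \<cdot> Assoc C P Q R" by (subst F) simp_all
    also have "\<theta> ((P \<boxdot> Q) \<boxdot> R) = (\<mu> (P \<boxdot> Q) R \<otimes>\<^bsub>A\<^esub> \<mu> P Q) \<bullet> m (cl P \<otimes>\<^bsub>B\<^esub> cl Q) (cl R) (\<theta>2 P Q) (\<theta> R)"
      by (simp add: \<mu>[of "P \<boxdot> Q"] \<theta>2_def[of "P \<boxdot> Q"] \<mu>[of P Q])
    also have "\<dots> \<cdot> Assoc C P Q R = (\<mu> (P \<boxdot> Q) R \<otimes>\<^bsub>A\<^esub> \<mu> P Q) \<bullet> ?t"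
      using m_assoc[of "cl P" "\<theta> P" "cl Q" "\<theta> Q" "cl R" "\<theta> R" P Q R] f by (simp add: \<theta>2_def)
    finally show "(F (Assoc C P Q R) \<otimes>\<^bsub>A\<^esub> (\<mu> P (Q \<boxdot> R) \<otimes>\<^bsub>A\<^esub> \<mu> Q R)) \<bullet> ?t
      = (\<mu> (P \<boxdot> Q) R \<otimes>\<^bsub>A\<^esub> \<mu> P Q) \<bullet> ?t" .
  qed simp_all

  let ?I = "TUnit C"
  \<comment> \<open>The value forced by the left unit axiom at \<open>I\<close>.\<close>
  define \<iota> where "\<iota> = inv\<^bsub>A\<^esub> (F (LUnit C ?I) \<otimes>\<^bsub>A\<^esub> \<mu> ?I ?I)"
  have \<iota>_closed [simp]: "\<iota> \<in> carrier A" by (simp add: \<iota>_def)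
  \<comment> \<open>The triangle shows that both sides have a common value, independent of
    \<open>P\<close> and \<open>Q\<close>. Hence the single scalar \<open>\<iota>\<close> satisfies
    the unit axioms at all objects, although neither \<open>c\<close> nor \<open>\<theta>\<close> is
    normalised.\<close>
  have unit: "F (LUnit C Q) \<otimes>\<^bsub>A\<^esub> \<mu> ?I Q = F (RUnit C P) \<otimes>\<^bsub>A\<^esub> \<mu> P ?I"
    if [simp]: "P \<in> Obj C" "Q \<in> Obj C" for P Q
  proof -
    have r: "\<mu> P Q \<otimes>\<^bsub>A\<^esub> F (RUnit C P) = F (RUnit C P \<boxtimes> Ident C Q) \<otimes>\<^bsub>A\<^esub> \<mu> (P \<boxdot> ?I) Q"
      and l: "\<mu> P Q \<otimes>\<^bsub>A\<^esub> F (LUnit C Q) = F (Ident C P \<boxtimes> LUnit C Q) \<otimes>\<^bsub>A\<^esub> \<mu> P (?I \<boxdot> Q)"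
      using \<mu>_natural[of "RUnit C P" "Ident C Q"] \<mu>_natural[of "Ident C P" "LUnit C Q"] by simp_all
    have t: "F (Ident C P \<boxtimes> LUnit C Q) = F (RUnit C P \<boxtimes> Ident C Q) \<otimes>\<^bsub>A\<^esub> F (Assoc C P ?I Q)"
      using triangle[of P Q] by (simp flip: F_Comp)
    have "\<mu> P Q \<otimes>\<^bsub>A\<^esub> (F (LUnit C Q) \<otimes>\<^bsub>A\<^esub> \<mu> ?I Q)
      = F (RUnit C P \<boxtimes> Ident C Q) \<otimes>\<^bsub>A\<^esub> (F (Assoc C P ?I Q) \<otimes>\<^bsub>A\<^esub> (\<mu> P (?I \<boxdot> Q) \<otimes>\<^bsub>A\<^esub> \<mu> ?I Q))"
      using l t by (simp flip: A.m_assoc)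
    also have "\<dots> = (F (RUnit C P \<boxtimes> Ident C Q) \<otimes>\<^bsub>A\<^esub> \<mu> (P \<boxdot> ?I) Q) \<otimes>\<^bsub>A\<^esub> \<mu> P ?I"
      by (simp add: \<mu>_assoc A.m_assoc)
    also have "\<dots> = \<mu> P Q \<otimes>\<^bsub>A\<^esub> (F (RUnit C P) \<otimes>\<^bsub>A\<^esub> \<mu> P ?I)"
      by (simp add: A.m_assoc flip: r)
    finally show ?thesis by simp
  qed
  have unit_l: "F (LUnit C Z) \<otimes>\<^bsub>A\<^esub> (\<mu> ?I Z \<otimes>\<^bsub>A\<^esub> \<iota>) = \<one>\<^bsub>A\<^esub>" if "Z \<in> Obj C" for Z
    using unit[of ?I Z] unit[of ?I ?I] that by (simp add: \<iota>_def flip: A.m_assoc)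
  have unit_r: "F (RUnit C Z) \<otimes>\<^bsub>A\<^esub> (\<mu> Z ?I \<otimes>\<^bsub>A\<^esub> \<iota>) = \<one>\<^bsub>A\<^esub>" if "Z \<in> Obj C" for Z
    using unit[of Z ?I] that by (simp add: \<iota>_def flip: A.m_assoc)

  define Fa where "Fa u = (cl (Dom C u), F u)" for u
  define M where "M Y Z = (cl Y \<otimes>\<^bsub>B\<^esub> cl Z, \<mu> Y Z)" for Y Z
  have is_functor_Fa: "is_functor C ?D cl Fa"
    by (auto simp: is_functor_def D Fa_def Hom_def F_Comp)
  have "is_monoidal_functor C ?D cl Fa M (\<one>\<^bsub>B\<^esub>, \<iota>)"
    unfolding is_monoidal_functor_def
  proof (intro conjI ballI)
    show "M Y Z \<in> Isom ?D (cl Y \<boxdot>\<^bsub>?D\<^esub> cl Z) (cl (Y \<boxdot> Z))" if "Y \<in> Obj C" "Z \<in> Obj C" for Y Z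
      using that by (simp add: M_def Isom_D) (simp add: D)
    show "(\<one>\<^bsub>B\<^esub>, \<iota>) \<in> Isom ?D (TUnit ?D) (cl ?I)"
      by (simp add: Isom_D) (simp add: D)
    show "M (Cod C u) (Cod C v) \<cdot>\<^bsub>?D\<^esub> (Fa u \<boxtimes>\<^bsub>?D\<^esub> Fa v) = Fa (u \<boxtimes> v) \<cdot>\<^bsub>?D\<^esub> M (Dom C u) (Dom C v)"
      if "u \<in> Arr C" "v \<in> Arr C" for u v
      using that \<mu>_natural[OF that] by (simp add: D Fa_def M_def)
    show "Fa (Assoc C P Q R) \<cdot>\<^bsub>?D\<^esub> M P (Q \<boxdot> R) \<cdot>\<^bsub>?D\<^esub> (Ident ?D (cl P) \<boxtimes>\<^bsub>?D\<^esub> M Q R)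
      = M (P \<boxdot> Q) R \<cdot>\<^bsub>?D\<^esub> (M P Q \<boxtimes>\<^bsub>?D\<^esub> Ident ?D (cl R)) \<cdot>\<^bsub>?D\<^esub> Assoc ?D (cl P) (cl Q) (cl R)"
      if "P \<in> Obj C" "Q \<in> Obj C" "R \<in> Obj C" for P Q R
      using that \<mu>_assoc[OF that] by (simp add: D Fa_def M_def B.m_assoc)
    show "Fa (LUnit C Z) \<cdot>\<^bsub>?D\<^esub> M ?I Z \<cdot>\<^bsub>?D\<^esub> ((\<one>\<^bsub>B\<^esub>, \<iota>) \<boxtimes>\<^bsub>?D\<^esub> Ident ?D (cl Z)) = LUnit ?D (cl Z)"
      if "Z \<in> Obj C" for Z
      using that unit_l[OF that] by (simp add: D Fa_def M_def)
    show "Fa (RUnit C Z) \<cdot>\<^bsub>?D\<^esub> M Z ?I \<cdot>\<^bsub>?D\<^esub> (Ident ?D (cl Z) \<boxtimes>\<^bsub>?D\<^esub> (\<one>\<^bsub>B\<^esub>, \<iota>)) = RUnit ?D (cl Z)"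
      if "Z \<in> Obj C" for Z
      using that unit_r[OF that] by (simp add: D Fa_def M_def)
  qed (rule is_functor_Fa)
  moreover have "is_equivalence C ?D cl Fa"
    unfolding is_equivalence_def
  proof (intro conjI exI)
    \<comment> \<open>The quasi-inverse lets a scalar act on the chosen object of a class. The unit
      of the equivalence is \<open>\<theta>\<close>, and the counit consists of identities.\<close>
    let ?Ga = "\<lambda>u. snd u \<bullet> Ident C (X (fst u))"
    show "is_functor C ?D cl Fa" by (rule is_functor_Fa)
    show "is_functor ?D C X ?Ga"
      by (auto simp: is_functor_def D Hom_def A.m_comm)
    show "is_natural_iso C C (\<lambda>Z. Z) (\<lambda>u. u) (X \<circ> cl) (?Ga \<circ> Fa) \<theta>"
      by (auto simp: is_natural_iso_def Isom_eq_Hom \<theta> Fa_def F)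
    have "F (a \<bullet> Ident C (X x)) = a" if "x \<in> carrier B" "a \<in> carrier A" for x a
      by (rule F_eqI) (use that in simp_all)
    then show "is_natural_iso ?D ?D (cl \<circ> X) (Fa \<circ> ?Ga) (\<lambda>x. x) (\<lambda>u. u) (\<lambda>x. (x, \<one>\<^bsub>A\<^esub>))"
      unfolding is_natural_iso_def Isom_D by (auto simp: D Fa_def)
  qed
  ultimately show ?thesis unfolding monoidally_equivalent_def by blast
qed

theorem corollary5p3:
  fixes C :: "('o, 'm, 'z) monoidal_category_scheme"
    and A :: "('a, 'v) monoid_scheme" and B :: "('b, 'w) monoid_scheme"
    and \<alpha> :: "'a \<Rightarrow> 'm" and \<beta> :: "'o set \<Rightarrow> 'b"
    and X :: "'b \<Rightarrow> 'o" and c :: "'b \<Rightarrow> 'b \<Rightarrow> 'm"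
  assumes "grouplike_monoidal_groupoid C"
    and "comm_group A" and "comm_group B"
    and "\<alpha> \<in> iso A (pi1 C)" and "\<beta> \<in> iso (pi0 C) B"
    and "\<forall>x\<in>carrier B. \<forall>a\<in>carrier A. module_action C A \<alpha> \<beta> x a = a"
    and "cocycle_data C B \<beta> X c"
    and "\<forall>x\<in>carrier B. \<forall>y\<in>carrier B. \<forall>z\<in>carrier B.
           phi A (cocycle C A B \<alpha> X c) x y z = \<one>\<^bsub>A\<^esub>"
    and "trivial_alternating C B X c"
  shows "coboundary3 A B (cocycle C A B \<alpha> X c) \<and>
         monoidally_equivalent C (trivial_monoidal_groupoid B A)"
proof -
  interpret C: grouplike_monoidal_groupoid C by fact
  interpret B: comm_group B by fact
  have "central_grouplike_groupoid C A \<alpha>"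
    using assms C.central_if_trivial_action[OF assms(2,4,5,6)]
    by (simp add: central_grouplike_groupoid_def central_grouplike_groupoid_axioms_def)
  then interpret grouplike_cocycle C A \<alpha> B \<beta> X c
    using assms by (simp add: grouplike_cocycle_def grouplike_cocycle_axioms_def)
  obtain s where s: "\<And>x y. \<lbrakk>x \<in> carrier B; y \<in> carrier B\<rbrakk> \<Longrightarrow> s x y \<in> commutator_fibre C X x y"
    and plus1: "\<And>x x' y. \<lbrakk>x \<in> carrier B; x' \<in> carrier B; y \<in> carrier B\<rbrakk> \<Longrightarrow>
      s (x \<otimes>\<^bsub>B\<^esub> x') y = commutator_plus1 C X c x x' y (s x y) (s x' y)"
    and plus2: "\<And>x y y'. \<lbrakk>x \<in> carrier B; y \<in> carrier B; y' \<in> carrier B\<rbrakk> \<Longrightarrow>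
      s x (y \<otimes>\<^bsub>B\<^esub> y') = commutator_plus2 C X c x y y' (s x y) (s x y')"
    and diag: "\<And>x. x \<in> carrier B \<Longrightarrow> s x x = commutator_diagonal C X x"
    using assms(9) unfolding trivial_alternating_def by blast
  obtain \<sigma> where \<sigma>: "\<And>x y. \<lbrakk>x \<in> carrier B; y \<in> carrier B\<rbrakk> \<Longrightarrow> \<sigma> x y \<in> carrier A"
    "\<And>x y. \<lbrakk>x \<in> carrier B; y \<in> carrier B\<rbrakk> \<Longrightarrow> c x y \<cdot>\<^bsub>C\<^esub> s x y = act (\<sigma> x y) (c y x)"
    by (rule commutator_sections[of s, OF s]) (assumption | rule that | simp)+
  interpret grouplike_commutator C A \<alpha> B \<beta> X c s \<sigma>
    by unfold_locales (use s \<sigma> in auto)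
  have "coboundary3 A B f"
    using assms(2,3) cocycle_closed \<sigma>(1) cocycle_pentagon
      commutator_hexagon1[OF _ _ _ plus1] commutator_hexagon2[OF _ _ _ plus2] commutator_diagonal[OF _ diag]
    by (rule alternating_3cocycle_coboundary[where s = \<sigma>])
  then obtain h where h: "h \<in> carrier B \<rightarrow> carrier B \<rightarrow> carrier A"
    "\<And>x y z. \<lbrakk>x \<in> carrier B; y \<in> carrier B; z \<in> carrier B\<rbrakk> \<Longrightarrow>
      f x y z = h y z \<otimes>\<^bsub>A\<^esub> inv\<^bsub>A\<^esub> h (x \<otimes>\<^bsub>B\<^esub> y) z \<otimes>\<^bsub>A\<^esub> h x (y \<otimes>\<^bsub>B\<^esub> z) \<otimes>\<^bsub>A\<^esub> inv\<^bsub>A\<^esub> h x y"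
    unfolding coboundary3_def by blast
  \<comment> \<open>The equivalence statement does not mention the chosen arrows, so they may be
    replaced by rescaled ones whose cocycle is 1.\<close>
  interpret c': grouplike_cocycle C A \<alpha> B \<beta> X "\<lambda>x y. act (h x y) (c x y)"
    by (rule trivialised_data(1)[OF h])
  have "monoidally_equivalent C (trivial_monoidal_groupoid B A)"
    using assms(5) trivialised_data(2)[OF h] by (rule c'.monoidally_equivalent_trivial)
  with \<open>coboundary3 A B f\<close> show ?thesis ..
qed

end
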